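(* For every integer $n\geqslant 4$, the volume of the Fermat function field lattice $\Lambda_n$ is $$V(\Lambda_n)=\begin{cases}\sqrt{3n}\cdot n^{3n-7}, & \text{if } n \text{ is odd},\\ 2\sqrt{3n}\cdot n^{3n-7}, & \text{if } n\text{ is even}.\end{cases}$$
   Context: Let $n\geqslant 4$. $\mathcal F_n$ is the Fermat curve $X^n+Y^n=Z^n$ over $\mathbb C$ (a non-singular plane curve), and $F_n=\mathbb C(x,y)$ with $x^n+y^n=1$ is its function field ($x=X/Z$, $y=Y/Z$). Let $\zeta$ be a primitive $n$-th root of unity and $\varepsilon$ a primitive $n$-th root of $-1$. The set $\mathcal P$ consists of the $3n$ points of $\mathcal F_n$ having exactly one zero coordinate: $a_j=(0:\zeta^j:1)$, $b_j=(\zeta^j:0:1)$, $c_j=(\varepsilon\zeta^j:1:0)$, $j=0,\dots,n-1$; points of $\mathcal F_n$ are identified with places of $F_n$. Let $\mathcal O_{\mathcal P}^*$ be the multiplicative group of those $z\in F_n^*$ all of whose zeros and poles lie in $\mathcal P$. The lattice $\Lambda_n\subset\mathbb R^{3n}$ is the image of the homomorphism $\mathcal O_{\mathcal P}^*\to\mathbb Z^{3n}$, $z\mapsto (v_P(z))_{P\in\mathcal P}$, where $v_P$ is the discrete valuation at $P$. The volume of a lattice with $\mathbb Z$-basis given by linearly independent column vectors $v_1,\dots,v_m$ is $V(\Lambda)=\sqrt{\det(B^TB)}$, where $B=[v_1|\cdots|v_m]$. *)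

theory Defs
  imports
    "HOL-Algebra.Algebraic_Closure_Type"
    "Jordan_Normal_Form.Determinant"
    Complex_Main
begin

text \<open>
  For \<open>c = 1\<close> these are the primitive \<open>n\<close>-th roots of unity, for \<open>c = -1\<close> the primitive
  \<open>n\<close>-th roots of \<open>-1\<close> (equivalently, the primitive \<open>2n\<close>-th roots of unity).
\<close>
definition is_primitive_root :: "nat \<Rightarrow> complex \<Rightarrow> complex \<Rightarrow> bool" where
  "is_primitive_root n c z \<longleftrightarrow> z ^ n = c \<and> (\<forall>m. 0 < m \<and> m < n \<longrightarrow> z ^ m \<noteq> c)"


subsection \<open>The Fermat function field\<close>

text \<open>
  The fields \<open>F\<^sub>n = \<complex>(x, y)\<close> for the various \<open>n\<close> are realised as subfields of one type, an
  algebraic closure of the rational function field \<open>\<complex>(x)\<close>. The generator \<open>x\<close> is the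
  indeterminate; \<open>y\<close> is kept as a parameter, subject to \<open>x^n + y^n = 1\<close>.
\<close>
type_synonym ambient = "complex poly fract alg_closure"

definition const :: "complex \<Rightarrow> ambient" where
  "const c = to_ac (to_fract [:c:])"

definition gen_x :: ambient where
  "gen_x = to_ac (to_fract [:0, 1:])"

inductive_set fermat_field :: "ambient \<Rightarrow> ambient set" for y :: ambient where
  const: "const c \<in> fermat_field y"
| gen_x: "gen_x \<in> fermat_field y"
| gen_y: "y \<in> fermat_field y"
| add: "u \<in> fermat_field y \<Longrightarrow> v \<in> fermat_field y \<Longrightarrow> u + v \<in> fermat_field y"
| diff: "u \<in> fermat_field y \<Longrightarrow> v \<in> fermat_field y \<Longrightarrow> u - v \<in> fermat_field y"
| mult: "u \<in> fermat_field y \<Longrightarrow> v \<in> fermat_field y \<Longrightarrow> u * v \<in> fermat_field y"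
| inverse: "u \<in> fermat_field y \<Longrightarrow> inverse u \<in> fermat_field y"


subsection \<open>Points of the Fermat curve\<close>

text \<open>A point of the projective plane is the set of all its homogeneous coordinate triples.\<close>
type_synonym point = "(complex \<times> complex \<times> complex) set"

definition proj_point :: "complex \<Rightarrow> complex \<Rightarrow> complex \<Rightarrow> point" where
  "proj_point a b c = {(l * a, l * b, l * c) | l. l \<noteq> 0}"

definition fermat_curve :: "nat \<Rightarrow> point set" where
  "fermat_curve n =
     {proj_point a b c | a b c. (a, b, c) \<noteq> (0, 0, 0) \<and> a ^ n + b ^ n = c ^ n}"

text \<open>
  The points \<open>a\<^sub>j\<close>, \<open>b\<^sub>j\<close>, \<open>c\<^sub>j\<close> with \<open>0 \<le> j < n\<close>, listed in this order and numbered from \<open>0\<close>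
  to \<open>3n - 1\<close>.
\<close>
definition special_point :: "nat \<Rightarrow> complex \<Rightarrow> complex \<Rightarrow> nat \<Rightarrow> point" where
  "special_point n \<zeta> \<epsilon> i =
     (if i < n then proj_point 0 (\<zeta> ^ i) 1
      else if i < 2 * n then proj_point (\<zeta> ^ (i - n)) 0 1
      else proj_point (\<epsilon> * \<zeta> ^ (i - 2 * n)) 1 0)"

definition special_points :: "nat \<Rightarrow> complex \<Rightarrow> complex \<Rightarrow> point set" where
  "special_points n \<zeta> \<epsilon> = special_point n \<zeta> \<epsilon> ` {..<3 * n}"


subsection \<open>Local rings and valuations\<close>

text \<open>
  The value at \<open>(a, b, c)\<close> of the ternary form of degree \<open>d\<close> in which \<open>X^i Y^j Z^(d-i-j)\<close> has
  coefficient \<open>f i j\<close>; \<open>k\<close> embeds the coefficients into the ring of values.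
\<close>
definition form :: "(complex \<Rightarrow> 'a::comm_ring_1) \<Rightarrow> nat \<Rightarrow> (nat \<Rightarrow> nat \<Rightarrow> complex)
    \<Rightarrow> 'a \<Rightarrow> 'a \<Rightarrow> 'a \<Rightarrow> 'a" where
  "form k d f a b c = (\<Sum>i\<le>d. \<Sum>j\<le>d - i. k (f i j) * a ^ i * b ^ j * c ^ (d - i - j))"

text \<open>
  Rational functions regular at \<open>P\<close>, i.e. quotients of two forms of the same degree with the
  denominator not vanishing at \<open>P\<close>, evaluated at the generic point \<open>(x : y : 1)\<close>.
  As \<open>P\<close> lies on the curve, such a denominator is nonzero in the function field.
\<close>
definition local_ring :: "ambient \<Rightarrow> point \<Rightarrow> ambient set" where
  "local_ring y P =
     {form const d f gen_x y 1 / form const d g gen_x y 1 | d f g.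
        \<forall>(a, b, c) \<in> P. form (\<lambda>q. q) d g a b c \<noteq> 0}"

definition place :: "ambient \<Rightarrow> point \<Rightarrow> ambient set" where
  "place y P =
     {form const d f gen_x y 1 / form const d g gen_x y 1 | d f g.
        \<forall>(a, b, c) \<in> P. form (\<lambda>q. q) d f a b c = 0 \<and> form (\<lambda>q. q) d g a b c \<noteq> 0}"

definition uniformizer :: "ambient \<Rightarrow> point \<Rightarrow> ambient \<Rightarrow> bool" where
  "uniformizer y P t \<longleftrightarrow> place y P = (\<lambda>r. t * r) ` local_ring y P"

definition local_unit :: "ambient \<Rightarrow> point \<Rightarrow> ambient \<Rightarrow> bool" where
  "local_unit y P u \<longleftrightarrow> u \<noteq> 0 \<and> u \<in> local_ring y P \<and> inverse u \<in> local_ring y P"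

text \<open>The discrete valuation at \<open>P\<close>; meaningful only for nonzero \<open>z\<close> in \<open>F\<^sub>n\<close>.\<close>
definition valuation :: "ambient \<Rightarrow> point \<Rightarrow> ambient \<Rightarrow> int" where
  "valuation y P z =
     (THE k. \<exists>t u. uniformizer y P t \<and> local_unit y P u \<and> z = u * t powi k)"


subsection \<open>The Fermat function field lattice\<close>

definition special_units :: "nat \<Rightarrow> complex \<Rightarrow> complex \<Rightarrow> ambient \<Rightarrow> ambient set" where
  "special_units n \<zeta> \<epsilon> y =
     {z \<in> fermat_field y. z \<noteq> 0 \<and>
        (\<forall>P \<in> fermat_curve n. valuation y P z \<noteq> 0 \<longrightarrow> P \<in> special_points n \<zeta> \<epsilon>)}"

definition fermat_lattice :: "nat \<Rightarrow> complex \<Rightarrow> complex \<Rightarrow> ambient \<Rightarrow> real vec set" where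
  "fermat_lattice n \<zeta> \<epsilon> y =
     (\<lambda>z. vec (3 * n) (\<lambda>i. real_of_int (valuation y (special_point n \<zeta> \<epsilon> i) z)))
       ` special_units n \<zeta> \<epsilon> y"

definition is_lattice_basis :: "nat \<Rightarrow> real vec list \<Rightarrow> real vec set \<Rightarrow> bool" where
  "is_lattice_basis N vs L \<longleftrightarrow>
     set vs \<subseteq> carrier_vec N \<and>
     (\<forall>c \<in> carrier_vec (length vs). mat_of_cols N vs *\<^sub>v c = 0\<^sub>v N \<longrightarrow> c = 0\<^sub>v (length vs)) \<and>
     L = {mat_of_cols N vs *\<^sub>v c | c. c \<in> carrier_vec (length vs) \<and> (\<forall>i < length vs. c $ i \<in> \<int>)}"

text \<open>
  Does not depend on the choice of the basis; unspecified if \<open>L\<close> is not a lattice.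
\<close>
definition lattice_volume :: "nat \<Rightarrow> real vec set \<Rightarrow> real" where
  "lattice_volume N L =
     (THE V. \<exists>vs. is_lattice_basis N vs L \<and>
        V = sqrt (det (transpose_mat (mat_of_cols N vs) * mat_of_cols N vs)))"

end

theory Submission
  imports Defs "Jordan_Normal_Form.Char_Poly" "HOL-Computational_Algebra.Formal_Laurent_Series"
begin

text \<open>
  Write the divisor of a unit as three functions \<open>p\<close>, \<open>q\<close>, \<open>r\<close> on \<open>\<int>/n\<close>, its orders at the \<open>a\<^sub>j\<close>,
  \<open>b\<^sub>j\<close>, \<open>c\<^sub>j\<close>. The automorphisms \<open>x \<mapsto> \<zeta>x\<close> and \<open>y \<mapsto> \<zeta>y\<close> translate the indices of two of the three
  families and fix the third one pointwise, so that differences of divisors of units are supported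
  on fewer families, and a principal divisor supported on one family is constant modulo \<open>n\<close>. Hence
  the second differences of \<open>p\<close>, \<open>q\<close>, \<open>r\<close> are all congruent modulo \<open>n\<close> to one constant, which has to
  be even if \<open>n\<close> is even, and if it vanishes then the slopes of \<open>p\<close>, \<open>q\<close>, \<open>r\<close> satisfy one linear relation
  modulo \<open>n\<close>. Conversely, all divisors of degree \<open>0\<close> divisible by \<open>n\<close> are principal because of the
  functions \<open>x - \<zeta>\<^sup>j\<close>, \<open>y - \<zeta>\<^sup>j\<close> and their images under \<open>(x, y) \<mapsto> (1/x, y/(\<epsilon>x))\<close>, and Hilbert's
  Theorem 90 for the two automorphisms provides units realising the remaining slopes and second
  differences. This yields a basis in echelon form, with five pivots \<open>1\<close>, one pivot \<open>1\<close> or \<open>2\<close>, and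
  \<open>3n - 7\<close> pivots \<open>n\<close>, of a lattice in the hyperplane of vectors with coordinate sum \<open>0\<close>; the latter
  accounts for the factor \<open>\<surd>(3n)\<close>.
\<close>

subsection \<open>The field generated by the coordinates\<close>

text \<open>The valuation is a definite description over quotients of forms, so none of its laws is
  available at the start. It becomes computable through embeddings of the field into Laurent series,
  one for each point of the curve: an embedding that takes some element to a series of order 1
  computes the valuation as the order. Each embedding, and each automorphism, is a substitution for
  x and y, and that it is well defined rests on y having degree n over C(x). Divisor theory is
  replaced by norms to C(y), where zeros and poles are explicit: this yields that functions without
  poles have no zeros, and that units have degree 0. Parity enters because 0 + ... + (n-1) =
  n(n-1)/2 is divisible by n only for odd n: the first differences of a periodic function sum to 0
  over a period, while a second difference c makes that sum congruent to c n(n-1)/2 modulo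
  n.\<close>

definition ev :: "(complex \<Rightarrow> 'b::comm_ring_1) \<Rightarrow> 'b \<Rightarrow> 'b \<Rightarrow> complex poly poly \<Rightarrow> 'b" where
  "ev k a b p = poly (map_poly (\<lambda>c. poly (map_poly k c) a) p) b"

lemma comm_ring_hom_eval:
  assumes "comm_ring_hom k"
  shows "comm_ring_hom (\<lambda>p. poly (map_poly k p) a)"
proof -
  interpret k: comm_ring_hom k by fact
  interpret m: map_poly_comm_ring_hom k ..
  show ?thesis
    by unfold_locales (simp_all add: hom_distribs)
qed

lemma comm_ring_hom_ev:
  assumes "comm_ring_hom k"
  shows "comm_ring_hom (ev k a b)"
  unfolding ev_def by (intro comm_ring_hom_eval assms)

lemma ev_poly:
  assumes "comm_ring_hom k"
  shows "ev k a b [:p:] = poly (map_poly k p) a"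
proof -
  interpret e: comm_ring_hom "\<lambda>p. poly (map_poly k p) a"
    by (rule comm_ring_hom_eval) fact
  show ?thesis
    by (simp add: ev_def Polynomial.map_poly_pCons)
qed

lemma ev_simps:
  assumes "comm_ring_hom k"
  shows "ev k a b [:[:c:]:] = k c" "ev k a b [:[:0, 1:]:] = a" "ev k a b [:0, 1:] = b"
proof -
  interpret k: comm_ring_hom k by fact
  show "ev k a b [:[:c:]:] = k c" "ev k a b [:[:0, 1:]:] = a" "ev k a b [:0, 1:] = b"
    by (simp_all add: ev_poly[OF assms] Polynomial.map_poly_pCons) (simp add: ev_def Polynomial.map_poly_pCons)
qed

lemma comm_ring_hom_const: "comm_ring_hom const"
proof
  have add: "[:x + y:] = [:x:] + [:y:]" and mult: "[:x * y:] = [:x:] * [:y:]" for x y :: complex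
    by simp_all
  show "const (x + y) = const x + const y" "const (x * y) = const x * const y" for x y
    unfolding const_def add mult by (simp_all only: to_fract_add to_fract_mult to_ac_add to_ac_mult)
qed (simp_all add: const_def flip: one_pCons)

lemma map_poly_const_gen_x: "poly (map_poly const p) gen_x = to_ac (to_fract p)"
proof (induction p)
  case (pCons c p)
  interpret k: comm_ring_hom const by (rule comm_ring_hom_const)
  have "to_ac (to_fract (pCons c p)) = to_ac (to_fract ([:c:] + [:0, 1:] * p))"
    by simp
  also have "\<dots> = const c + gen_x * to_ac (to_fract p)"
    unfolding to_fract_add to_fract_mult to_ac_add to_ac_mult by (simp add: const_def gen_x_def)
  finally show ?case using pCons by (simp add: map_poly_pCons)
qed simp

lemma gen_x_transcendental: "poly (map_poly const p) gen_x = 0 \<longleftrightarrow> p = 0"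
  unfolding map_poly_const_gen_x by simp

text \<open>The derivative n X^(n-1) does not vanish at b, so b is a simple root. Used with b = 1
  for 1 - X^n, and later for the factor y - b of y^n - b^n.\<close>

lemma order_monom_minus:
  assumes "n > 0" "b \<noteq> 0"
  shows "order b (monom 1 n - [:b ^ n:] :: complex poly) = 1"
proof -
  let ?p = "monom 1 n - [:b ^ n:] :: complex poly"
  have p: "pderiv ?p = monom (of_nat n) (n - 1)"
    by (simp add: pderiv_diff pderiv_monom)
  have "order b ?p = Suc (order b (pderiv ?p))"
  proof (rule order_pderiv)
    show "?p \<noteq> 0"
    proof
      assume "?p = 0"
      hence "coeff ?p 0 = 0" by simp
      thus False using assms by simp
    qed
    show "poly ?p b = 0"
      by (simp add: poly_monom)
  qed
  also have "order b (pderiv ?p) = 0"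
    unfolding p by (rule order_0I) (use assms in \<open>simp add: poly_monom\<close>)
  finally show ?thesis by simp
qed

lemma order_one_minus_monom:
  assumes "n > 0"
  shows "order 1 (1 - monom 1 n :: complex poly) = 1"
proof -
  have "1 - monom 1 n = - (monom 1 n - [:1 ^ n:] :: complex poly)" by (simp add: one_pCons)
  thus ?thesis using order_monom_minus[OF assms, of 1] by (simp only: order_uminus) simp
qed

text \<open>Compare orders at 1: the two n-th powers contribute multiples of n, and the simple zero
  of 1 - X^n contributes d.\<close>

lemma n_dvd_of_power_eq:
  fixes a b :: "complex poly"
  assumes "n > 0" "b \<noteq> 0" "a ^ n = b ^ n * (smult ((-1) ^ n) (1 - monom 1 n)) ^ d"
  shows "n dvd d"
proof -
  have nz: "1 - monom 1 n \<noteq> (0::complex poly)"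
  proof
    assume "1 - monom 1 n = (0::complex poly)"
    hence "coeff (1 - monom 1 n) 0 = (0::complex)" by simp
    thus False using assms(1) by simp
  qed
  have op: "order 1 (p ^ k) = k * order 1 p" if "p \<noteq> 0" for p :: "complex poly" and k
  proof (induction k)
    case (Suc k)
    show ?case using that Suc by (simp add: order_mult)
  qed simp
  let ?c = "smult ((-1) ^ n) (1 - monom 1 n) :: complex poly"
  have c: "?c \<noteq> 0" using nz by simp
  have oc: "order 1 ?c = 1" using order_one_minus_monom[OF assms(1)] by (simp add: order_smult)
  have "a ^ n \<noteq> 0" unfolding assms(3) using assms(2) c by simp
  hence "a \<noteq> 0" using assms(1) by (metis zero_power)
  hence "n * order 1 a = order 1 (b ^ n * ?c ^ d)" using op[of a n] assms(3) by simp
  also have "\<dots> = n * order 1 b + d"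
    using assms(2) c oc by (subst order_mult) (simp_all add: op)
  finally show ?thesis by (metis dvd_add_right_iff dvd_triv_left)
qed

text \<open>
  Kummer theory: the conjugates of \<open>y\<close> are its multiples by roots of unity, so the \<open>n\<close>-th power
  of the constant coefficient of the minimal polynomial of \<open>y\<close> over \<open>\<complex>(x)\<close> is, up to sign, a power
  of \<open>1 - x^n\<close>, which has a simple zero at \<open>1\<close>.
\<close>
lemma degree_generator_ge:
  fixes g :: "complex poly fract poly"
  assumes n: "n > 0" and y: "gen_x ^ n + y ^ n = 1"
    and g: "g \<noteq> 0" "poly (map_poly to_ac g) y = 0"
  shows "n \<le> degree g"
proof -
  interpret ac: inj_comm_ring_hom "to_ac :: complex poly fract \<Rightarrow> _"
    by unfold_locales simp_all
  interpret mac: map_poly_inj_comm_ring_hom "to_ac :: complex poly fract \<Rightarrow> _" ..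
  define S where "S = {h :: complex poly fract poly. h \<noteq> 0 \<and> poly (map_poly to_ac h) y = 0}"
  have "\<exists>h. h \<in> S \<and> (\<forall>h'. h' \<in> S \<longrightarrow> degree h \<le> degree h')"
    by (rule ex_has_least_nat[of _ g]) (use g in \<open>auto simp: S_def\<close>)
  then obtain h where h: "h \<in> S" and least: "\<And>h'. h' \<in> S \<Longrightarrow> degree h \<le> degree h'" by blast
  have h0: "h \<noteq> 0" "poly (map_poly to_ac h) y = 0" using h by (auto simp: S_def)
  define xx :: "complex poly fract" where "xx = to_fract [:0, 1:]"
  define m :: "complex poly fract poly" where "m = Polynomial.monom 1 n - [:1 - xx ^ n:]"
  have m_root: "poly (map_poly to_ac m) t = 0 \<longleftrightarrow> t ^ n = 1 - gen_x ^ n" for t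
    by (simp add: m_def hom_distribs poly_monom xx_def gen_x_def map_poly_pCons)
  \<comment> \<open>By minimality of h the relation T^n = 1 - x^n is a multiple of h, so every root
    of h is an n-th root of 1 - x^n.\<close>
  have "m mod h = 0"
  proof (rule ccontr)
    assume "m mod h \<noteq> 0"
    moreover from this have "degree (m mod h) < degree h"
      using degree_mod_less[of h m] h0 by simp
    moreover have "poly (map_poly to_ac (m mod h)) y = 0"
    proof -
      have "map_poly to_ac m = map_poly to_ac h * map_poly to_ac (m div h) + map_poly to_ac (m mod h)"
        by (metis mac.hom_add mac.hom_mult mult_div_mod_eq)
      hence "poly (map_poly to_ac m) y = poly (map_poly to_ac (m mod h)) y" using h0 by simp
      moreover have "poly (map_poly to_ac m) y = 0"
        unfolding m_root using y by (metis add_diff_cancel_left')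
      ultimately show ?thesis by simp
    qed
    ultimately show False using least[of "m mod h"] by (simp add: S_def)
  qed
  then obtain q where q: "m = h * q" by (metis dvdE mod_eq_0_iff_dvd)
  define H where "H = map_poly to_ac h"
  have H0: "H \<noteq> 0" using h0 by (simp add: H_def)
  have dH: "degree H = degree h" by (simp add: H_def)
  obtain R where R: "size R = degree H" "H = smult (lead_coeff H) (\<Prod>x\<in>#R. [:-x, 1:])"
    using alg_closed_imp_factorization[OF H0] by blast
  have Rn: "x ^ n = 1 - gen_x ^ n" if "x \<in># R" for x
  proof -
    have "poly H x = 0"
      by (subst R(2)) (use that in \<open>auto simp: poly_prod_mset prod_mset_zero_iff\<close>)
    hence "poly (map_poly to_ac m) x = 0" by (simp add: q hom_distribs H_def)
    thus ?thesis unfolding m_root .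
  qed
  have c0: "poly H 0 = lead_coeff H * (\<Prod>x\<in>#R. -x)"
    by (subst R(2)) (simp add: poly_prod_mset)
  have "(\<Prod>x\<in>#R. -x) ^ n = ((-1) ^ n * (1 - gen_x ^ n)) ^ size R"
    using Rn
  proof (induction R)
    case (add x R)
    have "(- x) ^ n = (-1) ^ n * (1 - gen_x ^ n)"
      using add.prems[of x] by (metis power_minus union_single_eq_member)
    moreover have "(\<Prod>x\<in>#R. -x) ^ n = ((-1) ^ n * (1 - gen_x ^ n)) ^ size R"
      by (rule add.IH) (rule add.prems, simp)
    moreover have "(\<Prod>x\<in>#add_mset x R. -x) ^ n = (- x) ^ n * (\<Prod>x\<in>#R. -x) ^ n"
      by (simp only: image_mset_add_mset prod_mset.add_mset power_mult_distrib)
    ultimately show ?case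
      by (simp only: size_add_mset power_Suc)
  qed simp
  hence pw: "poly H 0 ^ n = lead_coeff H ^ n * ((-1) ^ n * (1 - gen_x ^ n)) ^ degree h"
    by (simp add: c0 power_mult_distrib R(1) dH)
  have "to_ac (coeff h 0 ^ n) = to_ac (lead_coeff h ^ n * ((-1) ^ n * (1 - xx ^ n)) ^ degree h)"
    using pw by (simp add: H_def poly_0_coeff_0 xx_def gen_x_def hom_distribs)
  hence eq: "coeff h 0 ^ n = lead_coeff h ^ n * ((-1) ^ n * (1 - xx ^ n)) ^ degree h"
    by (simp only: to_ac_eq_iff)
  obtain a b where ab: "coeff h 0 / lead_coeff h = Fract a b" "b \<noteq> 0"
    by (cases "coeff h 0 / lead_coeff h") auto
  have lc: "lead_coeff h \<noteq> 0" using h0 by simp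
  have "(coeff h 0 / lead_coeff h) ^ n = ((-1) ^ n * (1 - xx ^ n)) ^ degree h"
    using eq lc by (simp add: power_divide)
  moreover have tfp: "to_fract (p ^ i) = to_fract p ^ i" for p :: "complex poly" and i
    by (induction i) simp_all
  have "(-1) ^ n * (1 - xx ^ n) = to_fract (smult ((-1) ^ n) (1 - monom 1 n))"
  proof -
    have "smult ((-1) ^ n) (1 - monom 1 n) = (-1) ^ n * (1 - [:0, 1::complex:] ^ n)"
      by (auto simp: monom_altdef minus_one_power_iff)
    thus ?thesis
      by (simp add: tfp xx_def)
  qed
  ultimately have "(to_fract a / to_fract b) ^ n = to_fract (smult ((-1) ^ n) (1 - monom 1 n) ^ degree h)"
    unfolding ab Fract_conv_to_fract tfp by simp
  hence "to_fract a ^ n = to_fract b ^ n * to_fract (smult ((-1) ^ n) (1 - monom 1 n) ^ degree h)"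
    using ab(2) by (simp add: power_divide field_simps)
  hence "to_fract (a ^ n) = to_fract (b ^ n * smult ((-1) ^ n) (1 - monom 1 n) ^ degree h)"
    by (simp add: tfp)
  hence "a ^ n = b ^ n * smult ((-1) ^ n) (1 - monom 1 n) ^ degree h"
    by (simp only: to_fract_eq_iff)
  hence "n dvd degree h" using n_dvd_of_power_eq[OF n ab(2)] by blast
  moreover have "degree h > 0"
  proof (rule ccontr)
    assume "\<not> degree h > 0"
    then obtain c where "h = [:c:]" by (meson degree_0_id gr0I degree_eq_zeroE)
    thus False using h0 by (simp add: map_poly_pCons)
  qed
  ultimately have "n \<le> degree h" by (simp add: dvd_imp_le)
  thus ?thesis using least[of g] g by (auto simp: S_def)
qed

text \<open>The image of the indeterminate is nonzero in a domain, so powers of the indeterminate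
  can be cancelled from an annihilating polynomial. The nonzero constant term then exhibits an
  algebraic element as a divisor of an element of the base.\<close>

lemma nonzero_coeff_0_ann:
  fixes f :: "'a::comm_ring_1 poly \<Rightarrow> 'b::idom"
  assumes "comm_ring_hom f" "f [:0, 1:] \<noteq> 0" "p \<noteq> 0" "f p = 0"
  shows "\<exists>p. coeff p 0 \<noteq> 0 \<and> f p = 0"
  using assms(3,4)
proof (induction p)
  case (pCons c p)
  interpret f: comm_ring_hom f by fact
  show ?case
  proof (cases "c = 0")
    case True
    hence "f [:0, 1:] * f p = 0" using pCons.prems by (simp flip: f.hom_mult)
    hence "f p = 0" using assms(2) by simp
    thus ?thesis using pCons True by auto
  next
    case False
    thus ?thesis using pCons by (intro exI[of _ "pCons c p"]) simp
  qed
qed simp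

section \<open>Substitution homomorphisms on the function field\<close>

locale fermat =
  fixes n :: nat and \<zeta> \<epsilon> :: complex and y :: ambient
  assumes n_ge: "n \<ge> 4"
    and zeta: "is_primitive_root n 1 \<zeta>"
    and eps: "is_primitive_root n (-1) \<epsilon>"
    and curve: "gen_x ^ n + y ^ n = 1"
begin

lemma n_pos: "n > 0" using n_ge by simp

abbreviation L :: "ambient set" where "L \<equiv> fermat_field y"
abbreviation E :: "complex poly poly \<Rightarrow> ambient" where "E \<equiv> ev const gen_x y"

sublocale E: comm_ring_hom E by (rule comm_ring_hom_ev[OF comm_ring_hom_const])
sublocale const: comm_ring_hom const by (rule comm_ring_hom_const)

lemma const_eq_0_iff [simp]: "const c = 0 \<longleftrightarrow> c = 0"
  by (simp add: const_def)

lemma const_eq_iff [simp]: "const c = const d \<longleftrightarrow> c = d"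
  by (simp add: const_def)

lemma L_0 [simp, intro]: "0 \<in> L" and L_1 [simp, intro]: "1 \<in> L"
  using fermat_field.const[of 0] fermat_field.const[of 1] by simp_all

lemmas L_gens [simp, intro] = fermat_field.const fermat_field.gen_x fermat_field.gen_y
lemmas L_ops [simp, intro] = fermat_field.add fermat_field.diff fermat_field.mult fermat_field.inverse

lemma L_uminus [simp, intro]: "u \<in> L \<Longrightarrow> - u \<in> L"
  using fermat_field.diff[of 0 y u] by simp

lemma L_divide [simp, intro]: "u \<in> L \<Longrightarrow> v \<in> L \<Longrightarrow> u / v \<in> L"
  by (simp add: field_class.field_divide_inverse)

lemma L_power [simp, intro]: "u \<in> L \<Longrightarrow> u ^ i \<in> L"
  by (induction i) auto

lemma L_power_int [simp, intro]: "u \<in> L \<Longrightarrow> u powi i \<in> L"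
  by (auto simp: power_int_def)

lemma L_sum [simp, intro]: "(\<And>i. i \<in> I \<Longrightarrow> f i \<in> L) \<Longrightarrow> sum f I \<in> L"
  by (induction I rule: infinite_finite_induct) auto

lemma L_prod [simp, intro]: "(\<And>i. i \<in> I \<Longrightarrow> f i \<in> L) \<Longrightarrow> prod f I \<in> L"
  by (induction I rule: infinite_finite_induct) auto

lemma L_E: "z \<in> L \<Longrightarrow> \<exists>p q. E q \<noteq> 0 \<and> z = E p / E q"
proof (induction rule: fermat_field.induct)
  case (const c)
  show ?case by (intro exI[of _ "[:[:c:]:]"] exI[of _ 1]) (simp add: ev_simps[OF comm_ring_hom_const])
next
  case gen_x
  show ?case by (intro exI[of _ "[:[:0, 1:]:]"] exI[of _ 1]) (simp add: ev_simps[OF comm_ring_hom_const])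
next
  case gen_y
  show ?case by (intro exI[of _ "[:0, 1:]"] exI[of _ 1]) (simp add: ev_simps[OF comm_ring_hom_const])
next
  case (add u v)
  then obtain p q p' q' where "E q \<noteq> 0" "u = E p / E q" "E q' \<noteq> 0" "v = E p' / E q'" by blast
  thus ?case
    by (intro exI[of _ "p * q' + p' * q"] exI[of _ "q * q'"]) (simp add: hom_distribs add_frac_eq)
next
  case (diff u v)
  then obtain p q p' q' where "E q \<noteq> 0" "u = E p / E q" "E q' \<noteq> 0" "v = E p' / E q'" by blast
  thus ?case
    by (intro exI[of _ "p * q' - p' * q"] exI[of _ "q * q'"]) (simp add: hom_distribs diff_frac_eq)
next
  case (mult u v)
  then obtain p q p' q' where "E q \<noteq> 0" "u = E p / E q" "E q' \<noteq> 0" "v = E p' / E q'" by blast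
  thus ?case
    by (intro exI[of _ "p * p'"] exI[of _ "q * q'"]) (simp add: hom_distribs)
next
  case (inverse u)
  then obtain p q where pq: "E q \<noteq> 0" "u = E p / E q" by blast
  show ?case
  proof (cases "E p = 0")
    case True
    thus ?thesis using pq by (intro exI[of _ 0] exI[of _ 1]) simp
  next
    case False
    thus ?thesis using pq by (intro exI[of _ q] exI[of _ p]) simp
  qed
qed

text \<open>The conditions concern L only: such a map is a total function on the ambient field, and
  \<open>lift_exists\<close> leaves its values outside L arbitrary.\<close>

definition lhom :: "(ambient \<Rightarrow> 'b::field) \<Rightarrow> bool" where
  "lhom \<phi> \<longleftrightarrow> \<phi> 1 = 1 \<and> (\<forall>u\<in>L. \<forall>v\<in>L. \<phi> (u + v) = \<phi> u + \<phi> v \<and> \<phi> (u * v) = \<phi> u * \<phi> v)"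

text \<open>Pseudo-division by the equation of the curve, read as a polynomial in y, leaves a
  remainder of degree below n that vanishes at y; by \<open>degree_generator_ge\<close> it is the
  zero polynomial. The multiplier c brought in by pseudo-division is a nonzero polynomial in x, so
  its value at the transcendental a is nonzero and cancels.\<close>

lemma ev_eq_0:
  fixes k :: "complex \<Rightarrow> 'b::field"
  assumes k: "comm_ring_hom k" and ab: "a ^ n + b ^ n = 1"
    and tr: "\<And>p. poly (map_poly k p) a = 0 \<Longrightarrow> p = 0" and p: "E p = 0"
  shows "ev k a b p = 0"
proof -
  interpret k: comm_ring_hom k by fact
  interpret F: comm_ring_hom "ev k a b" by (rule comm_ring_hom_ev[OF k])
  define m :: "complex poly poly" where "m = [:0, 1:] ^ n - [:1 - [:0, 1:] ^ n:]"
  have m: "m = Polynomial.monom 1 n - [:1 - [:0, 1:] ^ n:]"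
    by (simp add: m_def monom_altdef)
  have split: "[:1 - [:0, 1:] ^ n:] = 1 - [:[:0,1:]:] ^ n"
    by (simp add: poly_const_pow one_pCons)
  have Em: "E m = 0"
    unfolding m_def split using curve
    by (simp add: hom_distribs ev_simps[OF comm_ring_hom_const] algebra_simps)
  have Fm: "ev k a b m = 0"
    unfolding m_def split using ab
    by (simp add: hom_distribs ev_simps[OF k] algebra_simps)
  have dm: "degree m = n"
  proof -
    have "degree (Polynomial.monom 1 n + - [:1 - [:0, 1:] ^ n:] :: complex poly poly)
        = degree (Polynomial.monom 1 n :: complex poly poly)"
      by (rule degree_add_eq_left) (use n_pos in \<open>simp add: degree_monom_eq\<close>)
    thus ?thesis by (simp only: m diff_conv_add_uminus degree_monom_eq[OF one_neq_zero])
  qed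
  hence m0: "m \<noteq> 0" using n_pos by auto
  obtain c q where cq: "c \<noteq> 0" "smult c p = m * q + pseudo_mod p m"
    using pseudo_mod(1)[OF m0] by blast
  have r: "pseudo_mod p m = 0 \<or> degree (pseudo_mod p m) < n"
    using pseudo_mod(2)[OF m0] dm by simp
  have "E (smult c p) = 0"
    using p E.hom_mult[of "[:c:]" p] by simp
  hence "E (pseudo_mod p m) = 0"
    using cq Em by (simp add: hom_distribs)
  hence "poly (map_poly to_ac (map_poly to_fract (pseudo_mod p m))) y = 0"
    by (subst map_poly_map_poly) (simp_all add: ev_def map_poly_const_gen_x o_def)
  moreover have "degree (map_poly to_fract (pseudo_mod p m)) = degree (pseudo_mod p m)"
    by (rule Polynomial.degree_map_poly) simp
  ultimately have "map_poly to_fract (pseudo_mod p m) = 0"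
    using degree_generator_ge[OF n_pos curve, of "map_poly to_fract (pseudo_mod p m)"] r by force
  hence "pseudo_mod p m = 0" by simp
  hence "ev k a b ([:c:] * p) = 0"
    using cq Fm by (simp add: hom_distribs)
  moreover have "ev k a b [:c:] \<noteq> 0"
    using tr cq(1) by (auto simp: ev_poly[OF k])
  ultimately show ?thesis by (simp only: F.hom_mult) simp
qed

text \<open>A nonzero \<open>E q\<close> is algebraic over C(x), so modulo the equation of the curve
  q divides a nonzero polynomial c in x alone. If q vanished at (a, b), then c would vanish at the
  transcendental a.\<close>

lemma ev_neq_0:
  fixes k :: "complex \<Rightarrow> 'b::field"
  assumes k: "comm_ring_hom k" and ab: "a ^ n + b ^ n = 1"
    and tr: "\<And>p. poly (map_poly k p) a = 0 \<Longrightarrow> p = 0" and q: "E q \<noteq> 0"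
  shows "ev k a b q \<noteq> 0"
proof
  assume q0: "ev k a b q = 0"
  interpret k: comm_ring_hom k by fact
  interpret F: comm_ring_hom "ev k a b" by (rule comm_ring_hom_ev[OF k])
  obtain P0 where P0: "P0 \<noteq> 0" "poly (map_poly to_ac P0) (E q) = 0"
    using alg_closure_algebraic[of "E q"] by blast
  have c1: "comm_ring_hom (\<lambda>p::complex poly. [:p:])"
    by unfold_locales (simp_all add: one_pCons)
  define f where "f = (\<lambda>P. E (poly (map_poly (\<lambda>p. [:p:]) P) q))"
  interpret p1: comm_ring_hom "\<lambda>P. poly (map_poly (\<lambda>p::complex poly. [:p:]) P) q"
    by (rule comm_ring_hom_eval[OF c1])
  have f: "comm_ring_hom f"
    unfolding f_def by unfold_locales (simp_all add: hom_distribs)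
  have f_eq: "f P = poly (map_poly (to_ac \<circ> to_fract) P) (E q)" for P
    by (induction P) (simp_all add: f_def Polynomial.map_poly_pCons hom_distribs
        ev_poly[OF comm_ring_hom_const] map_poly_const_gen_x)
  \<comment> \<open>Denominators in x are cleared, so that the coefficients of P lie in C[x] and P
    can be evaluated inside \<open>E\<close>.\<close>
  define P where "P = primitive_part_fract P0"
  have P0': "P0 = smult (fract_content P0) (fract_poly P)"
    by (simp add: P_def content_times_primitive_part_fract)
  hence "P \<noteq> 0" "fract_content P0 \<noteq> 0" using P0 by auto
  have "map_poly to_ac P0 = map_poly to_ac (smult (fract_content P0) (fract_poly P))"
    using P0' by simp
  also have "\<dots> = smult (to_ac (fract_content P0)) (map_poly (to_ac \<circ> to_fract) P)"
    by (simp add: map_poly_smult map_poly_map_poly)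
  finally have "f P = 0"
    using P0 \<open>fract_content P0 \<noteq> 0\<close> by (simp add: f_eq)
  moreover have "f [:0, 1:] \<noteq> 0" using q by (simp add: f_def Polynomial.map_poly_pCons)
  ultimately obtain P where P: "coeff P 0 \<noteq> 0" "f P = 0"
    using nonzero_coeff_0_ann[OF f] \<open>P \<noteq> 0\<close> by metis
  obtain c P' where cP: "P = pCons c P'" by (cases P)
  have "E ([:c:] + q * poly (map_poly (\<lambda>p. [:p:]) P') q) = 0"
    using P(2) by (simp add: f_def cP Polynomial.map_poly_pCons)
  hence "ev k a b ([:c:] + q * poly (map_poly (\<lambda>p. [:p:]) P') q) = 0"
    using ev_eq_0[OF k ab tr] by blast
  hence "ev k a b [:c:] = 0" using q0 by (simp only: F.hom_add F.hom_mult) simp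
  hence "c = 0" using tr by (simp add: ev_poly[OF k])
  thus False using P(1) cP by simp
qed

text \<open>The universal property of the function field: \<open>ev_eq_0\<close> makes the value of
  a fraction independent of its representation and \<open>ev_neq_0\<close> keeps denominators
  nonzero. Laurent expansions and automorphisms are both obtained from it.\<close>

lemma lift_exists:
  fixes k :: "complex \<Rightarrow> 'b::field"
  assumes k: "comm_ring_hom k" and ab: "a ^ n + b ^ n = 1"
    and tr: "\<And>p. poly (map_poly k p) a = 0 \<Longrightarrow> p = 0"
  obtains \<phi> where "lhom \<phi>" "\<phi> gen_x = a" "\<phi> y = b" "\<And>c. \<phi> (const c) = k c"
proof -
  interpret k: comm_ring_hom k by fact
  interpret F: comm_ring_hom "ev k a b" by (rule comm_ring_hom_ev[OF k])
  let ?F = "ev k a b"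
  define \<phi> where "\<phi> = (\<lambda>z. SOME w. \<exists>p q. E q \<noteq> 0 \<and> z = E p / E q \<and> w = ?F p / ?F q)"
  have nz: "?F q \<noteq> 0" if "E q \<noteq> 0" for q using ev_neq_0[OF k ab tr that] .
  have \<phi>: "\<phi> (E p / E q) = ?F p / ?F q" if "E q \<noteq> 0" for p q
    unfolding \<phi>_def
  proof (rule someI2_ex, goal_cases)
    case 1
    thus ?case using that by blast
  next
    case (2 w)
    then obtain p' q' where w: "E q' \<noteq> 0" "E p / E q = E p' / E q'" "w = ?F p' / ?F q'" by blast
    hence "E (p * q' - p' * q) = 0" using that by (simp add: hom_distribs frac_eq_eq)
    hence "?F (p * q' - p' * q) = 0" using ev_eq_0[OF k ab tr] by blast
    thus ?case using nz[OF that] nz[OF w(1)] w(3) by (simp add: hom_distribs frac_eq_eq)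
  qed
  have \<phi>1: "\<phi> (E p) = ?F p" for p using \<phi>[of 1 p] by simp
  have 1: "lhom \<phi>"
    unfolding lhom_def
  proof (intro conjI ballI)
    show "\<phi> 1 = 1" using \<phi>1[of 1] by simp
  next
    fix u v assume "u \<in> L" "v \<in> L"
    then obtain p q p' q' where
      *: "E q \<noteq> 0" "u = E p / E q" "E q' \<noteq> 0" "v = E p' / E q'" using L_E by meson
    have "E (q * q') \<noteq> 0" using * by (simp add: hom_distribs)
    have uv: "\<phi> u = ?F p / ?F q" "\<phi> v = ?F p' / ?F q'" using * \<phi> by auto
    have "u + v = E (p * q' + p' * q) / E (q * q')" using * by (simp add: hom_distribs add_frac_eq)
    hence "\<phi> (u + v) = ?F (p * q' + p' * q) / ?F (q * q')" using \<phi>[OF \<open>E (q * q') \<noteq> 0\<close>] by simp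
    thus "\<phi> (u + v) = \<phi> u + \<phi> v"
      unfolding uv using nz[OF *(1)] nz[OF *(3)] by (simp add: hom_distribs add_frac_eq)
    have "u * v = E (p * p') / E (q * q')" using * by (simp add: hom_distribs)
    hence "\<phi> (u * v) = ?F (p * p') / ?F (q * q')" using \<phi>[OF \<open>E (q * q') \<noteq> 0\<close>] by simp
    thus "\<phi> (u * v) = \<phi> u * \<phi> v"
      unfolding uv by (simp add: hom_distribs)
  qed
  have 2: "\<phi> gen_x = a" "\<phi> y = b"
    using \<phi>1[of "[:[:0,1:]:]"] \<phi>1[of "[:0,1:]"]
    by (simp_all only: ev_simps[OF k] ev_simps[OF comm_ring_hom_const])
  have 3: "\<phi> (const c) = k c" for c
    using \<phi>1[of "[:[:c:]:]"] by (simp only: ev_simps[OF k] ev_simps[OF comm_ring_hom_const])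
  show ?thesis by (rule that[OF 1 2 3])
qed

subsection \<open>Branches and local rings\<close>

context
  fixes \<phi> :: "ambient \<Rightarrow> 'b::field"
  assumes \<phi>: "lhom \<phi>"
begin

lemma lhom_1: "\<phi> 1 = 1"
  using \<phi> by (simp add: lhom_def)

lemma lhom_add: "u \<in> L \<Longrightarrow> v \<in> L \<Longrightarrow> \<phi> (u + v) = \<phi> u + \<phi> v"
  using \<phi> by (simp add: lhom_def)

lemma lhom_mult: "u \<in> L \<Longrightarrow> v \<in> L \<Longrightarrow> \<phi> (u * v) = \<phi> u * \<phi> v"
  using \<phi> by (simp add: lhom_def)

lemma lhom_0: "\<phi> 0 = 0"
proof -
  have "\<phi> 0 + 0 = \<phi> 0 + \<phi> 0" using lhom_add[of 0 0] by simp
  thus ?thesis by (simp only: add_left_cancel)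
qed

lemma lhom_uminus: "u \<in> L \<Longrightarrow> \<phi> (- u) = - \<phi> u"
  using lhom_add[of u "- u"] by (simp add: lhom_0 minus_unique)

lemma lhom_diff: "u \<in> L \<Longrightarrow> v \<in> L \<Longrightarrow> \<phi> (u - v) = \<phi> u - \<phi> v"
  using lhom_add[of u "- v"] by (simp add: lhom_uminus)

lemma lhom_inverse: "u \<in> L \<Longrightarrow> \<phi> (inverse u) = inverse (\<phi> u)"
  using lhom_mult[of u "inverse u"] by (cases "u = 0") (simp_all add: lhom_0 lhom_1 inverse_unique)

lemma lhom_divide: "u \<in> L \<Longrightarrow> v \<in> L \<Longrightarrow> \<phi> (u / v) = \<phi> u / \<phi> v"
  by (simp add: field_class.field_divide_inverse lhom_mult lhom_inverse)

lemma lhom_power: "u \<in> L \<Longrightarrow> \<phi> (u ^ i) = \<phi> u ^ i"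
  by (induction i) (simp_all add: lhom_mult lhom_1)

lemma lhom_power_int: "u \<in> L \<Longrightarrow> \<phi> (u powi i) = \<phi> u powi i"
  by (simp add: power_int_def lhom_power lhom_inverse)

lemma lhom_sum: "(\<And>i. i \<in> I \<Longrightarrow> f i \<in> L) \<Longrightarrow> \<phi> (sum f I) = (\<Sum>i\<in>I. \<phi> (f i))"
  by (induction I rule: infinite_finite_induct) (simp_all add: lhom_0 lhom_add)

lemma lhom_prod: "(\<And>i. i \<in> I \<Longrightarrow> f i \<in> L) \<Longrightarrow> \<phi> (prod f I) = (\<Prod>i\<in>I. \<phi> (f i))"
  by (induction I rule: infinite_finite_induct) (simp_all add: lhom_1 lhom_mult)

lemma lhom_eq_0_iff: "u \<in> L \<Longrightarrow> \<phi> u = 0 \<longleftrightarrow> u = 0"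
  using lhom_mult[of u "inverse u"] by (cases "u = 0") (auto simp: lhom_0 lhom_1)

lemmas lhom_simps = lhom_1 lhom_0 lhom_add lhom_mult lhom_uminus lhom_diff lhom_inverse
  lhom_divide lhom_power lhom_power_int lhom_sum lhom_prod

lemma lhom_form:
  "u \<in> L \<Longrightarrow> v \<in> L \<Longrightarrow> w \<in> L \<Longrightarrow>
    \<phi> (form const d f u v w) = form (\<lambda>c. \<phi> (const c)) d f (\<phi> u) (\<phi> v) (\<phi> w)"
  by (simp add: form_def lhom_simps)

end

lemma L_form [simp]: "u \<in> L \<Longrightarrow> v \<in> L \<Longrightarrow> w \<in> L \<Longrightarrow> form const d f u v w \<in> L"
  by (simp add: form_def)

end

section \<open>Ternary forms and their products\<close>

lemma form_comm_ring_hom: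
  assumes "comm_ring_hom h"
  shows "h (form k d f a b c) = form (\<lambda>q. h (k q)) d f (h a) (h b) (h c)"
proof -
  interpret h: comm_ring_hom h by fact
  show ?thesis by (simp add: form_def hom_distribs)
qed

lemma form_scale: "form k d f (l * a) (l * b) (l * c) = l ^ d * form k d f a b c"
proof -
  have *: "k (f i j) * (l * a) ^ i * (l * b) ^ j * (l * c) ^ (d - i - j)
      = l ^ d * (k (f i j) * a ^ i * b ^ j * c ^ (d - i - j))" if "i \<le> d" "j \<le> d - i" for i j
  proof -
    have "l ^ d = l ^ i * l ^ j * l ^ (d - i - j)"
      unfolding power_add[symmetric] using that by simp
    thus ?thesis by (simp add: power_mult_distrib ac_simps)
  qed
  show ?thesis
    unfolding form_def sum_distrib_left by (intro sum.cong refl *) auto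
qed

lemma form_add:
  assumes "comm_ring_hom k"
  shows "form k d (\<lambda>i j. f i j + g i j) a b c = form k d f a b c + form k d g a b c"
proof -
  interpret k: comm_ring_hom k by fact
  show ?thesis by (simp add: form_def hom_distribs ring_distribs sum.distrib)
qed

lemma form_cmult:
  assumes "comm_ring_hom k"
  shows "form k d (\<lambda>i j. s * f i j) a b c = k s * form k d f a b c"
proof -
  interpret k: comm_ring_hom k by fact
  show ?thesis by (simp add: form_def hom_distribs sum_distrib_left mult.assoc)
qed

lemma form_0: "form k 0 (\<lambda>_ _. s) a b c = k s"
  by (simp add: form_def)

text \<open>In degree 1 the index pairs (1,0), (0,1), (0,0) belong to X, Y, Z.\<close>

definition linear_form :: "complex \<Rightarrow> complex \<Rightarrow> complex \<Rightarrow> nat \<Rightarrow> nat \<Rightarrow> complex" where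
  "linear_form p q r = (\<lambda>i j. if i = 1 then p else if j = 1 then q else r)"

lemma form_linear: "form k 1 (linear_form p q r) a b c = k p * a + k q * b + k r * c"
  by (simp add: form_def linear_form_def)

definition exponents :: "nat \<Rightarrow> (nat \<times> nat) set" where
  "exponents d = (SIGMA i:{..d}. {..d - i})"

lemma form_eq_sum_exponents:
  "form k d f a b c = (\<Sum>(i, j)\<in>exponents d. k (f i j) * a ^ i * b ^ j * c ^ (d - i - j))"
  by (simp add: form_def exponents_def sum.Sigma)

text \<open>The coefficients of a product of forms, a convolution over pairs of exponents with sum
  (i, j). Sums and products in the local ring are brought to a common degree with it.\<close>

definition form_times ::
  "nat \<Rightarrow> (nat \<Rightarrow> nat \<Rightarrow> complex) \<Rightarrow> nat \<Rightarrow> (nat \<Rightarrow> nat \<Rightarrow> complex) \<Rightarrow> nat \<Rightarrow> nat \<Rightarrow> complex" where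
  "form_times d f e g i j =
     (\<Sum>((p, q), (r, s)) \<in> {x \<in> exponents d \<times> exponents e.
        (fst (fst x) + fst (snd x), snd (fst x) + snd (snd x)) = (i, j)}. f p q * g r s)"

lemma form_times:
  assumes "comm_ring_hom k"
  shows "form k (d + e) (form_times d f e g) a b c = form k d f a b c * form k e g a b c"
proof -
  interpret k: comm_ring_hom k by fact
  let ?S = "exponents d \<times> exponents e"
  let ?h = "\<lambda>x::(nat \<times> nat) \<times> nat \<times> nat. (fst (fst x) + fst (snd x), snd (fst x) + snd (snd x))"
  let ?u = "\<lambda>((p, q), (r, s)). k (f p q * g r s) * a ^ (p + r) * b ^ (q + s) * c ^ (d + e - (p + r) - (q + s))"
  have fin: "finite (exponents d)" for d by (simp add: exponents_def)
  have "form k (d + e) (form_times d f e g) a b c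
      = (\<Sum>z\<in>exponents (d + e). \<Sum>x\<in>{x \<in> ?S. ?h x = z}. ?u x)"
    unfolding form_eq_sum_exponents
  proof (intro sum.cong refl, clarify)
    fix i j
    have "k (form_times d f e g i j) * a ^ i * b ^ j * c ^ (d + e - i - j)
        = (\<Sum>x\<in>{x \<in> ?S. ?h x = (i, j)}.
            (case x of ((p, q), (r, s)) \<Rightarrow> k (f p q * g r s)) * a ^ i * b ^ j * c ^ (d + e - i - j))"
      unfolding form_times_def by (simp add: hom_distribs sum_distrib_right case_prod_unfold)
    also have "\<dots> = (\<Sum>x\<in>{x \<in> ?S. ?h x = (i, j)}. ?u x)"
      by (intro sum.cong refl) auto
    finally show "k (form_times d f e g i j) * a ^ i * b ^ j * c ^ (d + e - i - j)
        = (\<Sum>x\<in>{x \<in> ?S. ?h x = (i, j)}. ?u x)" .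
  qed
  also have "\<dots> = (\<Sum>x\<in>?S. ?u x)"
    by (rule sum.group) (auto simp: fin exponents_def)
  also have "\<dots> = (\<Sum>x\<in>exponents d. \<Sum>x'\<in>exponents e. ?u (x, x'))"
    by (simp add: sum.cartesian_product)
  also have "\<dots> = form k d f a b c * form k e g a b c"
    unfolding form_eq_sum_exponents sum_product
  proof (intro sum.cong refl)
    fix x x' assume x: "x \<in> exponents d" "x' \<in> exponents e"
    obtain p q r s where [simp]: "x = (p, q)" "x' = (r, s)" by (cases x, cases x')
    have "d + e - (p + r) - (q + s) = (d - p - q) + (e - r - s)"
      using x by (auto simp: exponents_def)
    thus "?u (x, x') = (case x of (i, j) \<Rightarrow> k (f i j) * a ^ i * b ^ j * c ^ (d - i - j)) *
        (case x' of (i, j) \<Rightarrow> k (g i j) * a ^ i * b ^ j * c ^ (e - i - j))"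
      by (simp add: hom_distribs power_add ac_simps)
  qed
  finally show ?thesis .
qed

section \<open>Laurent branches and the local ring at a point\<close>

lemma comm_ring_hom_ident: "comm_ring_hom (\<lambda>q::complex. q)"
  by unfold_locales simp_all

lemma comm_ring_hom_fls_const: "comm_ring_hom (fls_const :: complex \<Rightarrow> _)"
  by unfold_locales (simp_all add: fls_const_mult_const flip: fls_plus_const)

lemma comm_ring_hom_fps_to_fls: "comm_ring_hom (fps_to_fls :: complex fps \<Rightarrow> _)"
  by unfold_locales (simp_all add: fls_times_fps_to_fls)

lemma comm_ring_hom_fps_nth_0: "comm_ring_hom (\<lambda>f::complex fps. fps_nth f 0)"
  by unfold_locales simp_all

text \<open>A parametrised germ of the curve through (a : b : c). The series A, B, C are homogeneous
  coordinates of the generic point, so points at infinity need no separate treatment. That the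
  parametrisation is unramified is not part of the locale; \<open>valuation_eq\<close> asks for it
  as the existence of an element of order 1.\<close>

locale branch = fermat +
  fixes \<psi> :: "ambient \<Rightarrow> complex fls" and A B C :: "complex fps" and a b c :: complex
  assumes lhom_psi: "lhom \<psi>" and psi_const: "\<psi> (const s) = fls_const s"
    and psi_x: "\<psi> gen_x * fps_to_fls C = fps_to_fls A"
    and psi_y: "\<psi> y * fps_to_fls C = fps_to_fls B"
    and C_nz: "C \<noteq> 0"
    and at_0: "fps_nth A 0 = a" "fps_nth B 0 = b" "fps_nth C 0 = c"
    and point_nz: "(a, b, c) \<noteq> (0, 0, 0)"
begin

abbreviation P :: point where "P \<equiv> proj_point a b c"
abbreviation R :: "ambient set" where "R \<equiv> local_ring y P"
abbreviation M :: "ambient set" where "M \<equiv> place y P"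
abbreviation gv :: "nat \<Rightarrow> (nat \<Rightarrow> nat \<Rightarrow> complex) \<Rightarrow> ambient" where
  "gv d f \<equiv> form const d f gen_x y 1"
abbreviation pv :: "nat \<Rightarrow> (nat \<Rightarrow> nat \<Rightarrow> complex) \<Rightarrow> complex" where
  "pv d f \<equiv> form (\<lambda>q. q) d f a b c"

lemma pv_scale: "(\<forall>(a, b, c) \<in> P. form (\<lambda>q. q) d g a b c \<noteq> 0) \<longleftrightarrow> pv d g \<noteq> 0"
  "(\<forall>(a, b, c) \<in> P. form (\<lambda>q. q) d f a b c = 0 \<and> form (\<lambda>q. q) d g a b c \<noteq> 0) \<longleftrightarrow> pv d f = 0 \<and> pv d g \<noteq> 0"
proof -
  have mem: "(a, b, c) \<in> P" by (auto simp: proj_point_def intro: exI[of _ 1])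
  have *: "form (\<lambda>q. q) d f a' b' c' = 0 \<longleftrightarrow> pv d f = 0" if "(a', b', c') \<in> P" for a' b' c' f
    using that by (auto simp: proj_point_def form_scale)
  have all: "(\<forall>(a, b, c) \<in> P. Q a b c) \<longleftrightarrow> Q a b c"
    if "\<And>a' b' c'. (a', b', c') \<in> P \<Longrightarrow> Q a' b' c' = Q a b c" for Q
    using mem that by fast
  show "(\<forall>(a, b, c) \<in> P. form (\<lambda>q. q) d g a b c \<noteq> 0) \<longleftrightarrow> pv d g \<noteq> 0"
    by (rule all) (simp add: *)
  show "(\<forall>(a, b, c) \<in> P. form (\<lambda>q. q) d f a b c = 0 \<and> form (\<lambda>q. q) d g a b c \<noteq> 0)
      \<longleftrightarrow> pv d f = 0 \<and> pv d g \<noteq> 0"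
    by (rule all) (simp add: *)
qed

lemma R_iff: "r \<in> R \<longleftrightarrow> (\<exists>d f g. r = gv d f / gv d g \<and> pv d g \<noteq> 0)"
  unfolding local_ring_def pv_scale by blast

lemma M_iff: "r \<in> M \<longleftrightarrow> (\<exists>d f g. r = gv d f / gv d g \<and> pv d f = 0 \<and> pv d g \<noteq> 0)"
  unfolding place_def pv_scale by blast

lemma M_subset_R: "M \<subseteq> R"
  unfolding subset_iff R_iff M_iff by blast

lemma R_subset_L: "R \<subseteq> L"
  by (auto simp: R_iff)

text \<open>By homogeneity, multiplying by C^d replaces the coordinates (x, y, 1) by (A, B, C). The
  value becomes a power series, and its constant term is the value of the form at (a, b, c).\<close>

lemma psi_gv:
  obtains F where "\<psi> (gv d f) * fps_to_fls C ^ d = fps_to_fls F" "fps_nth F 0 = pv d f"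
proof
  have "\<psi> (gv d f) * fps_to_fls C ^ d = form fls_const d f (\<psi> gen_x) (\<psi> y) 1 * fps_to_fls C ^ d"
    by (simp add: lhom_form[OF lhom_psi] lhom_1[OF lhom_psi] psi_const)
  also have "\<dots> = form fls_const d f (fps_to_fls A) (fps_to_fls B) (fps_to_fls C)"
    using form_scale[of fls_const d f "fps_to_fls C" "\<psi> gen_x" "\<psi> y" 1] psi_x psi_y by (simp add: mult.commute)
  also have "\<dots> = fps_to_fls (form fps_const d f A B C)"
    by (simp add: form_comm_ring_hom[OF comm_ring_hom_fps_to_fls])
  finally show "\<psi> (gv d f) * fps_to_fls C ^ d = fps_to_fls (form fps_const d f A B C)" .
  show "fps_nth (form fps_const d f A B C) 0 = pv d f"
    using form_comm_ring_hom[OF comm_ring_hom_fps_nth_0, of fps_const d f A B C] at_0 by simp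
qed

lemma gv_neq_0: "pv d g \<noteq> 0 \<Longrightarrow> gv d g \<noteq> 0"
  by (rule psi_gv[of d g]) (auto simp: lhom_0[OF lhom_psi])

lemma psi_quotient:
  assumes "pv d g \<noteq> 0"
  obtains F where "\<psi> (gv d f / gv d g) = fps_to_fls F" "fps_nth F 0 = pv d f / pv d g"
proof -
  obtain F where F: "\<psi> (gv d f) * fps_to_fls C ^ d = fps_to_fls F" "fps_nth F 0 = pv d f" by (rule psi_gv)
  obtain G where G: "\<psi> (gv d g) * fps_to_fls C ^ d = fps_to_fls G" "fps_nth G 0 = pv d g" by (rule psi_gv)
  have G0: "fps_nth G 0 \<noteq> 0" using G assms by simp
  have cd: "fps_to_fls C ^ d \<noteq> 0" using C_nz by simp
  show ?thesis
  proof
    have "\<psi> (gv d f / gv d g) = \<psi> (gv d f) * fps_to_fls C ^ d / (\<psi> (gv d g) * fps_to_fls C ^ d)"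
      using cd by (simp add: lhom_divide[OF lhom_psi])
    also have "\<dots> = fps_to_fls F * inverse (fps_to_fls G)"
      by (simp add: F G field_class.field_divide_inverse)
    also have "\<dots> = fps_to_fls (F * inverse G)"
      using fls_inverse_fps_to_fls[of G] G0 by (simp add: fls_times_fps_to_fls subdegree_eq_0)
    finally show "\<psi> (gv d f / gv d g) = fps_to_fls (F * inverse G)" .
    show "fps_nth (F * inverse G) 0 = pv d f / pv d g"
      using F G by (simp add: field_class.field_divide_inverse)
  qed
qed

lemma psi_R: "r \<in> R \<Longrightarrow> fls_subdegree (\<psi> r) \<ge> 0"
  unfolding R_iff by (metis psi_quotient fls_subdegree_fls_to_fps_gt0)

lemma psi_M:
  assumes "r \<in> M" "r \<noteq> 0"
  shows "fls_subdegree (\<psi> r) > 0"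
proof -
  obtain d f g where *: "r = gv d f / gv d g" "pv d f = 0" "pv d g \<noteq> 0" using assms by (auto simp: M_iff)
  obtain F where F: "\<psi> r = fps_to_fls F" "fps_nth F 0 = 0" using psi_quotient[OF *(3), of f] * by auto
  have "F \<noteq> 0" using F(1) assms * lhom_eq_0_iff[OF lhom_psi, of r] by auto
  thus ?thesis using F by (simp add: fls_subdegree_fls_to_fps subdegree_pos_iff)
qed

lemma R_const: "const s \<in> R"
  unfolding R_iff by (intro exI[of _ 0] exI[of _ "\<lambda>_ _. s"] exI[of _ "\<lambda>_ _. 1"]) (simp add: form_0)

lemma R_M_add: "r \<in> R \<Longrightarrow> r' \<in> R \<Longrightarrow> r + r' \<in> R" "r \<in> M \<Longrightarrow> r' \<in> M \<Longrightarrow> r + r' \<in> M"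
proof -
  have *: "gv d f / gv d g + gv e f' / gv e g' = gv (d + e) (\<lambda>i j. form_times d f e g' i j + form_times d g e f' i j)
      / gv (d + e) (form_times d g e g')"
    "pv (d + e) (\<lambda>i j. form_times d f e g' i j + form_times d g e f' i j) = pv d f * pv e g' + pv d g * pv e f'"
    "pv (d + e) (form_times d g e g') = pv d g * pv e g'"
    if "pv d g \<noteq> 0" "pv e g' \<noteq> 0" for d e f g f' g'
    using gv_neq_0[OF that(1)] gv_neq_0[OF that(2)]
    by (simp_all add: form_add[OF comm_ring_hom_const] form_add[OF comm_ring_hom_ident]
        form_times[OF comm_ring_hom_const] form_times[OF comm_ring_hom_ident] add_frac_eq mult.commute)
  show "r + r' \<in> R" if rr: "r \<in> R" "r' \<in> R"
  proof -
    obtain d f g e f' g' where 1: "r = gv d f / gv d g" "pv d g \<noteq> 0" "r' = gv e f' / gv e g'" "pv e g' \<noteq> 0"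
      using rr unfolding R_iff by blast
    show ?thesis unfolding R_iff 1(1,3)
      by (intro exI conjI, rule *(1)[OF 1(2,4)]) (simp only: *(3)[OF 1(2,4)], simp add: 1(2,4))
  qed
  show "r + r' \<in> M" if rr: "r \<in> M" "r' \<in> M"
  proof -
    obtain d f g e f' g' where 1: "r = gv d f / gv d g" "pv d g \<noteq> 0" "r' = gv e f' / gv e g'" "pv e g' \<noteq> 0"
      "pv d f = 0" "pv e f' = 0"
      using rr unfolding M_iff by blast
    show ?thesis unfolding M_iff 1(1,3)
      by (intro exI conjI, rule *(1)[OF 1(2,4)])
        (simp only: *(2)[OF 1(2,4)] 1(5,6), simp, simp only: *(3)[OF 1(2,4)], simp add: 1(2,4))
  qed
qed

lemma R_M_mult: "r \<in> R \<Longrightarrow> r' \<in> R \<Longrightarrow> r * r' \<in> R" "r \<in> R \<Longrightarrow> r' \<in> M \<Longrightarrow> r * r' \<in> M"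
proof -
  have *: "gv d f / gv d g * (gv e f' / gv e g') = gv (d + e) (form_times d f e f') / gv (d + e) (form_times d g e g')"
    "pv (d + e) (form_times d f e g') = pv d f * pv e g'" for d e f g f' g'
    by (simp_all add: form_times[OF comm_ring_hom_const] form_times[OF comm_ring_hom_ident])
  show "r * r' \<in> R" if rr: "r \<in> R" "r' \<in> R"
  proof -
    obtain d f g e f' g' where 1: "r = gv d f / gv d g" "pv d g \<noteq> 0" "r' = gv e f' / gv e g'" "pv e g' \<noteq> 0"
      using rr unfolding R_iff by blast
    show ?thesis unfolding R_iff 1(1,3)
      by (intro exI conjI, rule *(1)) (simp add: * 1(2,4))
  qed
  show "r * r' \<in> M" if rr: "r \<in> R" "r' \<in> M"
  proof -
    obtain d f g e f' g' where 1: "r = gv d f / gv d g" "pv d g \<noteq> 0" "r' = gv e f' / gv e g'" "pv e g' \<noteq> 0"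
      "pv e f' = 0"
      using rr unfolding R_iff M_iff by blast
    show ?thesis unfolding M_iff 1(1,3)
      by (intro exI conjI, rule *(1)) (simp_all add: * 1(2,4,5))
  qed
qed

text \<open>Outside M the numerator does not vanish at the point, so the quotient of forms can be
  inverted within R. Inside M the order under \<psi> is positive, which excludes an inverse of
  nonnegative order.\<close>

lemma local_unit_iff: "local_unit y P r \<longleftrightarrow> r \<in> R \<and> r \<notin> M"
proof
  assume r: "local_unit y P r"
  hence "r \<in> R" "inverse r \<in> R" "r \<noteq> 0" by (auto simp: local_unit_def)
  moreover have "r \<notin> M"
  proof
    assume "r \<in> M"
    hence "fls_subdegree (\<psi> r) > 0" using psi_M calculation by blast
    moreover have "fls_subdegree (\<psi> (inverse r)) \<ge> 0" using psi_R \<open>inverse r \<in> R\<close> by blast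
    ultimately show False using \<open>r \<in> R\<close> R_subset_L by (auto simp: lhom_inverse[OF lhom_psi])
  qed
  ultimately show "r \<in> R \<and> r \<notin> M" by blast
next
  assume r: "r \<in> R \<and> r \<notin> M"
  then obtain d f g where *: "r = gv d f / gv d g" "pv d g \<noteq> 0" by (auto simp: R_iff)
  with r have f: "pv d f \<noteq> 0" by (auto simp: M_iff)
  hence "r \<noteq> 0" using gv_neq_0 * by auto
  moreover have "inverse r \<in> R" using f * by (auto simp: R_iff)
  ultimately show "local_unit y P r" using r by (simp add: local_unit_def)
qed

lemma psi_local_unit:
  assumes "local_unit y P r" shows "fls_subdegree (\<psi> r) = 0"
proof -
  have "r \<in> R" "inverse r \<in> R" "r \<noteq> 0" using assms by (auto simp: local_unit_def)
  thus ?thesis using psi_R[of r] psi_R[of "inverse r"] R_subset_L by (auto simp: lhom_inverse[OF lhom_psi])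
qed

lemma const_in_M: "const s \<in> M \<Longrightarrow> s = 0"
  using psi_M[of "const s"] by (cases "s = 0") (simp_all add: psi_const)

section \<open>Congruence to constants modulo an ideal of the local ring\<close>

definition R_ideal :: "ambient set \<Rightarrow> bool" where
  "R_ideal I \<longleftrightarrow> 0 \<in> I \<and> I \<subseteq> R \<and> (\<forall>r\<in>I. \<forall>s\<in>I. r + s \<in> I) \<and> (\<forall>r\<in>R. \<forall>s\<in>I. r * s \<in> I)"

lemma R_ideal_M: "R_ideal M"
proof -
  have "0 \<in> M"
    unfolding M_iff by (intro exI[of _ 0] exI[of _ "\<lambda>_ _. 0"] exI[of _ "\<lambda>_ _. 1"]) (simp add: form_0)
  thus ?thesis using M_subset_R by (auto simp: R_ideal_def R_M_add R_M_mult)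
qed

lemma R_ideal_principal: "t \<in> R \<Longrightarrow> R_ideal ((\<lambda>r. t * r) ` R)"
  using R_const[of 0] R_M_add(1) R_M_mult(1) unfolding R_ideal_def
  by (auto simp: image_iff simp flip: distrib_left)

text \<open>For I = M this is evaluation at the point. For I = T R it is the stronger statement that
  r is constant modulo T; establishing it for the coordinates shows that T generates M.\<close>

definition cong_const :: "ambient set \<Rightarrow> ambient \<Rightarrow> complex \<Rightarrow> bool" where
  "cong_const I r s \<longleftrightarrow> r \<in> R \<and> r - const s \<in> I"

context
  fixes I assumes I: "R_ideal I"
begin

lemma cong_const_const: "cong_const I (const s) s"
  using I R_const by (simp add: cong_const_def R_ideal_def)

lemma cong_const_add: "cong_const I r s \<Longrightarrow> cong_const I r' s' \<Longrightarrow> cong_const I (r + r') (s + s')"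
proof -
  assume *: "cong_const I r s" "cong_const I r' s'"
  have eq: "r + r' - const (s + s') = (r - const s) + (r' - const s')" by (simp add: hom_distribs)
  show ?thesis unfolding cong_const_def eq
    using * I R_M_add(1) unfolding cong_const_def R_ideal_def by blast
qed

lemma cong_const_mult: "cong_const I r s \<Longrightarrow> cong_const I r' s' \<Longrightarrow> cong_const I (r * r') (s * s')"
proof -
  assume *: "cong_const I r s" "cong_const I r' s'"
  have eq: "r * r' - const (s * s') = r * (r' - const s') + const s' * (r - const s)"
    by (simp add: hom_distribs algebra_simps)
  show ?thesis unfolding cong_const_def eq
    using * I R_M_mult(1) R_const[of s'] unfolding cong_const_def R_ideal_def by blast
qed

lemma cong_const_power: "cong_const I r s \<Longrightarrow> cong_const I (r ^ i) (s ^ i)"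
  by (induction i) (use cong_const_const[of 1] cong_const_mult in simp_all)

lemma cong_const_sum:
  "(\<And>i. i \<in> J \<Longrightarrow> cong_const I (f i) (g i)) \<Longrightarrow> cong_const I (sum f J) (sum g J)"
  by (induction J rule: infinite_finite_induct) (use cong_const_const[of 0] cong_const_add in simp_all)

lemma cong_const_form:
  assumes "cong_const I u p" "cong_const I v q" "cong_const I w r"
  shows "cong_const I (form const d f u v w) (form (\<lambda>q. q) d f p q r)"
  unfolding form_def
  by (intro cong_const_sum cong_const_mult cong_const_const cong_const_power assms)

end

lemma local_unit_if_cong_const:
  assumes "cong_const M r s" "s \<noteq> 0"
  shows "local_unit y P r"
proof -
  have "r \<notin> M"
  proof
    assume "r \<in> M"
    hence "r + const (-1) * (r - const s) \<in> M"
      using assms(1) R_M_add(2) R_M_mult(2) R_const by (simp only: cong_const_def)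
    thus False using const_in_M assms(2) by (simp add: hom_distribs)
  qed
  thus ?thesis using assms(1) by (simp add: local_unit_iff cong_const_def)
qed

text \<open>Quotients of degree d are to be renormalised to the d-th power of a fixed linear form as
  denominator, which therefore has to be a form itself.\<close>

lemma form_linear_power:
  "\<exists>h. gv d h = gv 1 f ^ d \<and> pv d h = pv 1 f ^ d"
proof (induction d)
  case 0
  show ?case by (intro exI[of _ "\<lambda>_ _. 1"]) (simp add: form_0)
next
  case (Suc d)
  then obtain h where "gv d h = gv 1 f ^ d" "pv d h = pv 1 f ^ d" by blast
  thus ?case
    using form_times[OF comm_ring_hom_const, of 1 d f h gen_x y 1]
      form_times[OF comm_ring_hom_ident, of 1 d f h a b c] by (intro exI[of _ "form_times 1 f d h"]) simp
qed

lemma coordinates: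
  "gen_x = gv 1 (linear_form 1 0 0)" "y = gv 1 (linear_form 0 1 0)" "1 = gv 1 (linear_form 0 0 1)"
  "a = pv 1 (linear_form 1 0 0)" "b = pv 1 (linear_form 0 1 0)" "c = pv 1 (linear_form 0 0 1)"
  unfolding form_linear by simp_all

lemma nonzero_linear_form: "\<exists>f. pv 1 f \<noteq> 0"
  using point_nz coordinates(4-6) by (metis (full_types))

text \<open>For a linear form w that does not vanish at the point, x/w, y/w and 1/w are regular, so
  x and y are fractions of regular functions; fractions are closed under the field
  operations.\<close>

lemma L_fraction:
  assumes "z \<in> L"
  shows "\<exists>r\<in>R. \<exists>s\<in>R. s \<noteq> 0 \<and> z = r / s"
proof -
  obtain f where f: "pv 1 f \<noteq> 0" using nonzero_linear_form by blast
  define w where "w = gv 1 f"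
  have w: "w \<noteq> 0" unfolding w_def by (rule gv_neq_0[OF f])
  have q: "gv 1 g / w \<in> R" for g unfolding w_def R_iff using f by blast
  have wR: "gen_x / w \<in> R" "y / w \<in> R" "1 / w \<in> R"
    using q[of "linear_form 1 0 0"] q[of "linear_form 0 1 0"] q[of "linear_form 0 0 1"]
    unfolding coordinates(1-3)[symmetric] by auto
  have R1: "1 \<in> R" using R_const[of 1] by simp
  show ?thesis using assms
  proof (induction rule: fermat_field.induct)
    case (const c)
    show ?case using R_const R1 by (intro bexI[of _ "const c"] bexI[of _ 1]) auto
  next
    case gen_x
    show ?case using w wR by (intro bexI[of _ "gen_x / w"] bexI[of _ "1 / w"]) auto
  next
    case gen_y
    show ?case using w wR by (intro bexI[of _ "y / w"] bexI[of _ "1 / w"]) auto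
  next
    case (add u v)
    then obtain r s r' s' where *: "r \<in> R" "s \<in> R" "s \<noteq> 0" "u = r / s" "r' \<in> R" "s' \<in> R" "s' \<noteq> 0" "v = r' / s'" by metis
    show ?case
      by (rule bexI[of _ "r * s' + r' * s"], rule bexI[of _ "s * s'"])
        (use * in \<open>auto simp: add_frac_eq intro!: R_M_add(1) R_M_mult(1)\<close>)
  next
    case (diff u v)
    then obtain r s r' s' where *: "r \<in> R" "s \<in> R" "s \<noteq> 0" "u = r / s" "r' \<in> R" "s' \<in> R" "s' \<noteq> 0" "v = r' / s'" by metis
    have "r * s' + const (-1) * (r' * s) \<in> R"
      by (rule R_M_add(1)[OF R_M_mult(1)[OF *(1,6)] R_M_mult(1)[OF R_const R_M_mult(1)[OF *(5,2)]]])
    hence "r * s' - r' * s \<in> R" by (simp add: hom_distribs)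
    moreover have "s * s' \<in> R" "u - v = (r * s' - r' * s) / (s * s')" "s * s' \<noteq> 0"
      using * by (auto simp: diff_frac_eq intro: R_M_mult(1))
    ultimately show ?case by blast
  next
    case (mult u v)
    then obtain r s r' s' where *: "r \<in> R" "s \<in> R" "s \<noteq> 0" "u = r / s" "r' \<in> R" "s' \<in> R" "s' \<noteq> 0" "v = r' / s'" by metis
    show ?case
      by (rule bexI[of _ "r * r'"], rule bexI[of _ "s * s'"])
        (use * in \<open>auto intro!: R_M_mult(1)\<close>)
  next
    case (inverse u)
    then obtain r s where *: "r \<in> R" "s \<in> R" "s \<noteq> 0" "u = r / s" by metis
    show ?case
    proof (cases "r = 0")
      case True
      thus ?thesis using * R1 by (intro bexI[of _ r] bexI[of _ 1]) auto
    next
      case False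
      thus ?thesis using * by (intro bexI[of _ s] bexI[of _ r]) auto
    qed
  qed
qed

lemma local_unit_mult: "local_unit y P u \<Longrightarrow> local_unit y P v \<Longrightarrow> local_unit y P (u * v)"
  by (auto simp: local_unit_def R_M_mult)

lemma local_unit_inverse: "local_unit y P u \<Longrightarrow> local_unit y P (inverse u)"
  by (auto simp: local_unit_def)

lemma uniformizer_in_M: "uniformizer y P t \<Longrightarrow> t \<in> M"
  unfolding uniformizer_def using R_const[of 1] by (auto simp: image_iff intro!: bexI[of _ 1])

text \<open>Splitting off factors t must stop: t has positive order under \<psi>, so each factor
  lowers the nonnegative order of the cofactor. The branch takes the place of a Noetherian
  argument.\<close>

lemma R_decomposition:
  assumes t: "uniformizer y P t"
  shows "r \<in> R \<Longrightarrow> r \<noteq> 0 \<Longrightarrow> nat (fls_subdegree (\<psi> r)) = m \<Longrightarrow> \<exists>u k. local_unit y P u \<and> r = u * t ^ k"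
proof (induction m arbitrary: r rule: less_induct)
  case (less m)
  show ?case
  proof (cases "r \<in> M")
    case False
    hence "local_unit y P r" using less.prems by (simp add: local_unit_iff)
    thus ?thesis by (intro exI[of _ r] exI[of _ 0]) simp
  next
    case True
    then obtain r' where r': "r' \<in> R" "r = t * r'" using t by (auto simp: uniformizer_def)
    have nz: "t \<noteq> 0" "r' \<noteq> 0" using less.prems r' by auto
    have tL: "t \<in> L" "r' \<in> L" using uniformizer_in_M[OF t] M_subset_R R_subset_L r' by auto
    have "fls_subdegree (\<psi> r) = fls_subdegree (\<psi> t) + fls_subdegree (\<psi> r')"
      using tL nz by (simp add: r' lhom_mult[OF lhom_psi] lhom_eq_0_iff[OF lhom_psi])
    moreover have "fls_subdegree (\<psi> t) > 0" by (rule psi_M[OF uniformizer_in_M[OF t] nz(1)])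
    moreover have "fls_subdegree (\<psi> r') \<ge> 0" by (rule psi_R[OF r'(1)])
    ultimately have "nat (fls_subdegree (\<psi> r')) < m" using less.prems by simp
    then obtain u k where "local_unit y P u" "r' = u * t ^ k" using less.IH r'(1) nz(2) by blast
    thus ?thesis using r' by (intro exI[of _ u] exI[of _ "Suc k"]) simp
  qed
qed

text \<open>The last clause treats the degenerate case t = 0, that is M = {0}. The definition of
  \<open>uniformizer\<close> admits it, and it is excluded only in
  \<open>valuation_eq\<close>.\<close>

lemma decomposition:
  assumes t: "uniformizer y P t" and z: "z \<in> L" "z \<noteq> 0"
  shows "\<exists>u k. local_unit y P u \<and> z = u * t powi k \<and> (t = 0 \<longrightarrow> k = 0)"
proof -
  obtain r s where rs: "r \<in> R" "s \<in> R" "s \<noteq> 0" "z = r / s" using L_fraction[OF z(1)] by blast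
  have "r \<noteq> 0" using z rs by auto
  obtain u k where u: "local_unit y P u" "r = u * t ^ k" using R_decomposition[OF t rs(1) \<open>r \<noteq> 0\<close>] by blast
  obtain v l where v: "local_unit y P v" "s = v * t ^ l" using R_decomposition[OF t rs(2,3)] by blast
  show ?thesis
  proof (intro exI conjI)
    show "local_unit y P (u * inverse v)" using u v by (intro local_unit_mult local_unit_inverse)
    show "z = u * inverse v * t powi (int k - int l)"
    proof (cases "t = 0")
      case True
      hence "k = 0" "l = 0" using u v \<open>r \<noteq> 0\<close> \<open>s \<noteq> 0\<close> by (auto intro!: gr0I)
      thus ?thesis using rs u v by (simp add: field_class.field_divide_inverse)
    next
      case False
      thus ?thesis using rs u v by (simp add: power_int_diff field_simps)
    qed
    show "t = 0 \<longrightarrow> int k - int l = 0"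
      using u v \<open>r \<noteq> 0\<close> \<open>s \<noteq> 0\<close> by (cases k; cases l) auto
  qed
qed

text \<open>Decomposing an element of order 1 gives 1 = k * ord t for every uniformizer t, so t
  itself has order 1. Hence the exponent in any decomposition is the order under \<psi>, which
  provides both existence and uniqueness for the definite description.\<close>

lemma valuation_eq:
  assumes T: "uniformizer y P T" and one: "\<exists>z\<in>L. fls_subdegree (\<psi> z) = 1"
    and z: "z \<in> L" "z \<noteq> 0"
  shows "valuation y P z = fls_subdegree (\<psi> z)"
proof -
  have sd: "fls_subdegree (\<psi> (u * t powi k)) = k * fls_subdegree (\<psi> t)"
    if "local_unit y P u" "t \<in> L" "t \<noteq> 0" for u t k
  proof -
    have "u \<in> L" "u \<noteq> 0" using that R_subset_L by (auto simp: local_unit_def)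
    thus ?thesis using that psi_local_unit[of u]
      by (simp add: lhom_mult[OF lhom_psi] lhom_power_int[OF lhom_psi] lhom_eq_0_iff[OF lhom_psi])
  qed
  have t1: "fls_subdegree (\<psi> t) = 1 \<and> t \<noteq> 0 \<and> t \<in> L" if t: "uniformizer y P t" for t
  proof -
    obtain z1 where z1: "z1 \<in> L" "fls_subdegree (\<psi> z1) = 1" using one by blast
    hence "z1 \<noteq> 0" by (auto simp: lhom_0[OF lhom_psi])
    then obtain u k where u: "local_unit y P u" "z1 = u * t powi k" "t = 0 \<longrightarrow> k = 0"
      using decomposition[OF t z1(1)] by blast
    have tM: "t \<in> M" by (rule uniformizer_in_M[OF t])
    have "t \<noteq> 0"
    proof
      assume "t = 0"
      hence "z1 = u" using u by simp
      thus False using psi_local_unit[OF u(1)] z1 by simp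
    qed
    moreover have "t \<in> L" using tM M_subset_R R_subset_L by blast
    ultimately have "1 = k * fls_subdegree (\<psi> t)" using sd u z1 by metis
    moreover have "fls_subdegree (\<psi> t) > 0" using psi_M[OF tM \<open>t \<noteq> 0\<close>] .
    ultimately show ?thesis using \<open>t \<noteq> 0\<close> \<open>t \<in> L\<close>
      by (metis int_one_le_iff_zero_less pos_zmult_eq_1_iff zero_less_mult_pos2 zero_less_one mult.commute)
  qed
  obtain u k where u: "local_unit y P u" "z = u * T powi k" using decomposition[OF T z] by blast
  show ?thesis
    unfolding valuation_def
  proof (rule the_equality)
    have "k = fls_subdegree (\<psi> z)" using sd[OF u(1), of T k] t1[OF T] u(2) by simp
    thus "\<exists>t u. uniformizer y P t \<and> local_unit y P u \<and> z = u * t powi fls_subdegree (\<psi> z)"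
      using u T by blast
  next
    fix l assume "\<exists>t u. uniformizer y P t \<and> local_unit y P u \<and> z = u * t powi l"
    then obtain t v where "uniformizer y P t" "local_unit y P v" "z = v * t powi l" by blast
    thus "l = fls_subdegree (\<psi> z)" using sd[of v t l] t1[of t] by simp
  qed
qed

text \<open>If the coordinates divided by a linear form are constant modulo T, then so is every form
  of degree d divided by the d-th power of that linear form. For an element of M the constant is 0,
  which puts the element into T R.\<close>

lemma uniformizer_if_cong_const:
  assumes T: "T \<in> M" and f: "pv 1 f \<noteq> 0"
    and cc: "cong_const ((\<lambda>r. T * r) ` R) (gen_x / gv 1 f) p" "cong_const ((\<lambda>r. T * r) ` R) (y / gv 1 f) q"
      "cong_const ((\<lambda>r. T * r) ` R) (1 / gv 1 f) r"
  shows "uniformizer y P T"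
proof -
  let ?I = "(\<lambda>r. T * r) ` R"
  have I: "R_ideal ?I" using R_ideal_principal T M_subset_R by blast
  have IM: "?I \<subseteq> M" using R_M_mult(2)[OF _ T] by (auto simp: mult.commute)
  have "z \<in> ?I" if zM: "z \<in> M" for z
  proof -
    obtain d g h where z: "z = gv d g / gv d h" "pv d g = 0" "pv d h \<noteq> 0"
      using zM unfolding M_iff by blast
    obtain w where w: "gv d w = gv 1 f ^ d" "pv d w = pv 1 f ^ d" using form_linear_power by blast
    have f0: "gv 1 f \<noteq> 0" by (rule gv_neq_0[OF f])
    define F where "F = gv d g / gv d w"
    have FM: "F \<in> M" unfolding F_def M_iff
      by (intro exI[of _ d] exI[of _ g] exI[of _ w]) (use z f w in simp)
    have "F = form const d g (gen_x / gv 1 f) (y / gv 1 f) (1 / gv 1 f)"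
      using form_scale[of const d g "1 / gv 1 f" gen_x y 1] w by (simp add: F_def power_divide)
    hence cF: "cong_const ?I F (form (\<lambda>q. q) d g p q r)" using cong_const_form[OF I cc] by simp
    define s where "s = form (\<lambda>q. q) d g p q r"
    have "F - const s \<in> M" using cF IM unfolding cong_const_def s_def by blast
    hence "F + const (-1) * (F - const s) \<in> M" by (intro R_M_add(2)[OF FM] R_M_mult(2)[OF R_const])
    hence "s = 0" using const_in_M by (simp add: hom_distribs)
    hence "F \<in> ?I" using cF by (simp add: cong_const_def s_def[symmetric])
    moreover have "gv d w / gv d h \<in> R" unfolding R_iff using z by blast
    ultimately have "gv d w / gv d h * F \<in> ?I" using I unfolding R_ideal_def by blast
    moreover have "gv d w / gv d h * F = z" using w f0 by (simp add: F_def z)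
    ultimately show ?thesis by simp
  qed
  thus ?thesis unfolding uniformizer_def using IM by blast
qed

text \<open>The implicit function theorem on the curve, in the local ring.\<close>
lemma implicit_cong_const:
  assumes T: "t - const t0 \<in> M" and u: "cong_const M u u0" "u0 \<noteq> 0" "t \<in> R"
    and eq: "u ^ n - const u0 ^ n = const s * (t ^ n - const t0 ^ n)"
  shows "cong_const ((\<lambda>r. (t - const t0) * r) ` R) u u0"
proof -
  \<comment> \<open>D and N are the cofactors of u - u0 and t - t0 in the differences of n-th
    powers. The value of D at the point is n u0^(n-1), which is nonzero, so D is a local unit and
    can be divided by.\<close>
  define D where "D = (\<Sum>i<n. const u0 ^ (n - Suc i) * u ^ i)"
  define N where "N = (\<Sum>i<n. const t0 ^ (n - Suc i) * t ^ i)"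
  have ct: "cong_const M t t0" using T u(3) by (simp add: cong_const_def)
  have "cong_const M D (\<Sum>i<n. u0 ^ (n - Suc i) * u0 ^ i)"
    unfolding D_def by (intro cong_const_sum cong_const_mult cong_const_power cong_const_const R_ideal_M u(1))
  also have "(\<Sum>i<n. u0 ^ (n - Suc i) * u0 ^ i) = (\<Sum>i<n. u0 ^ (n - 1))"
    by (intro sum.cong refl) (simp flip: power_add)
  finally have uD: "local_unit y P D"
    by (rule local_unit_if_cong_const) (use u(2) n_pos in simp)
  have "cong_const M N (\<Sum>i<n. t0 ^ (n - Suc i) * t0 ^ i)"
    unfolding N_def by (intro cong_const_sum cong_const_mult cong_const_power cong_const_const R_ideal_M ct)
  hence NR: "N \<in> R" by (simp add: cong_const_def)
  have "(u - const u0) * D = const s * ((t - const t0) * N)"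
    using eq by (simp add: D_def N_def power_diff_sumr2 ac_simps)
  hence "u - const u0 = (t - const t0) * (const s * N * inverse D)"
    using uD by (simp add: local_unit_def field_simps)
  moreover have "const s * N * inverse D \<in> R"
    using uD NR by (intro R_M_mult R_const) (auto simp: local_unit_def)
  ultimately show ?thesis using u(1) by (auto simp: cong_const_def)
qed

end

text \<open>The field C is algebraically closed, so p splits into linear factors and a root of p is
  the image of a constant: non-constant elements are transcendental.\<close>

lemma poly_hom_neq_0:
  fixes k :: "complex \<Rightarrow> 'b::field"
  assumes "comm_ring_hom k" "\<And>s. a \<noteq> k s" "poly (map_poly k p) a = 0"
  shows "p = 0"
proof (rule ccontr)
  assume "p \<noteq> 0"
  interpret k: comm_ring_hom k by fact
  interpret e: comm_ring_hom "\<lambda>p. poly (map_poly k p) a" by (rule comm_ring_hom_eval) fact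
  obtain S where S: "p = smult (lead_coeff p) (\<Prod>x\<in>#S. [:-x, 1:])"
    using alg_closed_imp_factorization[OF \<open>p \<noteq> 0\<close>] by blast
  have k0: "k s = 0 \<Longrightarrow> s = 0" for s
    by (metis k.hom_mult k.hom_one left_inverse mult_zero_right zero_neq_one)
  have "poly (map_poly k p) a = k (lead_coeff p) * poly (map_poly k (\<Prod>x\<in>#S. [:-x, 1:])) a"
    by (subst S) (simp add: map_poly_smult k.hom_mult)
  also have "poly (map_poly k (\<Prod>x\<in>#S. [:-x, 1:])) a = (\<Prod>x\<in>#S. a - k x)"
    by (induction S) (simp_all add: e.hom_mult Polynomial.map_poly_pCons k.hom_uminus del: mult_pCons_left)
  finally have "k (lead_coeff p) = 0 \<or> (\<Prod>x\<in>#S. a - k x) = 0" using assms(3) by simp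
  thus False using assms(2) k0[of "lead_coeff p"] \<open>p \<noteq> 0\<close> by (auto simp: prod_mset_zero_iff)
qed

lemma fps_root_exists:
  fixes F :: "complex fps"
  assumes "fps_nth F 0 = r ^ n" "r \<noteq> 0" "n > 0"
  shows "\<exists>G. G ^ n = F \<and> fps_nth G 0 = r"
proof -
  obtain k where k: "n = Suc k" using assms(3) by (cases n) auto
  have "fps_radical (\<lambda>_ _. r) (Suc k) F ^ Suc k = F"
    using power_radical[of F "\<lambda>_ _. r" k] assms k by simp
  thus ?thesis using k by (intro exI[of _ "fps_radical (\<lambda>_ _. r) n F"]) simp
qed

lemma proj_point_scale: "l \<noteq> 0 \<Longrightarrow> proj_point (l * a) (l * b) (l * c) = proj_point a b c"
proof -
  assume l: "l \<noteq> 0"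
  have "proj_point (l * a) (l * b) (l * c) \<subseteq> proj_point a b c" if "l \<noteq> 0" for l a b c
    using that by (auto simp: proj_point_def mult.assoc[symmetric])
  from this[OF l] this[of "inverse l" "l * a" "l * b" "l * c"] show ?thesis
    using l by (simp add: mult.assoc[symmetric] subset_antisym)
qed

section \<open>A uniformizer at every point of the curve\<close>

context branch
begin

lemma curve_point: "a ^ n + b ^ n = c ^ n"
proof -
  have "\<psi> (gen_x ^ n + y ^ n) = 1" by (simp only: curve lhom_1[OF lhom_psi])
  hence "\<psi> gen_x ^ n + \<psi> y ^ n = 1"
    by (simp add: lhom_add[OF lhom_psi] lhom_power[OF lhom_psi])
  hence "(\<psi> gen_x * fps_to_fls C) ^ n + (\<psi> y * fps_to_fls C) ^ n = fps_to_fls C ^ n"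
    by (simp add: power_mult_distrib flip: distrib_right)
  hence "fps_to_fls (A ^ n + B ^ n) = fps_to_fls (C ^ n)"
    unfolding psi_x psi_y by (simp add: fps_to_fls_power)
  hence "A ^ n + B ^ n = C ^ n" by (simp only: fps_to_fls_eq_iff)
  hence "fps_nth (A ^ n + B ^ n) 0 = fps_nth (C ^ n) 0" by simp
  thus ?thesis by (simp add: fps_power_zeroth at_0)
qed

lemma cong_const_linear:
  assumes "pv 1 f \<noteq> 0"
  shows "cong_const M (gv 1 g / gv 1 f) (pv 1 g / pv 1 f)"
proof -
  let ?s = "pv 1 g / pv 1 f" and ?h = "\<lambda>i j. g i j + (- (pv 1 g / pv 1 f)) * f i j"
  have eq: "gv 1 g / gv 1 f - const ?s = gv 1 ?h / gv 1 f"
    unfolding form_add[OF comm_ring_hom_const] form_cmult[OF comm_ring_hom_const]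
    using gv_neq_0[OF assms] by (simp add: hom_distribs field_simps)
  have "pv 1 ?h = 0"
    unfolding form_add[OF comm_ring_hom_ident] form_cmult[OF comm_ring_hom_ident] using assms by simp
  hence "gv 1 g / gv 1 f - const ?s \<in> M"
    unfolding eq M_iff using assms by blast
  moreover have "gv 1 g / gv 1 f \<in> R" unfolding R_iff using assms by blast
  ultimately show ?thesis by (simp add: cong_const_def)
qed

lemma cong_const_self: "T \<in> R \<Longrightarrow> u - const s = T \<Longrightarrow> u \<in> R \<Longrightarrow> cong_const ((\<lambda>r. T * r) ` R) u s"
  using R_const[of 1] by (auto simp: cong_const_def image_iff intro!: bexI[of _ 1])

text \<open>This is the smoothness of the curve. In affine coordinates, x - a works where b is
  nonzero, y - b where a is nonzero, and 1/y at infinity; in each case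
  \<open>implicit_cong_const\<close> expresses the other coordinate through the parameter.\<close>

lemma uniformizer_exists: "\<exists>T. uniformizer y P T"
proof -
  have lin: "gv 1 (linear_form 1 0 0) = gen_x" "gv 1 (linear_form 0 1 0) = y" "gv 1 (linear_form 0 0 1) = 1"
    "pv 1 (linear_form 1 0 0) = a" "pv 1 (linear_form 0 1 0) = b" "pv 1 (linear_form 0 0 1) = c"
    using coordinates by simp_all
  have eq: "u ^ n - const u0 ^ n = const (-1) * (v ^ n - const v0 ^ n)"
    if "u ^ n + v ^ n = 1" "u0 ^ n + v0 ^ n = 1" for u v u0 v0
  proof -
    have "const (u0 ^ n + v0 ^ n) = 1" using that by simp
    thus ?thesis using that(1) by (simp add: hom_distribs algebra_simps)
  qed
  \<comment> \<open>At most one coordinate of a point of the curve is zero, so these cases are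
    exhaustive.\<close>
  consider "c \<noteq> 0" "b \<noteq> 0" | "c \<noteq> 0" "a \<noteq> 0" | "c = 0" "a \<noteq> 0" "b \<noteq> 0"
    using point_nz curve_point n_pos
    by (cases "c = 0"; cases "a = 0"; cases "b = 0") (auto simp: power_0_left)
  thus ?thesis
  proof cases
    case 1
    have 2: "cong_const M gen_x (a / c)" "cong_const M y (b / c)"
      using cong_const_linear[of "linear_form 0 0 1" "linear_form 1 0 0"]
        cong_const_linear[of "linear_form 0 0 1" "linear_form 0 1 0"] 1 unfolding lin by simp_all
    define T where "T = gen_x - const (a / c)"
    have T: "T \<in> M" "gen_x \<in> R" using 2 by (auto simp: T_def cong_const_def)
    have pt: "(b / c) ^ n + (a / c) ^ n = 1" using curve_point 1 by (simp add: power_divide field_simps)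
    have "cong_const ((\<lambda>r. T * r) ` R) y (b / c)" unfolding T_def
      by (rule implicit_cong_const[OF _ 2(2) _ T(2) eq]) (use T 1 pt curve in \<open>auto simp: T_def add.commute\<close>)
    moreover have "cong_const ((\<lambda>r. T * r) ` R) gen_x (a / c)"
      by (rule cong_const_self) (use T M_subset_R in \<open>auto simp: T_def\<close>)
    moreover have "cong_const ((\<lambda>r. T * r) ` R) 1 1"
      using cong_const_const[OF R_ideal_principal, of T 1] T M_subset_R by auto
    ultimately have "uniformizer y P T"
      using uniformizer_if_cong_const[OF T(1), of "linear_form 0 0 1"] 1 unfolding lin by simp
    thus ?thesis by blast
  next
    case 2
    have 3: "cong_const M gen_x (a / c)" "cong_const M y (b / c)"
      using cong_const_linear[of "linear_form 0 0 1" "linear_form 1 0 0"]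
        cong_const_linear[of "linear_form 0 0 1" "linear_form 0 1 0"] 2 unfolding lin by simp_all
    define T where "T = y - const (b / c)"
    have T: "T \<in> M" "y \<in> R" using 3 by (auto simp: T_def cong_const_def)
    have pt: "(a / c) ^ n + (b / c) ^ n = 1" using curve_point 2 by (simp add: power_divide field_simps)
    have "cong_const ((\<lambda>r. T * r) ` R) gen_x (a / c)" unfolding T_def
      by (rule implicit_cong_const[OF _ 3(1) _ T(2) eq]) (use T 2 pt curve in \<open>auto simp: T_def\<close>)
    moreover have "cong_const ((\<lambda>r. T * r) ` R) y (b / c)"
      by (rule cong_const_self) (use T M_subset_R in \<open>auto simp: T_def\<close>)
    moreover have "cong_const ((\<lambda>r. T * r) ` R) 1 1"
      using cong_const_const[OF R_ideal_principal, of T 1] T M_subset_R by auto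
    ultimately have "uniformizer y P T"
      using uniformizer_if_cong_const[OF T(1), of "linear_form 0 0 1"] 2 unfolding lin by simp
    thus ?thesis by blast
  next
    case 3
    have y0: "y \<noteq> 0" using gv_neq_0[of 1 "linear_form 0 1 0"] 3 unfolding lin by simp
    have 4: "cong_const M (gen_x / y) (a / b)" "cong_const M (1 / y) 0"
      using cong_const_linear[of "linear_form 0 1 0" "linear_form 1 0 0"]
        cong_const_linear[of "linear_form 0 1 0" "linear_form 0 0 1"] 3 unfolding lin by simp_all
    define T where "T = 1 / y"
    have T: "T \<in> M" "1 / y \<in> R" using 4 by (auto simp: T_def cong_const_def)
    have "(a / b) ^ n = - 1" using curve_point 3 n_pos by (simp add: power_divide field_simps zero_power add_eq_0_iff)
    hence "const (a / b) ^ n = - 1" by (metis const.hom_power const.hom_uminus const.hom_one)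
    moreover have "(gen_x / y) ^ n + 1 = (1 / y) ^ n"
    proof -
      have "(gen_x / y) ^ n + 1 = (gen_x ^ n + y ^ n) / y ^ n" using y0 by (simp add: power_divide add_divide_distrib)
      thus ?thesis using curve by (simp add: power_divide)
    qed
    ultimately have eq': "(gen_x / y) ^ n - const (a / b) ^ n = const 1 * ((1 / y) ^ n - const 0 ^ n)"
      using n_pos by simp
    have "cong_const ((\<lambda>r. (1 / y - const 0) * r) ` R) (gen_x / y) (a / b)"
      by (rule implicit_cong_const[OF _ 4(1) _ T(2) eq']) (use T 3 in \<open>auto simp: T_def\<close>)
    hence "cong_const ((\<lambda>r. T * r) ` R) (gen_x / y) (a / b)" by (simp add: T_def)
    moreover have "cong_const ((\<lambda>r. T * r) ` R) (1 / y) 0"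
      by (rule cong_const_self) (use T M_subset_R in \<open>auto simp: T_def\<close>)
    moreover have "cong_const ((\<lambda>r. T * r) ` R) (y / y) 1"
      using cong_const_const[OF R_ideal_principal, of T 1] T M_subset_R y0 by auto
    ultimately have "uniformizer y P T"
      using uniformizer_if_cong_const[OF T(1), of "linear_form 0 1 0"] 3 unfolding lin by simp
    thus ?thesis by blast
  qed
qed

lemma valuation_branch:
  "\<exists>z\<in>L. fls_subdegree (\<psi> z) = 1 \<Longrightarrow> z \<in> L \<Longrightarrow> z \<noteq> 0 \<Longrightarrow> valuation y P z = fls_subdegree (\<psi> z)"
  using uniformizer_exists valuation_eq by blast

end

section \<open>Power series expansions at the points of the curve\<close>

context fermat
begin

text \<open>With x = a + X as parameter, y is the n-th root of 1 - (a + X)^n with constant term b.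
  The root is a power series because b is nonzero.\<close>

lemma branch_x:
  assumes "a ^ n + b ^ n = 1" "b \<noteq> 0"
  obtains \<psi> A B where "branch n \<zeta> \<epsilon> y \<psi> A B 1 a b 1" "\<psi> gen_x = fls_const a + fls_X"
proof -
  let ?A = "fps_const a + fps_X :: complex fps"
  have "fps_nth (1 - ?A ^ n) 0 = b ^ n" using assms by (simp add: fps_power_zeroth algebra_simps)
  then obtain B where B: "B ^ n = 1 - ?A ^ n" "fps_nth B 0 = b"
    using fps_root_exists[OF _ assms(2) n_pos] by blast
  have "fps_to_fls (?A ^ n + B ^ n) = 1" by (simp only: B) simp
  hence eq: "(fls_const a + fls_X) ^ n + fps_to_fls B ^ n = 1"
    by (simp only: fps_to_fls_plus fps_to_fls_power) simp
  have ne: "fls_const a + fls_X \<noteq> fls_const s" for s :: complex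
  proof
    assume "fls_const a + fls_X = fls_const s"
    hence "fls_nth (fls_const a + fls_X) 1 = fls_nth (fls_const s) 1" by (simp only:)
    thus False by simp
  qed
  obtain \<psi> where \<psi>: "lhom \<psi>" "\<psi> gen_x = fls_const a + fls_X" "\<psi> y = fps_to_fls B" "\<And>c. \<psi> (const c) = fls_const c"
    using lift_exists[OF comm_ring_hom_fls_const eq poly_hom_neq_0[OF comm_ring_hom_fls_const ne]] by blast
  have "branch n \<zeta> \<epsilon> y \<psi> ?A B 1 a b 1"
    by unfold_locales (use \<psi> B in simp_all)
  thus ?thesis using that \<psi> by blast
qed

lemma branch_y:
  assumes "a ^ n + b ^ n = 1" "a \<noteq> 0"
  obtains \<psi> A B where "branch n \<zeta> \<epsilon> y \<psi> A B 1 a b 1" "\<psi> y = fls_const b + fls_X"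
proof -
  let ?B = "fps_const b + fps_X :: complex fps"
  have "fps_nth (1 - ?B ^ n) 0 = a ^ n" using assms by (simp add: fps_power_zeroth algebra_simps)
  then obtain A where A: "A ^ n = 1 - ?B ^ n" "fps_nth A 0 = a"
    using fps_root_exists[OF _ assms(2) n_pos] by blast
  have "fps_to_fls (A ^ n + ?B ^ n) = 1" by (simp only: A) simp
  hence eq: "fps_to_fls A ^ n + (fls_const b + fls_X) ^ n = 1"
    by (simp only: fps_to_fls_plus fps_to_fls_power) simp
  have ne': "fls_const b + fls_X \<noteq> fls_const s" for s :: complex
  proof
    assume "fls_const b + fls_X = fls_const s"
    hence "fls_nth (fls_const b + fls_X) 1 = fls_nth (fls_const s) 1" by (simp only:)
    thus False by simp
  qed
  \<comment> \<open>Since \<open>lift_exists\<close> singles out x, it is the series A that must be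
    transcendental, although the parameter is y. A constant A would make b + X algebraic over
    C.\<close>
  have ne: "fps_to_fls A \<noteq> fls_const s" for s
  proof
    assume s: "fps_to_fls A = fls_const s"
    interpret k: comm_ring_hom "fls_const :: complex \<Rightarrow> _" by (rule comm_ring_hom_fls_const)
    interpret e: comm_ring_hom "\<lambda>p. poly (map_poly fls_const p) (fls_const b + fls_X)"
      by (rule comm_ring_hom_eval[OF comm_ring_hom_fls_const])
    let ?p = "[:s ^ n - 1:] + [:0, 1:] ^ n"
    have "poly (map_poly fls_const ?p) (fls_const b + fls_X) = 0"
      using eq unfolding s
      by (simp only: e.hom_add e.hom_power) (simp add: Polynomial.map_poly_pCons k.hom_minus k.hom_power algebra_simps)
    hence "?p = 0" by (rule poly_hom_neq_0[OF comm_ring_hom_fls_const ne'])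
    moreover have "[:0, 1:] ^ n = (Polynomial.monom 1 n :: complex poly)"
      by (simp only: monom_altdef smult_1_left)
    ultimately have "[:s ^ n - 1:] + Polynomial.monom 1 n = 0" by (simp only:)
    hence "coeff ([:s ^ n - 1:] + Polynomial.monom 1 n) n = 0" by (simp only: coeff_0)
    thus False using n_pos by (cases n) simp_all
  qed
  obtain \<psi> where \<psi>: "lhom \<psi>" "\<psi> gen_x = fps_to_fls A" "\<psi> y = fls_const b + fls_X" "\<And>c. \<psi> (const c) = fls_const c"
    using lift_exists[OF comm_ring_hom_fls_const eq poly_hom_neq_0[OF comm_ring_hom_fls_const ne]] by blast
  have "branch n \<zeta> \<epsilon> y \<psi> A ?B 1 a b 1"
    by unfold_locales (use \<psi> A in simp_all)
  thus ?thesis using that \<psi> by blast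
qed

text \<open>The parameter is 1/y: the point is (A : 1 : X) with A^n = X^n - 1 and A(0) = a.\<close>

lemma branch_infinity:
  assumes "a ^ n = -1"
  obtains \<psi> A B C where "branch n \<zeta> \<epsilon> y \<psi> A B C a 1 0" "\<psi> y = fls_X_inv"
proof -
  have a0: "a \<noteq> 0" using assms n_pos by (auto simp: zero_power)
  have "fps_nth (fps_X ^ n - 1) 0 = a ^ n" using assms n_pos by (simp add: fps_power_zeroth)
  then obtain A where A: "A ^ n = fps_X ^ n - 1" "fps_nth A 0 = a"
    using fps_root_exists[OF _ a0 n_pos] by blast
  have A0: "A \<noteq> 0" using A(2) a0 by auto
  have "fps_to_fls (A ^ n) = fls_X ^ n - 1" by (simp only: A fps_to_fls_minus fps_to_fls_power) simp
  hence "fps_to_fls A ^ n * fls_X_inv ^ n = (fls_X ^ n - 1) * fls_X_inv ^ n" by (simp add: fps_to_fls_power)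
  also have "\<dots> = (fls_X * fls_X_inv) ^ n - fls_X_inv ^ n" by (simp only: power_mult_distrib left_diff_distrib mult_1_left)
  also have "fls_X * fls_X_inv = (1 :: complex fls)" by (simp add: fls_X_times_conv_shift fls_X_inv_times_conv_shift)
  finally have eq: "(fps_to_fls A * fls_X_inv) ^ n + fls_X_inv ^ n = 1" by (simp add: power_mult_distrib)
  have ne: "fps_to_fls A * fls_X_inv \<noteq> fls_const s" for s :: complex
  proof
    assume "fps_to_fls A * fls_X_inv = fls_const s"
    hence "fls_subdegree (fps_to_fls A * fls_X_inv) = 0" by simp
    moreover have "fls_subdegree (fps_to_fls A * fls_X_inv) = -1"
      using A0 A(2) a0 by (simp add: fls_subdegree_fls_to_fps)
    ultimately show False by simp
  qed
  obtain \<psi> where \<psi>: "lhom \<psi>" "\<psi> gen_x = fps_to_fls A * fls_X_inv" "\<psi> y = fls_X_inv" "\<And>c. \<psi> (const c) = fls_const c"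
    using lift_exists[OF comm_ring_hom_fls_const eq poly_hom_neq_0[OF comm_ring_hom_fls_const ne]] by blast
  have X1: "fls_X_inv * fls_X = (1 :: complex fls)" by (simp add: fls_X_times_conv_shift fls_X_inv_times_conv_shift)
  have "branch n \<zeta> \<epsilon> y \<psi> A 1 fps_X a 1 0"
    by unfold_locales (use \<psi> A in \<open>simp_all add: mult.assoc X1\<close>)
  thus ?thesis using that \<psi> by blast
qed

end

subsection \<open>Valuations at the points of the curve\<close>

context branch
begin

lemma branch_scale:
  assumes "l \<noteq> 0"
  shows "branch n \<zeta> \<epsilon> y \<psi> (fps_const l * A) (fps_const l * B) (fps_const l * C) (l * a) (l * b) (l * c)"
proof unfold_locales
  show "\<psi> gen_x * fps_to_fls (fps_const l * C) = fps_to_fls (fps_const l * A)"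
    "\<psi> y * fps_to_fls (fps_const l * C) = fps_to_fls (fps_const l * B)"
    using psi_x psi_y by (simp_all add: fls_times_fps_to_fls ac_simps)
qed (use assms lhom_psi psi_const C_nz at_0 point_nz in auto)

end

lemma power_divide_eq_minus_1:
  fixes a b :: "'a::field"
  assumes "b \<noteq> 0" "a ^ n + b ^ n = 0"
  shows "(a / b) ^ n = - 1"
proof -
  have "a ^ n = - (b ^ n)" using assms(2) by (simp add: eq_neg_iff_add_eq_0)
  thus ?thesis using assms(1) by (simp add: power_divide)
qed

context fermat
begin

abbreviation val :: "point \<Rightarrow> ambient \<Rightarrow> int" where "val \<equiv> valuation y"

lemma branch_exists:
  assumes pt: "(a, b, c) \<noteq> (0, 0, 0)" "a ^ n + b ^ n = c ^ n"
  obtains \<psi> A B C where "branch n \<zeta> \<epsilon> y \<psi> A B C a b c" "\<exists>z\<in>L. fls_subdegree (\<psi> z) = 1"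
proof (cases "c = 0")
  case False
  have eq: "(a / c) ^ n + (b / c) ^ n = 1" using pt False by (simp add: power_divide field_simps)
  hence "a / c \<noteq> 0 \<or> b / c \<noteq> 0" using n_pos by (auto simp: power_0_left)
  then obtain \<psi> A B z where br: "branch n \<zeta> \<epsilon> y \<psi> A B 1 (a / c) (b / c) 1" "z \<in> L" "\<psi> z = fls_X"
  proof
    assume "b / c \<noteq> 0"
    then obtain \<psi> A B where 1: "branch n \<zeta> \<epsilon> y \<psi> A B 1 (a / c) (b / c) 1" "\<psi> gen_x = fls_const (a / c) + fls_X"
      using branch_x[OF eq] by blast
    interpret branch n \<zeta> \<epsilon> y \<psi> A B 1 "a / c" "b / c" 1 by (rule 1)
    have "\<psi> (gen_x - const (a / c)) = fls_X" by (simp add: lhom_diff[OF lhom_psi] psi_const 1)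
    thus ?thesis using that[OF 1(1), of "gen_x - const (a / c)"] by simp
  next
    assume "a / c \<noteq> 0"
    then obtain \<psi> A B where 1: "branch n \<zeta> \<epsilon> y \<psi> A B 1 (a / c) (b / c) 1" "\<psi> y = fls_const (b / c) + fls_X"
      using branch_y[OF eq] by blast
    interpret branch n \<zeta> \<epsilon> y \<psi> A B 1 "a / c" "b / c" 1 by (rule 1)
    have "\<psi> (y - const (b / c)) = fls_X" by (simp add: lhom_diff[OF lhom_psi] psi_const 1)
    thus ?thesis using that[OF 1(1), of "y - const (b / c)"] by simp
  qed
  interpret branch n \<zeta> \<epsilon> y \<psi> A B 1 "a / c" "b / c" 1 by (rule br)
  have "fls_subdegree (\<psi> z) = 1" by (simp add: br)
  thus ?thesis using that[of \<psi> "fps_const c * A" "fps_const c * B" "fps_const c * 1"] branch_scale[OF False] br(2) False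
    by auto
next
  case True
  have b: "b \<noteq> 0"
  proof
    assume "b = 0"
    hence "a ^ n = 0" using pt True n_pos by (simp add: power_0_left)
    thus False using pt True \<open>b = 0\<close> by simp
  qed
  have "(a / b) ^ n = -1"
    by (rule power_divide_eq_minus_1[OF b]) (use pt True n_pos in simp)
  then obtain \<psi> A B C where 1: "branch n \<zeta> \<epsilon> y \<psi> A B C (a / b) 1 0" "\<psi> y = fls_X_inv"
    using branch_infinity by blast
  interpret branch n \<zeta> \<epsilon> y \<psi> A B C "a / b" 1 0 by (rule 1)
  have "fls_subdegree (\<psi> (inverse y)) = 1" by (simp add: lhom_inverse[OF lhom_psi] 1)
  thus ?thesis using that[of \<psi> "fps_const b * A" "fps_const b * B" "fps_const b * C"] branch_scale[OF b] True b
    by (auto intro: bexI[of _ "inverse y"])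
qed

lemma fermat_curve_iff: "Q \<in> fermat_curve n \<longleftrightarrow>
    (\<exists>a b c. Q = proj_point a b c \<and> (a, b, c) \<noteq> (0, 0, 0) \<and> a ^ n + b ^ n = c ^ n)"
  unfolding fermat_curve_def by blast

lemma fermat_curve_affine [simp]: "a ^ n + b ^ n = 1 \<Longrightarrow> proj_point a b 1 \<in> fermat_curve n"
  unfolding fermat_curve_iff by (intro exI[of _ a] exI[of _ b] exI[of _ 1]) simp

lemma fermat_curve_infinity [simp]: "a ^ n = - 1 \<Longrightarrow> proj_point a 1 0 \<in> fermat_curve n"
  unfolding fermat_curve_iff using n_pos by (intro exI[of _ a] exI[of _ 1] exI[of _ 0]) simp

lemma fermat_curve_cases:
  assumes "Q \<in> fermat_curve n"
  obtains (affine) a b where "Q = proj_point a b 1" "a ^ n + b ^ n = 1"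
  | (infinity) a where "Q = proj_point a 1 0" "a ^ n = -1"
proof -
  obtain a b c where Q: "Q = proj_point a b c" "(a, b, c) \<noteq> (0, 0, 0)" "a ^ n + b ^ n = c ^ n"
    using assms unfolding fermat_curve_iff by blast
  show ?thesis
  proof (cases "c = 0")
    case False
    hence "Q = proj_point (a / c) (b / c) 1" using Q(1) proj_point_scale[of c "a / c" "b / c" 1] by simp
    moreover have "(a / c) ^ n + (b / c) ^ n = 1" using Q False by (simp add: power_divide field_simps)
    ultimately show ?thesis using affine by blast
  next
    case True
    have b: "b \<noteq> 0"
    proof
      assume "b = 0"
      hence "a ^ n = 0" using Q True n_pos by (simp add: power_0_left)
      thus False using Q True \<open>b = 0\<close> by simp
    qed
    have "Q = proj_point (a / b) 1 0" using Q(1) proj_point_scale[of b "a / b" 1 0] b True by simp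
    moreover have "(a / b) ^ n = -1"
      by (rule power_divide_eq_minus_1[OF b]) (use Q True n_pos in simp)
    ultimately show ?thesis using infinity by blast
  qed
qed

text \<open>From here on, the general laws of the valuation are read off from the order of Laurent
  series, without reference to forms or coordinates of the point.\<close>

lemma val_lhom:
  assumes "Q \<in> fermat_curve n"
  obtains \<psi> where "lhom \<psi>" "\<And>c. \<psi> (const c) = fls_const c"
    "\<And>z. z \<in> L \<Longrightarrow> z \<noteq> 0 \<Longrightarrow> val Q z = fls_subdegree (\<psi> z)"
proof -
  obtain a b c where Q: "Q = proj_point a b c" "(a, b, c) \<noteq> (0, 0, 0)" "a ^ n + b ^ n = c ^ n"
    using assms unfolding fermat_curve_iff by blast
  obtain \<psi> A B C where *: "branch n \<zeta> \<epsilon> y \<psi> A B C a b c" "\<exists>z\<in>L. fls_subdegree (\<psi> z) = 1"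
    by (rule branch_exists[OF Q(2,3)])
  interpret branch n \<zeta> \<epsilon> y \<psi> A B C a b c by (rule *)
  show ?thesis by (rule that[OF lhom_psi psi_const]) (simp add: Q(1) valuation_branch[OF *(2)])
qed

context
  fixes Q assumes Q: "Q \<in> fermat_curve n"
begin

lemma val_mult: "u \<in> L \<Longrightarrow> u \<noteq> 0 \<Longrightarrow> w \<in> L \<Longrightarrow> w \<noteq> 0 \<Longrightarrow> val Q (u * w) = val Q u + val Q w"
  by (rule val_lhom[OF Q]) (simp add: lhom_mult lhom_eq_0_iff)

lemma val_inverse: "u \<in> L \<Longrightarrow> u \<noteq> 0 \<Longrightarrow> val Q (inverse u) = - val Q u"
  by (rule val_lhom[OF Q]) (simp add: lhom_inverse lhom_eq_0_iff)

lemma val_divide: "u \<in> L \<Longrightarrow> u \<noteq> 0 \<Longrightarrow> w \<in> L \<Longrightarrow> w \<noteq> 0 \<Longrightarrow> val Q (u / w) = val Q u - val Q w"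
  by (simp add: field_class.field_divide_inverse val_mult val_inverse)

lemma val_const: "c \<noteq> 0 \<Longrightarrow> val Q (const c) = 0"
  by (rule val_lhom[OF Q]) simp

lemma val_1: "val Q 1 = 0"
  using val_const[of 1] by simp

lemma val_power: "u \<in> L \<Longrightarrow> u \<noteq> 0 \<Longrightarrow> val Q (u ^ i) = int i * val Q u"
  by (induction i) (simp_all add: val_1 val_mult algebra_simps)

lemma val_power_int: "u \<in> L \<Longrightarrow> u \<noteq> 0 \<Longrightarrow> val Q (u powi i) = i * val Q u"
  by (simp add: power_int_def val_power val_inverse)

lemma val_prod:
  "(\<And>i. i \<in> I \<Longrightarrow> f i \<in> L \<and> f i \<noteq> 0) \<Longrightarrow> val Q (prod f I) = (\<Sum>i\<in>I. val Q (f i))"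
proof (induction I rule: infinite_finite_induct)
  case (insert i I)
  hence "prod f I \<in> L" "prod f I \<noteq> 0" by auto
  thus ?case using insert by (simp add: val_mult)
qed (simp_all add: val_1)

lemma val_residue:
  assumes "z \<in> L" "z \<noteq> 0" "val Q z \<ge> 0"
  obtains c where "z = const c \<or> val Q (z - const c) > 0"
proof -
  obtain \<psi> where \<psi>: "lhom \<psi>" "\<And>c. \<psi> (const c) = fls_const c"
    "\<And>z. z \<in> L \<Longrightarrow> z \<noteq> 0 \<Longrightarrow> val Q z = fls_subdegree (\<psi> z)"
    by (rule val_lhom[OF Q], rule that)
  define c where "c = fls_nth (\<psi> z) 0"
  show ?thesis
  proof (rule that[of c], rule disjCI)
    assume "\<not> val Q (z - const c) > 0"
    show "z = const c"
    proof (rule ccontr)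
      assume "z \<noteq> const c"
      hence nz: "z - const c \<in> L" "z - const c \<noteq> 0" using assms by auto
      have eq: "\<psi> (z - const c) = \<psi> z - fls_const c" using \<psi> assms by (simp add: lhom_diff)
      have "fls_subdegree (\<psi> (z - const c)) > 0"
      proof (rule fls_subdegree_greaterI)
        show "\<psi> (z - const c) \<noteq> 0" using nz by (simp add: lhom_eq_0_iff[OF \<psi>(1)])
        have "fls_nth (\<psi> z) k = 0" if "k < 0" for k
          using \<psi>(3)[OF assms(1,2)] assms(3) that by simp
        thus "fls_nth (\<psi> (z - const c)) k = 0" if "k \<le> 0" for k
          using that unfolding eq by (cases "k = 0") (simp_all add: c_def[symmetric])
      qed
      thus False using \<psi>(3)[OF nz] \<open>\<not> val Q (z - const c) > 0\<close> by simp
    qed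
  qed
qed

lemma val_add_ge:
  assumes "u \<in> L" "u \<noteq> 0" "w \<in> L" "w \<noteq> 0" "u + w \<noteq> 0"
  shows "val Q (u + w) \<ge> min (val Q u) (val Q w)"
proof -
  obtain \<psi> where \<psi>: "lhom \<psi>" 
    "\<And>c. \<psi> (const c) = fls_const c" "\<And>z. z \<in> L \<Longrightarrow> z \<noteq> 0 \<Longrightarrow> val Q z = fls_subdegree (\<psi> z)"
    by (rule val_lhom[OF Q], rule that)
  have "\<psi> u + \<psi> w \<noteq> 0" using assms lhom_eq_0_iff[OF \<psi>(1), of "u + w"] by (simp add: lhom_add[OF \<psi>(1)])
  thus ?thesis using assms fls_plus_subdegree[of "\<psi> u" "\<psi> w"] by (simp add: \<psi>(3) lhom_add[OF \<psi>(1)])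
qed

lemma val_add_eq:
  assumes "u \<in> L" "u \<noteq> 0" "w \<in> L" "w \<noteq> 0" "val Q u < val Q w"
  shows "val Q (u + w) = val Q u" "u + w \<noteq> 0"
proof -
  obtain \<psi> where \<psi>: "lhom \<psi>" 
    "\<And>c. \<psi> (const c) = fls_const c" "\<And>z. z \<in> L \<Longrightarrow> z \<noteq> 0 \<Longrightarrow> val Q z = fls_subdegree (\<psi> z)"
    by (rule val_lhom[OF Q], rule that)
  have u: "\<psi> u \<noteq> 0" using assms by (simp add: lhom_eq_0_iff[OF \<psi>(1)])
  show nz: "u + w \<noteq> 0"
  proof
    assume "u + w = 0"
    hence "w = const (-1) * u" by (simp add: hom_distribs add_eq_0_iff)
    thus False using assms val_mult[of "const (-1)" u] val_const[of "-1"] by simp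
  qed
  show "val Q (u + w) = val Q u"
    using assms fls_subdegree_add_eq1[OF u, of "\<psi> w"] nz by (simp add: \<psi>(3) lhom_add[OF \<psi>(1)])
qed

lemma val_minus_const_0:
  assumes "z \<in> L" "z = const c \<or> val Q (z - const c) > 0" "c \<noteq> d"
  shows "val Q (z - const d) = 0" "z \<noteq> const d"
proof -
  have eq: "z - const d = const (c - d) + (z - const c)" by (simp add: hom_distribs)
  have "val Q (z - const d) = 0 \<and> z - const d \<noteq> 0"
  proof (cases "z = const c")
    case True
    thus ?thesis using assms val_const[of "c - d"] by (simp add: hom_distribs)
  next
    case False
    have z: "const (c - d) \<in> L" "const (c - d) \<noteq> 0" "z - const c \<in> L" "z - const c \<noteq> 0"
      using assms False by simp_all
    have "val Q (const (c - d)) < val Q (z - const c)" using assms False val_const[of "c - d"] by simp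
    from val_add_eq[OF z this] show ?thesis unfolding eq using val_const[of "c - d"] assms by simp
  qed
  thus "val Q (z - const d) = 0" "z \<noteq> const d" by auto
qed

lemma val_minus_const_neg:
  assumes "z \<in> L" "z \<noteq> 0" "val Q z < 0"
  shows "val Q (z - const d) = val Q z" "z \<noteq> const d"
proof -
  have "val Q (z - const d) = val Q z \<and> z - const d \<noteq> 0"
  proof (cases "d = 0")
    case False
    have "const (-d) \<in> L" "const (-d) \<noteq> 0" "val Q z < val Q (const (-d))"
      using False assms val_const[of "-d"] by simp_all
    from val_add_eq[OF assms(1,2) this] show ?thesis by (simp add: hom_distribs)
  qed (use assms in simp)
  thus "val Q (z - const d) = val Q z" "z \<noteq> const d" by auto
qed

end

lemma gen_x_not_const [simp]: "gen_x \<noteq> const s"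
proof
  assume "gen_x = const s"
  hence "poly (map_poly const [:-s, 1:]) gen_x = 0" by (simp add: Polynomial.map_poly_pCons hom_distribs)
  thus False unfolding gen_x_transcendental by simp
qed

lemma eps_n: "\<epsilon> ^ n = -1" and zeta_n: "\<zeta> ^ n = 1"
  using eps zeta by (simp_all add: is_primitive_root_def)

lemma eps_nz [simp]: "\<epsilon> \<noteq> 0" and zeta_nz [simp]: "\<zeta> \<noteq> 0"
  using eps_n zeta_n n_pos by (auto simp: power_0_left)

lemma gen_y_not_const [simp]: "y \<noteq> const s"
proof
  assume s: "y = const s"
  obtain \<psi> A B C where 1: "branch n \<zeta> \<epsilon> y \<psi> A B C \<epsilon> 1 0" "\<psi> y = fls_X_inv"
    using branch_infinity[OF eps_n] by blast
  interpret branch n \<zeta> \<epsilon> y \<psi> A B C \<epsilon> 1 0 by (rule 1)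
  have "fls_subdegree (fls_const s) = fls_subdegree (fls_X_inv :: complex fls)"
    unfolding 1(2)[symmetric] s psi_const ..
  thus False by simp
qed

lemma gen_nz [simp]: "gen_x \<noteq> 0" "y \<noteq> 0"
  using gen_x_not_const[of 0] gen_y_not_const[of 0] by simp_all

text \<open>At a point with b = 0 the function x - a is ramified, and likewise y - b where a = 0;
  only positivity is claimed uniformly.\<close>

lemma val_affine:
  assumes "a ^ n + b ^ n = 1"
  shows "b \<noteq> 0 \<Longrightarrow> val (proj_point a b 1) (gen_x - const a) = 1"
    "a \<noteq> 0 \<Longrightarrow> val (proj_point a b 1) (y - const b) = 1"
    "val (proj_point a b 1) (gen_x - const a) > 0"
    "val (proj_point a b 1) (y - const b) > 0"
proof -
  obtain \<psi> A B C where br: "branch n \<zeta> \<epsilon> y \<psi> A B C a b 1" "\<exists>z\<in>L. fls_subdegree (\<psi> z) = 1"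
    by (rule branch_exists[of a b 1]) (use assms in auto)
  interpret branch n \<zeta> \<epsilon> y \<psi> A B C a b 1 by (rule br)
  have lin: "gv 1 (linear_form 1 0 0) = gen_x" "gv 1 (linear_form 0 1 0) = y" "gv 1 (linear_form 0 0 1) = 1"
    "pv 1 (linear_form 1 0 0) = a" "pv 1 (linear_form 0 1 0) = b" "pv 1 (linear_form 0 0 1) = 1"
    using coordinates by simp_all
  have "cong_const M gen_x a" "cong_const M y b"
    using cong_const_linear[of "linear_form 0 0 1" "linear_form 1 0 0"]
      cong_const_linear[of "linear_form 0 0 1" "linear_form 0 1 0"] unfolding lin by simp_all
  hence "gen_x - const a \<in> M" "y - const b \<in> M" by (simp_all add: cong_const_def)
  thus "val (proj_point a b 1) (gen_x - const a) > 0" "val (proj_point a b 1) (y - const b) > 0"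
    using psi_M[of "gen_x - const a"] psi_M[of "y - const b"]
      valuation_branch[OF br(2), of "gen_x - const a"] valuation_branch[OF br(2), of "y - const b"] by auto
next
  assume "b \<noteq> 0"
  then obtain \<psi> A B where br: "branch n \<zeta> \<epsilon> y \<psi> A B 1 a b 1" "\<psi> gen_x = fls_const a + fls_X"
    using branch_x[OF assms] by blast
  interpret branch n \<zeta> \<epsilon> y \<psi> A B 1 a b 1 by (rule br)
  have "\<psi> (gen_x - const a) = fls_X" by (simp add: lhom_diff[OF lhom_psi] psi_const br)
  hence sd: "fls_subdegree (\<psi> (gen_x - const a)) = 1" by simp
  hence one: "\<exists>z\<in>L. fls_subdegree (\<psi> z) = 1" by (intro bexI[of _ "gen_x - const a"]) simp_all
  show "val (proj_point a b 1) (gen_x - const a) = 1" using valuation_branch[OF one, of "gen_x - const a"] sd by simp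
next
  assume "a \<noteq> 0"
  then obtain \<psi> A B where br: "branch n \<zeta> \<epsilon> y \<psi> A B 1 a b 1" "\<psi> y = fls_const b + fls_X"
    using branch_y[OF assms] by blast
  interpret branch n \<zeta> \<epsilon> y \<psi> A B 1 a b 1 by (rule br)
  have "\<psi> (y - const b) = fls_X" by (simp add: lhom_diff[OF lhom_psi] psi_const br)
  hence sd: "fls_subdegree (\<psi> (y - const b)) = 1" by simp
  hence one: "\<exists>z\<in>L. fls_subdegree (\<psi> z) = 1" by (intro bexI[of _ "y - const b"]) simp_all
  show "val (proj_point a b 1) (y - const b) = 1" using valuation_branch[OF one, of "y - const b"] sd by simp
qed

lemma val_infinity:
  assumes "a ^ n = -1"
  shows "val (proj_point a 1 0) y = -1" "val (proj_point a 1 0) gen_x = -1"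
proof -
  obtain \<psi> A B C where br: "branch n \<zeta> \<epsilon> y \<psi> A B C a 1 0" "\<psi> y = fls_X_inv"
    using branch_infinity[OF assms] by blast
  interpret branch n \<zeta> \<epsilon> y \<psi> A B C a 1 0 by (rule br)
  have one: "\<exists>z\<in>L. fls_subdegree (\<psi> z) = 1"
    by (rule bexI[of _ "inverse y"]) (simp_all add: lhom_inverse[OF lhom_psi] br)
  show vy: "val (proj_point a 1 0) y = -1" using valuation_branch[OF one] br by simp
  have Q: "proj_point a 1 0 \<in> fermat_curve n" using assms by simp
  have L': "y ^ n \<in> L" "y ^ n \<noteq> 0" "const (-1) \<in> L" "const (-1) \<noteq> 0" by simp_all
  \<comment> \<open>The pole of x is found from that of y through y^n - 1 = -x^n.\<close>
  have "val (proj_point a 1 0) (y ^ n + const (-1)) = - int n"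
    using val_add_eq(1)[OF Q L'] val_power[OF Q, of y n] vy val_const[OF Q, of "-1"] n_pos by simp
  moreover have "y ^ n + const (-1) = const (-1) * gen_x ^ n" using curve by (simp add: hom_distribs algebra_simps)
  ultimately have "int n * val (proj_point a 1 0) gen_x = - int n"
    using val_mult[OF Q, of "const (-1)" "gen_x ^ n"] val_const[OF Q, of "-1"] val_power[OF Q, of gen_x n] by simp
  hence "int n * (val (proj_point a 1 0) gen_x + 1) = 0" by (simp add: distrib_left)
  thus "val (proj_point a 1 0) gen_x = -1" using n_pos by simp
qed

end

subsection \<open>Automorphisms of the curve\<close>

lemma complex_poly_induct [consumes 1, case_names const linear]:
  fixes p :: "complex poly"
  assumes "p \<noteq> 0" and "\<And>c. c \<noteq> 0 \<Longrightarrow> P [:c:]"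
    and "\<And>x p. p \<noteq> 0 \<Longrightarrow> P p \<Longrightarrow> P ([:-x, 1:] * p)"
  shows "P p"
proof -
  obtain S where S: "p = smult (lead_coeff p) (\<Prod>x\<in>#S. [:-x, 1:])"
    using alg_closed_imp_factorization[OF assms(1)] by blast
  have "c \<noteq> 0 \<Longrightarrow> P (smult c (\<Prod>x\<in>#S. [:-x, 1:]))" for c
  proof (induction S)
    case empty
    thus ?case using assms(2)[of c] by (simp add: one_pCons)
  next
    case (add x S)
    have "P ([:-x, 1:] * smult c (\<Prod>x\<in>#S. [:-x, 1:]))"
      by (rule assms(3)) (use add in \<open>auto simp: prod_mset_zero_iff\<close>)
    thus ?case by (simp only: image_mset_add_mset prod_mset.add_mset mult_smult_right)
  qed
  thus ?thesis using S assms(1) by (metis leading_coeff_0_iff)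
qed

context fermat
begin

definition aut :: "(ambient \<Rightarrow> ambient) \<Rightarrow> bool" where
  "aut \<alpha> \<longleftrightarrow> lhom \<alpha> \<and> (\<forall>c. \<alpha> (const c) = const c) \<and> \<alpha> ` L = L"

lemma autD:
  assumes "aut \<alpha>"
  shows "lhom \<alpha>" "\<alpha> (const c) = const c" "z \<in> L \<Longrightarrow> \<alpha> z \<in> L"
  using assms by (auto simp: aut_def)

lemma aut_surj: "aut \<alpha> \<Longrightarrow> z \<in> L \<Longrightarrow> \<exists>w\<in>L. \<alpha> w = z"
  by (auto simp: aut_def image_iff set_eq_iff Bex_def) metis

lemma aut_nz [simp]: "aut \<alpha> \<Longrightarrow> z \<in> L \<Longrightarrow> \<alpha> z = 0 \<longleftrightarrow> z = 0"
  using lhom_eq_0_iff autD(1) by blast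

lemma lhom_unique:
  assumes "lhom \<alpha>" "lhom \<beta>" "\<And>c. \<alpha> (const c) = \<beta> (const c)" "\<alpha> gen_x = \<beta> gen_x" "\<alpha> y = \<beta> y" "z \<in> L"
  shows "\<alpha> z = \<beta> z"
  using assms(6)
  by (induction rule: fermat_field.induct)
    (simp_all add: assms lhom_simps[OF assms(1)] lhom_simps[OF assms(2)])

lemma lhom_comp: "lhom \<psi> \<Longrightarrow> aut \<alpha> \<Longrightarrow> lhom (\<lambda>z. \<psi> (\<alpha> z))"
  unfolding lhom_def[of "\<lambda>z. \<psi> (\<alpha> z)"]
  by (simp add: lhom_simps[OF autD(1)] lhom_simps[of \<psi>] autD(3))

definition lift :: "ambient \<Rightarrow> ambient \<Rightarrow> ambient \<Rightarrow> ambient" where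
  "lift u w = (SOME \<alpha>. lhom \<alpha> \<and> (\<forall>c. \<alpha> (const c) = const c) \<and> \<alpha> gen_x = u \<and> \<alpha> y = w)"

lemma lift:
  assumes "u ^ n + w ^ n = 1" "\<And>s. u \<noteq> const s"
  shows "lhom (lift u w)" "lift u w (const c) = const c" "lift u w gen_x = u" "lift u w y = w"
proof -
  have "\<exists>\<alpha>. lhom \<alpha> \<and> (\<forall>c. \<alpha> (const c) = const c) \<and> \<alpha> gen_x = u \<and> \<alpha> y = w"
    by (rule lift_exists[OF comm_ring_hom_const assms(1) poly_hom_neq_0[OF comm_ring_hom_const assms(2)]]) blast+
  from someI_ex[OF this]
  show "lhom (lift u w)" "lift u w (const c) = const c" "lift u w gen_x = u" "lift u w y = w"
    by (simp_all add: lift_def)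
qed

text \<open>The image of L is closed under the field operations and contains the constants, so
  surjectivity onto L has to be checked on the two generators only.\<close>

lemma aut_lift:
  assumes "u ^ n + w ^ n = 1" "\<And>s. u \<noteq> const s" "u \<in> L" "w \<in> L"
    and "gen_x \<in> lift u w ` L" "y \<in> lift u w ` L"
  shows "aut (lift u w)"
proof -
  note l = lift[OF assms(1,2)]
  have 1: "lift u w z \<in> L" if "z \<in> L" for z using that
    by (induction rule: fermat_field.induct) (use l assms in \<open>simp_all add: lhom_simps[OF l(1)]\<close>)
  have 2: "z \<in> lift u w ` L" if "z \<in> L" for z using that
  proof (induction rule: fermat_field.induct)
    case (const c)
    show ?case using l(2)[of c] by (metis fermat_field.const image_eqI)
  next
    case (add z z')
    then obtain r r' where *: "z = lift u w r" "z' = lift u w r'" "r \<in> L" "r' \<in> L" by blast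
    hence "z + z' = lift u w (r + r')" by (simp add: lhom_add[OF l(1)])
    thus ?case using * by blast
  next
    case (diff z z')
    then obtain r r' where *: "z = lift u w r" "z' = lift u w r'" "r \<in> L" "r' \<in> L" by blast
    hence "z - z' = lift u w (r - r')" by (simp add: lhom_diff[OF l(1)])
    thus ?case using * by blast
  next
    case (mult z z')
    then obtain r r' where *: "z = lift u w r" "z' = lift u w r'" "r \<in> L" "r' \<in> L" by blast
    hence "z * z' = lift u w (r * r')" by (simp add: lhom_mult[OF l(1)])
    thus ?case using * by blast
  next
    case (inverse z)
    then obtain r where *: "z = lift u w r" "r \<in> L" by blast
    hence "inverse z = lift u w (inverse r)" by (simp add: lhom_inverse[OF l(1)])
    thus ?case using * by blast
  qed (use assms in auto)
  show ?thesis unfolding aut_def using l 1 2 by blast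
qed

definition sigma where "sigma = lift (const \<zeta> * gen_x) y"
definition tau where "tau = lift gen_x (const \<zeta> * y)"
definition swp where "swp = lift y gen_x"
text \<open>This exchanges X and Z: (x : y : 1) goes to (1 : y/\<epsilon> : x). The factor
  1/\<epsilon>, an n-th root of -1, repairs the sign in the equation. It exchanges the families a
  and c.\<close>

definition kap where "kap = lift (1 / gen_x) (y / (const \<epsilon> * gen_x))"

lemma const_zeta_n: "const \<zeta> ^ n = 1" and const_eps_n: "const \<epsilon> ^ n = -1"
  using zeta_n eps_n by (metis const.hom_power const.hom_one const.hom_uminus)+

lemma const_inverse: "const (inverse c) = inverse (const c)"
proof (cases "c = 0")
  case False
  hence "const (inverse c) * const c = 1" by (simp add: const.hom_mult[symmetric])
  thus ?thesis by (metis inverse_unique mult.commute)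
qed simp

lemma const_divide: "const (c / d) = const c / const d"
  by (simp add: field_class.field_divide_inverse const.hom_mult const_inverse)

lemma sigma: "aut sigma" "sigma gen_x = const \<zeta> * gen_x" "sigma y = y"
proof -
  have eq: "(const \<zeta> * gen_x) ^ n + y ^ n = 1" using curve by (simp add: power_mult_distrib const_zeta_n)
  have nc: "const \<zeta> * gen_x \<noteq> const s" for s
  proof
    assume "const \<zeta> * gen_x = const s"
    hence "gen_x = const (s / \<zeta>)" by (simp add: const_divide field_simps)
    thus False by simp
  qed
  note l = lift[OF eq nc, folded sigma_def]
  show "sigma gen_x = const \<zeta> * gen_x" "sigma y = y" by (simp_all add: l)
  have "sigma (const (1 / \<zeta>) * gen_x) = const (1 / \<zeta>) * (const \<zeta> * gen_x)"
    by (simp add: lhom_mult[OF l(1)] l)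
  also have "\<dots> = gen_x" by (simp add: mult.assoc[symmetric] const.hom_mult[symmetric])
  finally have "gen_x \<in> sigma ` L" by (intro image_eqI[of _ _ "const (1 / \<zeta>) * gen_x"]) simp_all
  moreover have "y \<in> sigma ` L" using l(4) by (intro image_eqI[of _ _ y]) simp_all
  ultimately show "aut sigma" using aut_lift[OF eq nc, folded sigma_def] by simp
qed

lemma tau: "aut tau" "tau gen_x = gen_x" "tau y = const \<zeta> * y"
proof -
  have eq: "gen_x ^ n + (const \<zeta> * y) ^ n = 1" using curve by (simp add: power_mult_distrib const_zeta_n)
  note l = lift[OF eq gen_x_not_const, folded tau_def]
  show "tau gen_x = gen_x" "tau y = const \<zeta> * y" by (simp_all add: l)
  have "tau (const (1 / \<zeta>) * y) = const (1 / \<zeta>) * (const \<zeta> * y)"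
    by (simp add: lhom_mult[OF l(1)] l)
  also have "\<dots> = y" by (simp add: mult.assoc[symmetric] const.hom_mult[symmetric])
  finally have "y \<in> tau ` L" by (intro image_eqI[of _ _ "const (1 / \<zeta>) * y"]) simp_all
  moreover have "gen_x \<in> tau ` L" using l(3) by (intro image_eqI[of _ _ gen_x]) simp_all
  ultimately show "aut tau" using aut_lift[OF eq gen_x_not_const, folded tau_def] by simp
qed

lemma swp: "aut swp" "swp gen_x = y" "swp y = gen_x"
proof -
  have eq: "y ^ n + gen_x ^ n = 1" using curve by (simp add: add.commute)
  note l = lift[OF eq gen_y_not_const, folded swp_def]
  show "swp gen_x = y" "swp y = gen_x" by (simp_all add: l)
  have "gen_x \<in> swp ` L" "y \<in> swp ` L"
    using l(3,4) by (auto intro: image_eqI[of _ _ y] image_eqI[of _ _ gen_x])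
  thus "aut swp" using aut_lift[OF eq gen_y_not_const, folded swp_def] by simp
qed

lemma kap: "aut kap" "kap gen_x = 1 / gen_x" "kap y = y / (const \<epsilon> * gen_x)"
proof -
  have yn: "y ^ n = 1 - gen_x ^ n" using curve by (simp add: algebra_simps)
  have eq: "(1 / gen_x) ^ n + (y / (const \<epsilon> * gen_x)) ^ n = 1"
    by (simp add: power_divide power_mult_distrib const_eps_n yn field_simps)
  have nc: "1 / gen_x \<noteq> const s" for s
  proof
    assume "1 / gen_x = const s"
    hence "inverse (1 / gen_x) = const (inverse s)" by (simp only: const_inverse)
    hence "gen_x = const (inverse s)" by simp
    thus False by simp
  qed
  note l = lift[OF eq nc, folded kap_def]
  show "kap gen_x = 1 / gen_x" "kap y = y / (const \<epsilon> * gen_x)" by (simp_all add: l)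
  have "kap (1 / gen_x) = gen_x" by (simp add: lhom_divide[OF l(1)] lhom_1[OF l(1)] l)
  hence "gen_x \<in> kap ` L" by (intro image_eqI[of _ _ "1 / gen_x"]) simp_all
  moreover have "kap (const \<epsilon> * y / gen_x) = y" by (simp add: lhom_divide[OF l(1)] lhom_mult[OF l(1)] l)
  hence "y \<in> kap ` L" by (intro image_eqI[of _ _ "const \<epsilon> * y / gen_x"]) simp_all
  ultimately show "aut kap" using aut_lift[OF eq nc, folded kap_def] by simp
qed

text \<open>Composing a branch with an automorphism gives a branch at the image point, and
  surjectivity of the automorphism provides the element of order 1 there.\<close>

lemma val_comp:
  assumes pt: "(a, b, c) \<noteq> (0, 0, 0)" "a ^ n + b ^ n = c ^ n" and \<alpha>: "aut \<alpha>"
    and br: "\<And>\<psi> A B C. branch n \<zeta> \<epsilon> y \<psi> A B C a b c \<Longrightarrow>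
      \<exists>A' B' C'. branch n \<zeta> \<epsilon> y (\<lambda>z. \<psi> (\<alpha> z)) A' B' C' a' b' c'"
    and z: "z \<in> L" "z \<noteq> 0"
  shows "val (proj_point a b c) (\<alpha> z) = val (proj_point a' b' c') z"
proof -
  obtain \<psi> A B C where 1: "branch n \<zeta> \<epsilon> y \<psi> A B C a b c" "\<exists>z\<in>L. fls_subdegree (\<psi> z) = 1"
    by (rule branch_exists[OF pt])
  obtain A' B' C' where 2: "branch n \<zeta> \<epsilon> y (\<lambda>z. \<psi> (\<alpha> z)) A' B' C' a' b' c'" using br[OF 1(1)] by blast
  interpret b1: branch n \<zeta> \<epsilon> y \<psi> A B C a b c by (rule 1)
  interpret b2: branch n \<zeta> \<epsilon> y "\<lambda>z. \<psi> (\<alpha> z)" A' B' C' a' b' c' by (rule 2)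
  have "\<exists>z\<in>L. fls_subdegree (\<psi> (\<alpha> z)) = 1" using 1(2) aut_surj[OF \<alpha>] by metis
  thus ?thesis using b1.valuation_branch[OF 1(2), of "\<alpha> z"] b2.valuation_branch[of z] z \<alpha> autD(3) by simp
qed

context
  fixes a b c :: complex and z :: ambient
  assumes pt: "(a, b, c) \<noteq> (0, 0, 0)" "a ^ n + b ^ n = c ^ n" and z: "z \<in> L" "z \<noteq> 0"
begin

lemma val_sigma: "val (proj_point a b c) (sigma z) = val (proj_point (\<zeta> * a) b c) z"
proof (rule val_comp[OF pt sigma(1) _ z])
  fix \<psi> A B C assume "branch n \<zeta> \<epsilon> y \<psi> A B C a b c"
  then interpret branch n \<zeta> \<epsilon> y \<psi> A B C a b c .
  have "branch n \<zeta> \<epsilon> y (\<lambda>z. \<psi> (sigma z)) (fps_const \<zeta> * A) B C (\<zeta> * a) b c"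
    by unfold_locales (use lhom_comp[OF lhom_psi sigma(1)] psi_const autD(2)[OF sigma(1)] C_nz at_0 point_nz psi_y psi_x in
        \<open>auto simp: sigma lhom_mult[OF lhom_psi] fls_times_fps_to_fls mult.assoc\<close>)
  thus "\<exists>A' B' C'. branch n \<zeta> \<epsilon> y (\<lambda>z. \<psi> (sigma z)) A' B' C' (\<zeta> * a) b c" by blast
qed

lemma val_tau: "val (proj_point a b c) (tau z) = val (proj_point a (\<zeta> * b) c) z"
proof (rule val_comp[OF pt tau(1) _ z])
  fix \<psi> A B C assume "branch n \<zeta> \<epsilon> y \<psi> A B C a b c"
  then interpret branch n \<zeta> \<epsilon> y \<psi> A B C a b c .
  have "branch n \<zeta> \<epsilon> y (\<lambda>z. \<psi> (tau z)) A (fps_const \<zeta> * B) C a (\<zeta> * b) c"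
    by unfold_locales (use lhom_comp[OF lhom_psi tau(1)] psi_const autD(2)[OF tau(1)] C_nz at_0 point_nz psi_y psi_x in
        \<open>auto simp: tau lhom_mult[OF lhom_psi] fls_times_fps_to_fls mult.assoc\<close>)
  thus "\<exists>A' B' C'. branch n \<zeta> \<epsilon> y (\<lambda>z. \<psi> (tau z)) A' B' C' a (\<zeta> * b) c" by blast
qed

lemma val_swp: "val (proj_point a b c) (swp z) = val (proj_point b a c) z"
proof (rule val_comp[OF pt swp(1) _ z])
  fix \<psi> A B C assume "branch n \<zeta> \<epsilon> y \<psi> A B C a b c"
  then interpret branch n \<zeta> \<epsilon> y \<psi> A B C a b c .
  have "branch n \<zeta> \<epsilon> y (\<lambda>z. \<psi> (swp z)) B A C b a c"
    by unfold_locales (use lhom_comp[OF lhom_psi swp(1)] psi_const autD(2)[OF swp(1)] C_nz at_0 point_nz psi_y psi_x in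
        \<open>auto simp: swp\<close>)
  thus "\<exists>A' B' C'. branch n \<zeta> \<epsilon> y (\<lambda>z. \<psi> (swp z)) A' B' C' b a c" by blast
qed

lemma val_kap: "val (proj_point a b c) (kap z) = val (proj_point c (b / \<epsilon>) a) z"
proof (rule val_comp[OF pt kap(1) _ z])
  fix \<psi> A B C assume "branch n \<zeta> \<epsilon> y \<psi> A B C a b c"
  then interpret branch n \<zeta> \<epsilon> y \<psi> A B C a b c .
  have x0: "\<psi> gen_x \<noteq> 0" by (simp add: lhom_eq_0_iff[OF lhom_psi])
  hence A0: "A \<noteq> 0" using psi_x C_nz by (metis fps_to_fls_eq_0_iff mult_eq_0_iff)
  have y: "\<psi> (y / (const \<epsilon> * gen_x)) * fps_to_fls A = fps_to_fls (fps_const (1 / \<epsilon>) * B)"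
  proof -
    have "\<psi> (y / (const \<epsilon> * gen_x)) = \<psi> y / (fls_const \<epsilon> * \<psi> gen_x)"
      by (simp add: lhom_divide[OF lhom_psi] lhom_mult[OF lhom_psi] psi_const)
    hence "\<psi> (y / (const \<epsilon> * gen_x)) * fps_to_fls A = inverse (fls_const \<epsilon>) * fps_to_fls B"
      using x0 by (simp add: psi_x[symmetric] psi_y[symmetric] field_class.field_divide_inverse)
    moreover have "inverse (fls_const \<epsilon>) = fls_const (1 / \<epsilon>)"
      by (rule inverse_unique) (simp add: fls_const_mult_const)
    ultimately show ?thesis by (simp add: fls_times_fps_to_fls)
  qed
  have "branch n \<zeta> \<epsilon> y (\<lambda>z. \<psi> (kap z)) C (fps_const (1 / \<epsilon>) * B) A c (b / \<epsilon>) a"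
    by unfold_locales (use lhom_comp[OF lhom_psi kap(1)] psi_const autD(2)[OF kap(1)] C_nz A0 at_0 point_nz psi_x[symmetric] x0 y in
        \<open>auto simp: kap lhom_divide[OF lhom_psi] lhom_1[OF lhom_psi]\<close>)
  thus "\<exists>A' B' C'. branch n \<zeta> \<epsilon> y (\<lambda>z. \<psi> (kap z)) A' B' C' c (b / \<epsilon>) a" by blast
qed

end

section \<open>Roots of unity and the action of the automorphisms on the cusps\<close>

lemma zeta_powi_eq_1_iff: "\<zeta> powi j = 1 \<longleftrightarrow> int n dvd j"
proof -
  define r where "r = nat (j mod int n)"
  have r: "int r = j mod int n" "r < n" using n_pos by (simp_all add: r_def nat_less_iff)
  have "j = int n * (j div int n) + int r" using r by simp
  hence "\<zeta> powi j = (\<zeta> powi int n) powi (j div int n) * \<zeta> powi int r"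
    by (metis power_int_add power_int_mult zeta_nz)
  also have "\<dots> = \<zeta> ^ r" using zeta_n by simp
  finally have "\<zeta> powi j = \<zeta> ^ r" .
  moreover have "\<zeta> ^ r = 1 \<longleftrightarrow> r = 0"
    using zeta r(2) by (cases "r = 0") (auto simp: is_primitive_root_def)
  moreover have "r = 0 \<longleftrightarrow> int n dvd j" using r(1) by (auto simp: dvd_eq_mod_eq_0)
  ultimately show ?thesis by simp
qed

lemma zeta_powi_eq_iff: "\<zeta> powi i = \<zeta> powi j \<longleftrightarrow> int n dvd i - j"
  using zeta_powi_eq_1_iff[of "i - j"] by (simp add: power_int_diff)

lemma zeta_powi_n [simp]: "(\<zeta> powi j) ^ n = 1"
  using zeta_powi_eq_1_iff[of "j * int n"] by (simp add: power_int_mult)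

lemma root_of_unity:
  assumes "w ^ n = 1"
  obtains j where "w = \<zeta> powi j"
proof -
  have inj: "inj_on (\<lambda>k. \<zeta> ^ k) {..<n}"
  proof
    fix i j assume *: "i \<in> {..<n}" "j \<in> {..<n}" "\<zeta> ^ i = \<zeta> ^ j"
    hence "int n dvd int i - int j" using zeta_powi_eq_iff[of "int i" "int j"] by simp
    thus "i = j" using *(1,2) dvd_imp_le_int[of "int i - int j" "int n"] by force
  qed
  have fin: "finite {w::complex. w ^ n = 1}" using n_pos by (intro finite_roots_unity) simp
  have "(\<lambda>k. \<zeta> ^ k) ` {..<n} = {w. w ^ n = 1}"
  proof (rule card_seteq[OF fin])
    show "(\<lambda>k. \<zeta> ^ k) ` {..<n} \<subseteq> {w. w ^ n = 1}"
      using zeta_powi_n[of "int k" for k] by auto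
    show "card {w::complex. w ^ n = 1} \<le> card ((\<lambda>k. \<zeta> ^ k) ` {..<n})"
      using card_roots_unity[of n] n_pos by (simp add: card_image[OF inj])
  qed
  then obtain k where "w = \<zeta> ^ k" using assms by blast
  thus ?thesis using that[of "int k"] by simp
qed

text \<open>If \<epsilon>^2 = \<zeta>^m, then the inverse of \<epsilon> \<zeta>^j is \<epsilon>
  \<zeta>^(-j-m). So this exponent appears whenever an exchange of coordinates reflects the index of
  the family c.\<close>

definition twist :: int where "twist = (SOME m. \<epsilon> ^ 2 = \<zeta> powi m)"

lemma twist: "\<epsilon> ^ 2 = \<zeta> powi twist"
proof -
  have "(\<epsilon> ^ 2) ^ n = 1" using eps_n by (simp add: mult.commute flip: power_mult) (simp add: power_mult)
  then obtain m where "\<epsilon> ^ 2 = \<zeta> powi m" by (rule root_of_unity)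
  thus ?thesis unfolding twist_def by (rule someI)
qed

text \<open>The cusps are indexed by all integers, periodically modulo n, so that automorphisms act
  by shifts and reflections of the index without wrap-around.\<close>

definition pa :: "int \<Rightarrow> point" where "pa j = proj_point 0 (\<zeta> powi j) 1"
definition pb :: "int \<Rightarrow> point" where "pb j = proj_point (\<zeta> powi j) 0 1"
definition pc :: "int \<Rightarrow> point" where "pc j = proj_point (\<epsilon> * \<zeta> powi j) 1 0"

lemma eps_zeta_n: "(\<epsilon> * \<zeta> powi j) ^ n = - 1"
  by (simp add: power_mult_distrib eps_n)

lemma cusps_on_curve [simp]: "pa j \<in> fermat_curve n" "pb j \<in> fermat_curve n" "pc j \<in> fermat_curve n"
  using n_pos by (simp_all add: pa_def pb_def pc_def eps_zeta_n power_0_left)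

abbreviation va :: "ambient \<Rightarrow> int \<Rightarrow> int" where "va z j \<equiv> val (pa j) z"
abbreviation vb :: "ambient \<Rightarrow> int \<Rightarrow> int" where "vb z j \<equiv> val (pb j) z"
abbreviation vc :: "ambient \<Rightarrow> int \<Rightarrow> int" where "vc z j \<equiv> val (pc j) z"

lemma pc_scale:
  assumes "a \<noteq> 0" "b \<noteq> 0" "a / b = \<epsilon> * \<zeta> powi j"
  shows "proj_point a b 0 = pc j"
  using proj_point_scale[of b "\<epsilon> * \<zeta> powi j" 1 0] assms by (simp add: pc_def field_simps)

lemma cusps_periodic: "pa (j + int n * k) = pa j" "pb (j + int n * k) = pb j" "pc (j + int n * k) = pc j"
proof -
  have "\<zeta> powi (j + int n * k) = \<zeta> powi j" by (simp add: zeta_powi_eq_iff)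
  thus "pa (j + int n * k) = pa j" "pb (j + int n * k) = pb j" "pc (j + int n * k) = pc j"
    by (simp_all add: pa_def pb_def pc_def)
qed

context
  fixes z assumes z: "z \<in> L" "z \<noteq> 0"
begin

lemma v_sigma: "va (sigma z) j = va z j" "vb (sigma z) j = vb z (j + 1)" "vc (sigma z) j = vc z (j + 1)"
  unfolding pa_def pb_def pc_def
  using n_pos by (simp_all add: val_sigma[OF _ _ z] power_0_left eps_zeta_n power_int_add ac_simps)

lemma v_tau: "va (tau z) j = va z (j + 1)" "vb (tau z) j = vb z j" "vc (tau z) j = vc z (j - 1)"
proof -
  show "va (tau z) j = va z (j + 1)" "vb (tau z) j = vb z j"
    unfolding pa_def pb_def
    using n_pos by (simp_all add: val_tau[OF _ _ z] power_0_left power_int_add ac_simps)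
  have "val (proj_point (\<epsilon> * \<zeta> powi j) 1 0) (tau z) = val (proj_point (\<epsilon> * \<zeta> powi j) (\<zeta> * 1) 0) z"
    by (rule val_tau[OF _ _ z]) (use n_pos in \<open>simp_all add: eps_zeta_n\<close>)
  also have "proj_point (\<epsilon> * \<zeta> powi j) (\<zeta> * 1) 0 = pc (j - 1)"
    by (rule pc_scale) (simp_all add: power_int_diff)
  finally show "vc (tau z) j = vc z (j - 1)" by (simp add: pc_def)
qed

lemma v_swp: "va (swp z) j = vb z j" "vb (swp z) j = va z j" "vc (swp z) j = vc z (- j - twist)"
proof -
  show "va (swp z) j = vb z j" "vb (swp z) j = va z j"
    unfolding pa_def pb_def using n_pos by (simp_all add: val_swp[OF _ _ z] power_0_left)
  have "val (proj_point (\<epsilon> * \<zeta> powi j) 1 0) (swp z) = val (proj_point 1 (\<epsilon> * \<zeta> powi j) 0) z"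
    by (rule val_swp[OF _ _ z]) (use n_pos in \<open>simp_all add: eps_zeta_n\<close>)
  also have "proj_point 1 (\<epsilon> * \<zeta> powi j) 0 = pc (- j - twist)"
    by (rule pc_scale) (simp_all add: power_int_diff power_int_minus twist[symmetric] field_simps power2_eq_square)
  finally show "vc (swp z) j = vc z (- j - twist)" by (simp add: pc_def)
qed

lemma v_kap: "va (kap z) j = vc z (- j)" "vb (kap z) j = vb z (- j)" "vc (kap z) j = va z (- j - twist)"
proof -
  have "val (proj_point 0 (\<zeta> powi j) 1) (kap z) = val (proj_point 1 (\<zeta> powi j / \<epsilon>) 0) z"
    by (rule val_kap[OF _ _ z]) (use n_pos in \<open>simp_all add: power_0_left\<close>)
  also have "proj_point 1 (\<zeta> powi j / \<epsilon>) 0 = pc (- j)"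
    by (rule pc_scale) (simp_all add: power_int_minus field_simps)
  finally show "va (kap z) j = vc z (- j)" by (simp add: pa_def)
  have "val (proj_point (\<zeta> powi j) 0 1) (kap z) = val (proj_point 1 (0 / \<epsilon>) (\<zeta> powi j)) z"
    by (rule val_kap[OF _ _ z]) (use n_pos in \<open>simp_all add: power_0_left\<close>)
  also have "proj_point 1 (0 / \<epsilon>) (\<zeta> powi j) = pb (- j)"
    using proj_point_scale[of "\<zeta> powi j" "\<zeta> powi (- j)" 0 1] by (simp add: pb_def power_int_minus)
  finally show "vb (kap z) j = vb z (- j)" by (simp add: pb_def)
  have "val (proj_point (\<epsilon> * \<zeta> powi j) 1 0) (kap z) = val (proj_point 0 (1 / \<epsilon>) (\<epsilon> * \<zeta> powi j)) z"
    by (rule val_kap[OF _ _ z]) (use n_pos in \<open>simp_all add: eps_zeta_n\<close>)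
  also have "proj_point 0 (1 / \<epsilon>) (\<epsilon> * \<zeta> powi j) = pa (- j - twist)"
    using proj_point_scale[of "\<epsilon> * \<zeta> powi j" 0 "\<zeta> powi (- j - twist)" 1]
    by (simp add: pa_def power_int_minus power_int_diff twist[symmetric] field_simps power2_eq_square)
  finally show "vc (kap z) j = va z (- j - twist)" by (simp add: pc_def)
qed

end

section \<open>Functions of y alone\<close>

definition py :: "complex poly \<Rightarrow> ambient" where "py p = poly (map_poly const p) y"

sublocale py: comm_ring_hom py
  unfolding py_def by (rule comm_ring_hom_eval[OF comm_ring_hom_const])

lemma py_simps: "py [:c:] = const c" "py [:0, 1:] = y" "py [:- c, 1:] = y - const c"
  by (simp_all add: py_def Polynomial.map_poly_pCons const.hom_uminus)

lemma py_L [simp]: "py p \<in> L"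
  unfolding py_def by (induction p) (simp_all add: Polynomial.map_poly_pCons)

lemma py_eq_0_iff [simp]: "py p = 0 \<longleftrightarrow> p = 0"
  using poly_hom_neq_0[OF comm_ring_hom_const gen_y_not_const] by (auto simp: py_def)

lemma order_linear: "order b [:- x, 1:] = (if x = b then 1 else 0)" for b :: complex
  using order_power_n_n[of b 1] by (auto intro: order_0I)

text \<open>The polynomial splits into linear factors, and y - c vanishes at (a : b : 1) only for c
  = b. The order of y - b is kept as a factor because y may be ramified there.\<close>

lemma val_py_affine:
  assumes "a ^ n + b ^ n = 1" "p \<noteq> 0"
  shows "val (proj_point a b 1) (py p) = int (order b p) * val (proj_point a b 1) (y - const b)"
  using assms(2)
proof (induction p rule: complex_poly_induct)
  case (const c)
  have "order b [:c:] = 0" using const by (intro order_0I) simp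
  thus ?case using const val_const[of "proj_point a b 1" c] assms(1) by (simp add: py_simps)
next
  case (linear x p)
  have Q: "proj_point a b 1 \<in> fermat_curve n" using assms(1) by simp
  have "val (proj_point a b 1) (py ([:- x, 1:] * p)) = val (proj_point a b 1) (y - const x) + val (proj_point a b 1) (py p)"
    unfolding py.hom_mult py_simps using linear by (intro val_mult[OF Q]) simp_all
  moreover have "val (proj_point a b 1) (y - const x) = 0" if "x \<noteq> b"
    using val_minus_const_0(1)[OF Q, of y b x] val_affine(4)[OF assms(1)] that by simp
  moreover have "order b ([:- x, 1:] * p) = order b [:- x, 1:] + order b p"
    by (rule order_mult) (use linear in \<open>simp del: mult_pCons_left\<close>)
  ultimately show ?case using linear by (auto simp: order_linear distrib_right simp del: mult_pCons_left)
qed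

lemma val_py_infinity:
  assumes "a ^ n = - 1" "p \<noteq> 0"
  shows "val (proj_point a 1 0) (py p) = - int (degree p)"
  using assms(2)
proof (induction p rule: complex_poly_induct)
  case (const c)
  thus ?case using val_const[of "proj_point a 1 0" c] assms(1) by (simp add: py_simps)
next
  case (linear x p)
  have Q: "proj_point a 1 0 \<in> fermat_curve n" using assms(1) by simp
  have "val (proj_point a 1 0) (py ([:- x, 1:] * p)) = val (proj_point a 1 0) (y - const x) + val (proj_point a 1 0) (py p)"
    unfolding py.hom_mult py_simps using linear by (intro val_mult[OF Q]) simp_all
  moreover have "val (proj_point a 1 0) (y - const x) = - 1"
    using val_minus_const_neg(1)[OF Q, of y x] val_infinity(1)[OF assms(1)] by simp
  moreover have "degree ([:- x, 1:] * p) = Suc (degree p)"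
    using linear by (subst degree_mult_eq) auto
  ultimately show ?case using linear by simp
qed

section \<open>Norms along cyclic orbits\<close>

lemma lhom_ident: "lhom (\<lambda>z. z)"
  by (simp add: lhom_def)

lemma aut_ident: "aut (\<lambda>z. z)"
  by (simp add: aut_def lhom_ident)

lemma aut_comp: "aut \<alpha> \<Longrightarrow> aut \<beta> \<Longrightarrow> aut (\<lambda>z. \<alpha> (\<beta> z))"
  using lhom_comp[of \<alpha> \<beta>] unfolding aut_def by (simp add: image_image[symmetric])

lemma aut_funpow: "aut \<alpha> \<Longrightarrow> aut (\<alpha> ^^ i)"
proof (induction i)
  case 0
  show ?case using aut_ident by (simp add: id_def)
next
  case (Suc i)
  thus ?case using aut_comp[of \<alpha> "\<alpha> ^^ i"] by (simp add: o_def)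
qed

lemma sigma_funpow: "(sigma ^^ k) gen_x = const \<zeta> ^ k * gen_x" "(sigma ^^ k) y = y"
  by (induction k) (simp_all add: sigma lhom_simps[OF autD(1)[OF sigma(1)]] autD(2)[OF sigma(1)])

lemma tau_funpow: "(tau ^^ k) gen_x = gen_x" "(tau ^^ k) y = const \<zeta> ^ k * y"
  by (induction k) (simp_all add: tau lhom_simps[OF autD(1)[OF tau(1)]] autD(2)[OF tau(1)])

lemma sigma_n: "z \<in> L \<Longrightarrow> (sigma ^^ n) z = z"
  by (rule lhom_unique[OF autD(1)[OF aut_funpow[OF sigma(1)]] lhom_ident])
    (simp_all add: autD(2)[OF aut_funpow[OF sigma(1)]] sigma_funpow const_zeta_n)

lemma tau_n: "z \<in> L \<Longrightarrow> (tau ^^ n) z = z"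
  by (rule lhom_unique[OF autD(1)[OF aut_funpow[OF tau(1)]] lhom_ident])
    (simp_all add: autD(2)[OF aut_funpow[OF tau(1)]] tau_funpow const_zeta_n)

lemma sigma_tau: "z \<in> L \<Longrightarrow> sigma (tau z) = tau (sigma z)"
  by (rule lhom_unique[OF autD(1)[OF aut_comp[OF sigma(1) tau(1)]] autD(1)[OF aut_comp[OF tau(1) sigma(1)]]])
    (simp_all add: sigma tau autD(2)[OF sigma(1)] autD(2)[OF tau(1)]
      lhom_simps[OF autD(1)[OF sigma(1)]] lhom_simps[OF autD(1)[OF tau(1)]])

text \<open>The norm to the fixed field of \<alpha>, when the n-th iterate of \<alpha> is the
  identity on L.\<close>

definition orbit_prod :: "(ambient \<Rightarrow> ambient) \<Rightarrow> ambient \<Rightarrow> ambient" where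
  "orbit_prod \<alpha> z = (\<Prod>k<n. (\<alpha> ^^ k) z)"

lemma orbit_prod_invariant:
  assumes "aut \<alpha>" "\<And>z. z \<in> L \<Longrightarrow> (\<alpha> ^^ n) z = z" "z \<in> L"
  shows "\<alpha> (orbit_prod \<alpha> z) = orbit_prod \<alpha> z"
proof -
  have "\<alpha> (orbit_prod \<alpha> z) = (\<Prod>k<n. (\<alpha> ^^ Suc k) z)"
    using assms autD(3)[OF aut_funpow[OF assms(1)]]
    by (simp add: orbit_prod_def lhom_prod[OF autD(1)])
  also have "\<dots> = (\<Prod>k<n. (\<alpha> ^^ k) z)"
  proof -
    obtain m where m: "n = Suc m" using n_pos by (cases n) auto
    have "(\<Prod>k<n. (\<alpha> ^^ Suc k) z) = (\<Prod>k<m. (\<alpha> ^^ Suc k) z) * (\<alpha> ^^ n) z" by (simp add: m)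
    moreover have "(\<Prod>k<n. (\<alpha> ^^ k) z) = z * (\<Prod>k<m. (\<alpha> ^^ Suc k) z)"
      unfolding m prod.lessThan_Suc_shift by simp
    ultimately show ?thesis using assms by (simp add: mult.commute)
  qed
  finally show ?thesis by (simp add: orbit_prod_def)
qed

lemma orbit_prod_L [simp]: "aut \<alpha> \<Longrightarrow> z \<in> L \<Longrightarrow> orbit_prod \<alpha> z \<in> L"
  using autD(3)[OF aut_funpow] by (auto simp: orbit_prod_def)

lemma orbit_prod_nz [simp]: "aut \<alpha> \<Longrightarrow> z \<in> L \<Longrightarrow> orbit_prod \<alpha> z = 0 \<longleftrightarrow> z = 0"
  using n_pos by (auto simp: orbit_prod_def aut_funpow)

lemma orbit_prod_val:
  assumes "aut \<alpha>" "z \<in> L" "z \<noteq> 0" "Q \<in> fermat_curve n"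
  shows "val Q (orbit_prod \<alpha> z) = (\<Sum>k<n. val Q ((\<alpha> ^^ k) z))"
  unfolding orbit_prod_def
  by (rule val_prod) (use assms aut_funpow autD(3) in \<open>auto\<close>)

subsection \<open>Functions without poles\<close>

lemma range_E_closed:
  "const c \<in> range E" "gen_x \<in> range E" "y \<in> range E"
  "u \<in> range E \<Longrightarrow> w \<in> range E \<Longrightarrow> u + w \<in> range E"
  "u \<in> range E \<Longrightarrow> w \<in> range E \<Longrightarrow> u * w \<in> range E"
proof -
  show "const c \<in> range E" "gen_x \<in> range E" "y \<in> range E"
    using ev_simps[OF comm_ring_hom_const, of gen_x y] by (metis rangeI)+
  show "u \<in> range E \<Longrightarrow> w \<in> range E \<Longrightarrow> u + w \<in> range E"
    by (auto simp flip: E.hom_add)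
  show "u \<in> range E \<Longrightarrow> w \<in> range E \<Longrightarrow> u * w \<in> range E"
    by (auto simp flip: E.hom_mult)
qed

lemma E_pCons: "E (pCons p q) = poly (map_poly const p) gen_x + y * E q"
proof -
  have "pCons p q = [:p:] + [:0, 1:] * q" by simp
  thus ?thesis by (simp only: E.hom_add E.hom_mult ev_poly[OF comm_ring_hom_const] ev_simps[OF comm_ring_hom_const])
qed

lemma range_E_L: "w \<in> range E \<Longrightarrow> w \<in> L"
proof -
  have "E p \<in> L" for p
  proof (induction p)
    case (pCons c p)
    have "poly (map_poly const c) gen_x \<in> L" by (induction c) (simp_all add: Polynomial.map_poly_pCons)
    thus ?case using pCons by (simp add: E_pCons)
  qed simp
  thus "w \<in> range E \<Longrightarrow> w \<in> L" by blast
qed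

lemma range_E_sigma: "w \<in> range E \<Longrightarrow> sigma w \<in> range E"
proof -
  note ls = lhom_simps[OF autD(1)[OF sigma(1)]]
  have "sigma (E p) \<in> range E" for p
  proof (induction p)
    case (pCons c p)
    have L1: "poly (map_poly const c) gen_x \<in> L" for c
      by (induction c) (simp_all add: Polynomial.map_poly_pCons)
    have "sigma (poly (map_poly const c) gen_x) \<in> range E"
    proof (induction c)
      case 0
      show ?case using range_E_closed(1)[of 0] by (simp add: ls)
    next
      case (pCons a c)
      have "sigma (poly (map_poly const (pCons a c)) gen_x)
          = const a + const \<zeta> * gen_x * sigma (poly (map_poly const c) gen_x)"
        using L1[of c] by (simp add: Polynomial.map_poly_pCons ls sigma autD(2)[OF sigma(1)])
      also have "\<dots> \<in> range E" by (intro range_E_closed pCons)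
      finally show ?case .
    qed
    moreover have "sigma (E (pCons c p)) = sigma (poly (map_poly const c) gen_x) + y * sigma (E p)"
      using L1[of c] range_E_L[of "E p"] by (simp add: E_pCons ls sigma)
    ultimately show ?case using pCons by (simp only: range_E_closed)
  next
    case 0
    show ?case using range_E_closed(1)[of 0] by (simp add: ls)
  qed
  thus "w \<in> range E \<Longrightarrow> sigma w \<in> range E" by blast
qed

lemma sum_zeta_powers: "(\<Sum>k<n. const \<zeta> ^ (k * i)) = (if n dvd i then of_nat n else 0)"
proof (cases "n dvd i")
  case True
  then obtain l where "i = n * l" by blast
  hence "const \<zeta> ^ (k * i) = 1" for k by (simp add: mult.left_commute[of k] power_mult const_zeta_n)
  thus ?thesis using True by simp
next
  case False
  have "\<zeta> powi int i \<noteq> 1" using False by (simp add: zeta_powi_eq_1_iff del: power_int_of_nat)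
  hence ne: "const \<zeta> ^ i \<noteq> 1" by (metis const.hom_power const.hom_one const_eq_iff power_int_of_nat)
  have "(\<Sum>k<n. const \<zeta> ^ (k * i)) = (\<Sum>k<n. (const \<zeta> ^ i) ^ k)"
    by (simp add: power_mult[symmetric] mult.commute)
  also have "\<dots> = ((const \<zeta> ^ i) ^ n - 1) / (const \<zeta> ^ i - 1)" by (rule geometric_sum[OF ne])
  also have "(const \<zeta> ^ i) ^ n = 1" by (metis const_zeta_n power_commutes power_mult power_one mult.commute)
  finally show ?thesis using False by simp
qed

text \<open>The trace of x^i under \<open>sigma\<close> vanishes unless n divides i, and in that
  case x^i is a power of 1 - y^n. Powers of y are fixed by \<open>sigma\<close> and factor
  out.\<close>

lemma py_trace:
  assumes "w \<in> range E"
  shows "(\<Sum>k<n. (sigma ^^ k) w) \<in> range py"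
proof -
  have py_closed: "const c \<in> range py" "y \<in> range py"
    "u \<in> range py \<Longrightarrow> w \<in> range py \<Longrightarrow> u + w \<in> range py"
    "u \<in> range py \<Longrightarrow> w \<in> range py \<Longrightarrow> u * w \<in> range py" for c u w
    using py_simps(1,2) by (auto simp flip: py.hom_add py.hom_mult intro: rangeI) (metis rangeI)+
  have py_pow: "u \<in> range py \<Longrightarrow> u ^ i \<in> range py" for u i
    by (induction i) (use py_closed(1)[of 1] py_closed(4) in simp_all)
  have py_sum: "(\<And>i. i \<in> J \<Longrightarrow> f i \<in> range py) \<Longrightarrow> sum f J \<in> range py" for f and J :: "nat set"
    by (induction J rule: infinite_finite_induct) (use py_closed(1)[of 0] py_closed(3) in simp_all)
  note ls = lhom_simps[OF autD(1)[OF aut_funpow[OF sigma(1)]]]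
  have tx: "(\<Sum>k<n. (sigma ^^ k) (gen_x ^ i)) \<in> range py" for i
  proof -
    have "(\<Sum>k<n. (sigma ^^ k) (gen_x ^ i)) = (\<Sum>k<n. const \<zeta> ^ (k * i)) * gen_x ^ i"
      by (simp add: ls sigma_funpow power_mult_distrib power_mult sum_distrib_right)
    also have "\<dots> \<in> range py"
    proof (cases "n dvd i")
      case True
      then obtain l where "i = n * l" by blast
      moreover have "gen_x ^ n = 1 - y ^ n" using curve by (simp add: eq_diff_eq)
      ultimately have "gen_x ^ i = (1 - y ^ n) ^ l" by (simp add: power_mult)
      also have "1 - y ^ n = const 1 + const (-1) * y ^ n" by (simp add: const.hom_uminus)
      also have "\<dots> ^ l \<in> range py" by (intro py_pow py_closed)
      finally have "const (of_nat n) * gen_x ^ i \<in> range py" by (intro py_closed)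
      thus ?thesis using True by (simp add: sum_zeta_powers const.hom_of_nat)
    next
      case False
      thus ?thesis using py_closed(1)[of 0] by (simp add: sum_zeta_powers)
    qed
    finally show ?thesis .
  qed
  have L1: "poly (map_poly const c) gen_x \<in> L" for c
    by (induction c) (simp_all add: Polynomial.map_poly_pCons)
  have tc: "(\<Sum>k<n. (sigma ^^ k) (poly (map_poly const c) gen_x)) \<in> range py" for c
  proof -
    have eq: "poly (map_poly const c) gen_x = (\<Sum>i\<le>degree c. const (coeff c i) * gen_x ^ i)"
      by (simp add: poly_altdef Polynomial.degree_map_poly coeff_map_poly)
    have "(\<Sum>k<n. (sigma ^^ k) (poly (map_poly const c) gen_x))
        = (\<Sum>k<n. \<Sum>i\<le>degree c. const (coeff c i) * (sigma ^^ k) (gen_x ^ i))"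
      unfolding eq by (simp add: ls autD(2)[OF aut_funpow[OF sigma(1)]] del: lhom_power)
    also have "\<dots> = (\<Sum>i\<le>degree c. const (coeff c i) * (\<Sum>k<n. (sigma ^^ k) (gen_x ^ i)))"
      by (subst sum.swap) (simp add: sum_distrib_left)
    also have "\<dots> \<in> range py" by (intro py_sum py_closed tx)
    finally show ?thesis .
  qed
  have "(\<Sum>k<n. (sigma ^^ k) (E p)) \<in> range py" for p
  proof (induction p)
    case (pCons c p)
    have "(\<Sum>k<n. (sigma ^^ k) (E (pCons c p)))
        = (\<Sum>k<n. (sigma ^^ k) (poly (map_poly const c) gen_x)) + y * (\<Sum>k<n. (sigma ^^ k) (E p))"
      using L1[of c] range_E_L[of "E p"] by (simp add: E_pCons ls sigma_funpow sum.distrib sum_distrib_left)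
    thus ?case using tc pCons by (simp only: py_closed)
  next
    case 0
    show ?case using py_closed(1)[of 0] by (simp add: ls)
  qed
  thus ?thesis using assms by blast
qed

lemma sigma_funpow_fixed: "sigma z = z \<Longrightarrow> (sigma ^^ k) z = z"
  by (induction k) simp_all

text \<open>The trace of a fixed element is n times the element.\<close>

lemma py_of_fixed:
  assumes "w \<in> range E" "sigma w = w"
  shows "w \<in> range py"
proof -
  have "of_nat n * w \<in> range py"
    using py_trace[OF assms(1)] sigma_funpow_fixed[OF assms(2)] by simp
  then obtain p where "of_nat n * w = py p" by blast
  hence "w = py (smult (1 / of_nat n) p)"
  proof -
    assume *: "of_nat n * w = py p"
    have "py (smult (1 / of_nat n) p) = py ([:1 / of_nat n:] * p)" by simp
    also have "\<dots> = const (1 / of_nat n) * (const (of_nat n) * w)"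
      by (simp only: py.hom_mult py_simps *[symmetric] const.hom_of_nat)
    also have "\<dots> = w" using n_pos by (simp add: mult.assoc[symmetric] const.hom_mult[symmetric])
    finally show ?thesis ..
  qed
  thus ?thesis by blast
qed

text \<open>Extending a fraction by the other conjugates of its denominator turns the denominator
  into a norm, which is fixed. Then the numerator is fixed as well, and both are polynomials in y by
  \<open>py_of_fixed\<close>.\<close>

lemma sigma_fixed_field:
  assumes "z \<in> L" "sigma z = z"
  obtains p q where "q \<noteq> 0" "z = py p / py q" "coprime p q"
proof -
  obtain p q where pq: "E q \<noteq> 0" "z = E p / E q" using L_E[OF assms(1)] by blast
  have qL: "E q \<in> L" by (rule range_E_L) blast
  define r where "r = (\<Prod>k<n - 1. (sigma ^^ Suc k) (E q))"
  have r: "r \<in> range E"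
  proof -
    have *: "(sigma ^^ k) (E q) \<in> range E" for k
      by (induction k) (simp_all add: range_E_sigma)
    have "(\<Prod>k<m. (sigma ^^ Suc k) (E q)) \<in> range E" for m
    proof (induction m)
      case 0
      show ?case using range_E_closed(1)[of 1] by simp
    next
      case (Suc m)
      show ?case unfolding prod.lessThan_Suc by (intro range_E_closed(5) Suc.IH *)
    qed
    thus ?thesis by (simp add: r_def)
  qed
  have N: "orbit_prod sigma (E q) = E q * r"
    using prod.lessThan_Suc_shift[of "\<lambda>k. (sigma ^^ k) (E q)" "n - 1"] n_pos
    by (simp add: orbit_prod_def r_def)
  define D where "D = E q * r"
  have D: "sigma D = D" "D \<noteq> 0" "D \<in> L"
    unfolding D_def N[symmetric]
    using orbit_prod_invariant[OF sigma(1) sigma_n qL] qL pq sigma(1) by simp_all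
  have zD: "z * D = E p * r" using pq by (simp add: D_def)
  have "D \<in> range py" using D r by (intro py_of_fixed) (auto simp: D_def intro: range_E_closed)
  then obtain d where d: "D = py d" by blast
  have "sigma (z * D) = z * D" using assms D by (simp add: lhom_mult[OF autD(1)[OF sigma(1)]])
  hence "z * D \<in> range py" unfolding zD using r by (intro py_of_fixed) (auto intro: range_E_closed)
  then obtain e where e: "z * D = py e" by blast
  have d0: "d \<noteq> 0" using D d by auto
  obtain e' d' where *: "e = e' * gcd e d" "d = d' * gcd e d" "coprime e' d'"
    using d0 gcd_coprime_exists[of e d] by auto
  have "py (gcd e d) \<noteq> 0" "py d' \<noteq> 0" using d0 *(2) by auto
  have "z = py e / py d" using e d D by (simp add: field_simps)
  also have "py e = py e' * py (gcd e d)" using arg_cong[OF *(1), of py] by (simp only: py.hom_mult)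
  also have "py d = py d' * py (gcd e d)" using arg_cong[OF *(2), of py] by (simp only: py.hom_mult)
  also have "py e' * py (gcd e d) / (py d' * py (gcd e d)) = py e' / py d'"
    using \<open>py (gcd e d) \<noteq> 0\<close> by simp
  finally show ?thesis using that * d0 by (metis mult_zero_left)
qed

lemma sigma_funpow_val:
  assumes "(a, b, c) \<noteq> (0, 0, 0)" "a ^ n + b ^ n = c ^ n" "z \<in> L" "z \<noteq> 0"
  shows "val (proj_point a b c) ((sigma ^^ k) z) = val (proj_point (\<zeta> ^ k * a) b c) z"
  using assms(3,4)
proof (induction k arbitrary: z)
  case (Suc k)
  have "val (proj_point a b c) ((sigma ^^ Suc k) z) = val (proj_point a b c) ((sigma ^^ k) (sigma z))"
    by (simp add: funpow_swap1)
  also have "\<dots> = val (proj_point (\<zeta> ^ k * a) b c) (sigma z)"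
    using Suc autD(3)[OF sigma(1)] sigma(1) by simp
  also have "\<dots> = val (proj_point (\<zeta> * (\<zeta> ^ k * a)) b c) z"
    using Suc assms(1,2) zeta_n
    by (intro val_sigma) (auto simp: power_mult_distrib power_mult[symmetric] mult.commute[of k] power_mult)
  finally show ?case by (simp add: mult.assoc)
qed simp

text \<open>
  A nonzero function without poles has a norm to \<open>\<complex>(y)\<close> without poles, hence a constant norm;
  so it cannot vanish anywhere.
\<close>
lemma no_poles_imp_no_zeros:
  assumes z: "z \<in> L" "z \<noteq> 0" and nn: "\<And>Q. Q \<in> fermat_curve n \<Longrightarrow> val Q z \<ge> 0"
    and Q: "Q \<in> fermat_curve n"
  shows "val Q z = 0"
proof -
  define N where "N = orbit_prod sigma z"
  have N: "N \<in> L" "N \<noteq> 0" "sigma N = N"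
    using z sigma(1) orbit_prod_invariant[OF sigma(1) sigma_n z(1)] by (simp_all add: N_def)
  have onc: "proj_point (\<zeta> ^ k * a) b c \<in> fermat_curve n"
    if "(a, b, c) \<noteq> (0, 0, 0)" "a ^ n + b ^ n = c ^ n" for a b c k
    unfolding fermat_curve_iff using that zeta_n
    by (intro exI[of _ "\<zeta> ^ k * a"] exI[of _ b] exI[of _ c])
      (auto simp: power_mult_distrib power_mult[symmetric] mult.commute[of k] power_mult)
  have terms: "val Q ((sigma ^^ k) z) \<ge> 0" if "Q \<in> fermat_curve n" for Q k
    using that sigma_funpow_val[OF _ _ z] nn onc unfolding fermat_curve_iff by metis
  have valN: "val Q N = (\<Sum>k<n. val Q ((sigma ^^ k) z))" if "Q \<in> fermat_curve n" for Q
    unfolding N_def by (rule orbit_prod_val[OF sigma(1) z that])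
  hence N_nn: "val Q N \<ge> 0" if "Q \<in> fermat_curve n" for Q
    using terms that by (simp add: sum_nonneg)
  obtain p q where pq: "q \<noteq> 0" "N = py p / py q" "coprime p q"
    using sigma_fixed_field[OF N(1,3)] by blast
  have p0: "p \<noteq> 0" using N pq by auto
  \<comment> \<open>A root b of q lies under a point (a : b : 1) of the curve, where N would have a
    pole because p and q are coprime.\<close>
  have "degree q = 0"
  proof (rule ccontr)
    assume "degree q \<noteq> 0"
    then obtain b where b: "poly q b = 0" using alg_closed_imp_poly_has_root[of q] by auto
    hence pb: "poly p b \<noteq> 0"
      using pq(3) coprime_poly_0 by blast
    obtain a where a: "a ^ n = 1 - b ^ n" using nth_root_exists[of n "1 - b ^ n"] n_pos by blast
    have ab: "a ^ n + b ^ n = 1" using a by simp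
    let ?Q = "proj_point a b 1"
    have Q: "?Q \<in> fermat_curve n" using ab by simp
    have "val ?Q N = int (order b p) * val ?Q (y - const b) - int (order b q) * val ?Q (y - const b)"
      using pq p0 val_divide[OF Q, of "py p" "py q"] val_py_affine[OF ab] by simp
    moreover have "order b p = 0" using pb by (rule order_0I)
    moreover have "order b q > 0" using b pq(1) by (simp add: order_gt_0_iff)
    moreover have "val ?Q (y - const b) > 0" by (rule val_affine(4)[OF ab])
    ultimately have "val ?Q N < 0" by simp
    thus False using N_nn[OF Q] by simp
  qed
  \<comment> \<open>At infinity N has order degree q - degree p.\<close>
  moreover have "degree p = 0"
  proof -
    have Q: "proj_point \<epsilon> 1 0 \<in> fermat_curve n" by (simp add: eps_n)
    have "val (proj_point \<epsilon> 1 0) N = - int (degree p) + int (degree q)"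
      using pq p0 val_divide[OF Q, of "py p" "py q"] val_py_infinity[OF eps_n] by simp
    thus ?thesis using N_nn[OF Q] \<open>degree q = 0\<close> by simp
  qed
  ultimately obtain c d where "p = [:c:]" "q = [:d:]" by (metis degree_eq_zeroE)
  hence "N = const (c / d)" "c / d \<noteq> 0" using pq p0 by (auto simp: py_simps const_divide)
  hence "val Q N = 0" using val_const[OF Q] by simp
  hence "(\<Sum>k<n. val Q ((sigma ^^ k) z)) = 0" using valN[OF Q] by simp
  hence "\<forall>k\<in>{..<n}. val Q ((sigma ^^ k) z) = 0"
    using terms[OF Q] by (subst (asm) sum_nonneg_eq_0_iff) auto
  from bspec[OF this, of 0] show ?thesis using n_pos by simp
qed

text \<open>Subtract the residue c at one point: a nonzero z - c would have a zero there and no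
  poles, against \<open>no_poles_imp_no_zeros\<close>.\<close>

lemma const_if_val_0:
  assumes z: "z \<in> L" "z \<noteq> 0" and v0: "\<And>Q. Q \<in> fermat_curve n \<Longrightarrow> val Q z = 0"
  obtains c where "c \<noteq> 0" "z = const c"
proof -
  have Q: "pa 0 \<in> fermat_curve n" by simp
  obtain c where c: "z = const c \<or> val (pa 0) (z - const c) > 0"
    using val_residue[OF Q z] v0[OF Q] by auto
  have "z = const c"
  proof (rule ccontr)
    assume ne: "z \<noteq> const c"
    have c0: "c \<noteq> 0"
    proof
      assume "c = 0"
      thus False using c ne v0[OF Q] by simp
    qed
    have "val Q (z - const c) \<ge> 0" if "Q \<in> fermat_curve n" for Q
    proof -
      have "val Q (z + const (- c)) \<ge> min (val Q z) (val Q (const (- c)))"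
        by (rule val_add_ge[OF that]) (use z c0 ne in \<open>simp_all add: const.hom_uminus\<close>)
      thus ?thesis using v0[OF that] val_const[OF that, of "- c"] c0 by (simp add: const.hom_uminus)
    qed
    hence "val (pa 0) (z - const c) = 0"
      using no_poles_imp_no_zeros[of "z - const c", OF _ _ _ Q] z ne by simp
    thus False using c ne by simp
  qed
  thus ?thesis using that[of c] z by auto
qed

subsection \<open>Units supported at the cusps\<close>

text \<open>The group of units, described by the points outside the cusps, which are the affine
  points with two nonzero coordinates. Agreement with \<open>special_units\<close> is shown at the
  end.\<close>

definition U :: "ambient set" where
  "U = {z \<in> L. z \<noteq> 0 \<and>
    (\<forall>a b. a \<noteq> 0 \<longrightarrow> b \<noteq> 0 \<longrightarrow> a ^ n + b ^ n = 1 \<longrightarrow> val (proj_point a b 1) z = 0)}"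

lemma U_iff: "z \<in> U \<longleftrightarrow> z \<in> L \<and> z \<noteq> 0 \<and>
    (\<forall>a b. a \<noteq> 0 \<longrightarrow> b \<noteq> 0 \<longrightarrow> a ^ n + b ^ n = 1 \<longrightarrow> val (proj_point a b 1) z = 0)"
  by (simp add: U_def)

lemma U_L [simp]: "z \<in> U \<Longrightarrow> z \<in> L" and U_nz: "z \<in> U \<Longrightarrow> z \<noteq> 0"
  by (simp_all add: U_iff)

lemma U_mult [simp]: "u \<in> U \<Longrightarrow> w \<in> U \<Longrightarrow> u * w \<in> U"
  unfolding U_iff by (simp add: val_mult)

lemma U_inverse [simp]: "u \<in> U \<Longrightarrow> inverse u \<in> U"
  unfolding U_iff by (simp add: val_inverse)

lemma U_divide [simp]: "u \<in> U \<Longrightarrow> w \<in> U \<Longrightarrow> u / w \<in> U"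
  by (simp add: field_class.field_divide_inverse)

lemma U_const [simp]: "c \<noteq> 0 \<Longrightarrow> const c \<in> U"
  unfolding U_iff by (simp add: val_const)

lemma U_1 [simp]: "1 \<in> U"
  using U_const[of 1] by simp

lemma U_power_int [simp]: "u \<in> U \<Longrightarrow> u powi i \<in> U"
  unfolding U_iff by (simp add: val_power_int)

lemma U_gen_x [simp]: "gen_x \<in> U" and U_gen_y [simp]: "y \<in> U"
  unfolding U_iff
  using val_minus_const_0(1)[of "proj_point a b 1" gen_x a 0 for a b]
    val_minus_const_0(1)[of "proj_point a b 1" y b 0 for a b] val_affine(3,4) by auto

lemma cusp_facts:
  "0 ^ n + (\<zeta> powi j) ^ n = 1" "(\<zeta> powi j) ^ n + 0 ^ n = 1"
  using n_pos by simp_all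

lemma v_gen_x: "va gen_x j = 1" "vb gen_x j = 0" "vc gen_x j = -1"
  and v_gen_y: "va y j = 0" "vb y j = 1" "vc y j = -1"
proof -
  show "va gen_x j = 1" using val_affine(1)[OF cusp_facts(1)] by (simp add: pa_def)
  show "vb y j = 1" using val_affine(2)[OF cusp_facts(2)] by (simp add: pb_def)
  show "vc gen_x j = -1" "vc y j = -1" using val_infinity eps_zeta_n by (simp_all add: pc_def)
  have "val (pb j) (gen_x - const (\<zeta> powi j)) > 0" using val_affine(3)[OF cusp_facts(2)] by (simp add: pb_def)
  from val_minus_const_0(1)[of "pb j", OF _ _ disjI2[OF this], of 0] show "vb gen_x j = 0" by simp
  have "val (pa j) (y - const (\<zeta> powi j)) > 0" using val_affine(4)[OF cusp_facts(1)] by (simp add: pa_def)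
  from val_minus_const_0(1)[of "pa j", OF _ _ disjI2[OF this], of 0] show "va y j = 0" by simp
qed

text \<open>Since b is a simple root of T^n - b^n, the remaining linear factors do not vanish at the
  point.\<close>

lemma val_y_n:
  assumes "a ^ n + b ^ n = 1" "b \<noteq> 0"
  shows "val (proj_point a b 1) (y ^ n - const (b ^ n)) = val (proj_point a b 1) (y - const b)"
proof -
  have "y ^ n - const (b ^ n) = py ([:0, 1:] ^ n - [:b ^ n:])"
    by (simp only: py.hom_minus py.hom_power py_simps)
  also have "[:0, 1:] ^ n = (Polynomial.monom 1 n :: complex poly)" by (simp add: monom_altdef)
  finally have eq: "y ^ n - const (b ^ n) = py (Polynomial.monom 1 n - [:b ^ n:])" .
  have "Polynomial.monom 1 n - [:b ^ n:] \<noteq> (0 :: complex poly)"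
    using order_monom_minus[OF n_pos assms(2)]
    by (metis assms(2) n_pos coeff_0 coeff_diff coeff_monom coeff_pCons_0 diff_0 neg_equal_0_iff_equal nat_less_le power_not_zero)
  thus ?thesis unfolding eq val_py_affine[OF assms(1)] using order_monom_minus[OF n_pos assms(2)]
    by (simp add: val_py_affine[OF assms(1)])
qed

text \<open>The line Y = \<zeta>^i Z meets the curve only at \<open>pa i\<close>, with multiplicity
  n, because y^n - 1 = -x^n and x has order 1 there. This is the source of the divisors divisible by
  n.\<close>

lemma v_gen_y_minus:
  "va (y - const (\<zeta> powi i)) j = (if int n dvd j - i then int n else 0)"
  "vb (y - const (\<zeta> powi i)) j = 0" "vc (y - const (\<zeta> powi i)) j = -1"
  and U_gen_y_minus [simp]: "y - const (\<zeta> powi i) \<in> U"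
proof -
  show "va (y - const (\<zeta> powi i)) j = (if int n dvd j - i then int n else 0)"
  proof (cases "int n dvd j - i")
    case True
    hence eq: "\<zeta> powi i = \<zeta> powi j" using zeta_powi_eq_iff[of j i] by simp
    have "y ^ n - const ((\<zeta> powi j) ^ n) = const (-1) * gen_x ^ n"
      using curve by (simp add: const.hom_uminus algebra_simps eq_diff_eq)
    moreover have "va (const (-1) * gen_x ^ n) j = int n"
      using val_mult[of "pa j" "const (-1)" "gen_x ^ n"] val_const[of "pa j" "-1"] val_power[of "pa j" gen_x n] v_gen_x
      by simp
    moreover have "va (y ^ n - const ((\<zeta> powi j) ^ n)) j = va (y - const (\<zeta> powi j)) j"
      unfolding pa_def by (rule val_y_n[OF cusp_facts(1)]) simp
    ultimately show ?thesis using True eq by simp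
  next
    case False
    hence ne: "\<zeta> powi j \<noteq> \<zeta> powi i" using zeta_powi_eq_iff[of j i] by simp
    have "val (pa j) (y - const (\<zeta> powi j)) > 0" using val_affine(4)[OF cusp_facts(1)] by (simp add: pa_def)
    from val_minus_const_0(1)[of "pa j", OF _ _ disjI2[OF this] ne] show ?thesis using False by simp
  qed
  have "val (pb j) (y - const 0) > 0" using val_affine(4)[OF cusp_facts(2), of j] by (simp add: pb_def)
  from val_minus_const_0(1)[of "pb j", OF _ _ disjI2[OF this], of "\<zeta> powi i"]
  show "vb (y - const (\<zeta> powi i)) j = 0" by simp
  show "vc (y - const (\<zeta> powi i)) j = -1"
    using val_minus_const_neg(1)[of "pc j" y "\<zeta> powi i"] v_gen_y by simp
  have "val (proj_point a b 1) (y - const (\<zeta> powi i)) = 0" if "a \<noteq> 0" "b \<noteq> 0" "a ^ n + b ^ n = 1" for a b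
  proof -
    have "b \<noteq> \<zeta> powi i"
    proof
      assume "b = \<zeta> powi i"
      hence "a ^ n = 0" using that(3) by simp
      thus False using that(1) by simp
    qed
    thus ?thesis
      using val_minus_const_0(1)[of "proj_point a b 1" y b "\<zeta> powi i"] val_affine(4)[OF that(3)] that(3) by simp
  qed
  thus "y - const (\<zeta> powi i) \<in> U" by (simp add: U_iff)
qed

lemma nonzero_mult_zeta:
  "a ^ n + b ^ n = 1 \<Longrightarrow> (\<zeta> * a) ^ n + b ^ n = 1" "a ^ n + b ^ n = 1 \<Longrightarrow> a ^ n + (\<zeta> * b) ^ n = 1"
  by (simp_all add: power_mult_distrib zeta_n)

lemma U_sigma [simp]: "z \<in> U \<Longrightarrow> sigma z \<in> U"
proof -
  assume z: "z \<in> U"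
  have "val (proj_point a b 1) (sigma z) = 0" if *: "a \<noteq> 0" "b \<noteq> 0" "a ^ n + b ^ n = 1" for a b
  proof -
    have "val (proj_point a b 1) (sigma z) = val (proj_point (\<zeta> * a) b 1) z"
      by (rule val_sigma) (use * z U_nz in simp_all)
    also have "\<dots> = 0" using z * nonzero_mult_zeta(1)[OF *(3)] unfolding U_iff by simp
    finally show ?thesis .
  qed
  thus ?thesis using z sigma(1) autD(3)[OF sigma(1)] by (simp add: U_iff)
qed

lemma U_tau [simp]: "z \<in> U \<Longrightarrow> tau z \<in> U"
proof -
  assume z: "z \<in> U"
  have "val (proj_point a b 1) (tau z) = 0" if *: "a \<noteq> 0" "b \<noteq> 0" "a ^ n + b ^ n = 1" for a b
  proof -
    have "val (proj_point a b 1) (tau z) = val (proj_point a (\<zeta> * b) 1) z"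
      by (rule val_tau) (use * z U_nz in simp_all)
    also have "\<dots> = 0" using z * nonzero_mult_zeta(2)[OF *(3)] unfolding U_iff by simp
    finally show ?thesis .
  qed
  thus ?thesis using z tau(1) autD(3)[OF tau(1)] by (simp add: U_iff)
qed

lemma U_swp [simp]: "z \<in> U \<Longrightarrow> swp z \<in> U"
proof -
  assume z: "z \<in> U"
  have "val (proj_point a b 1) (swp z) = 0" if *: "a \<noteq> 0" "b \<noteq> 0" "a ^ n + b ^ n = 1" for a b
  proof -
    have "val (proj_point a b 1) (swp z) = val (proj_point b a 1) z"
      by (rule val_swp) (use * z U_nz in simp_all)
    also have "\<dots> = 0" using z * add.commute[of "a ^ n" "b ^ n"] unfolding U_iff by simp
    finally show ?thesis .
  qed
  thus ?thesis using z swp(1) autD(3)[OF swp(1)] by (simp add: U_iff)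
qed

lemma U_kap [simp]: "z \<in> U \<Longrightarrow> kap z \<in> U"
proof -
  assume z: "z \<in> U"
  have "val (proj_point a b 1) (kap z) = 0" if *: "a \<noteq> 0" "b \<noteq> 0" "a ^ n + b ^ n = 1" for a b
  proof -
    have "val (proj_point a b 1) (kap z) = val (proj_point 1 (b / \<epsilon>) a) z"
      by (rule val_kap) (use * z U_nz in auto)
    also have "proj_point 1 (b / \<epsilon>) a = proj_point (1 / a) (b / (\<epsilon> * a)) 1"
      using proj_point_scale[OF *(1), of "1 / a" "b / (\<epsilon> * a)" 1] * by (simp add: field_simps)
    also have "val \<dots> z = 0"
    proof -
      have "b ^ n = 1 - a ^ n" using *(3) by (simp add: algebra_simps)
      hence "(1 / a) ^ n + (b / (\<epsilon> * a)) ^ n = 1"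
        using * by (simp add: power_divide power_mult_distrib eps_n field_simps)
      thus ?thesis using z * by (simp add: U_iff)
    qed
    finally show ?thesis .
  qed
  thus ?thesis using z kap(1) autD(3)[OF kap(1)] by (simp add: U_iff)
qed

lemma curve_point_cases:
  assumes "Q \<in> fermat_curve n"
  obtains (a) j where "Q = pa j" | (b) j where "Q = pb j" | (c) j where "Q = pc j"
  | (generic) a b where "Q = proj_point a b 1" "a \<noteq> 0" "b \<noteq> 0" "a ^ n + b ^ n = 1"
  using assms
proof (cases rule: fermat_curve_cases)
  case (affine a b)
  consider "a = 0" | "b = 0" | "a \<noteq> 0" "b \<noteq> 0" by blast
  thus ?thesis
  proof cases
    case 1
    hence "b ^ n = 1" using affine n_pos by (simp add: power_0_left)
    then obtain j where "b = \<zeta> powi j" by (rule root_of_unity)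
    thus ?thesis using a affine 1 by (simp add: pa_def)
  next
    case 2
    hence "a ^ n = 1" using affine n_pos by (simp add: power_0_left)
    then obtain j where "a = \<zeta> powi j" by (rule root_of_unity)
    thus ?thesis using b affine 2 by (simp add: pb_def)
  next
    case 3
    thus ?thesis using generic affine by blast
  qed
next
  case (infinity a)
  have "(a / \<epsilon>) ^ n = 1" using infinity by (simp add: power_divide eps_n)
  then obtain j where "a / \<epsilon> = \<zeta> powi j" by (rule root_of_unity)
  hence "a = \<epsilon> * \<zeta> powi j" by (simp add: field_simps)
  thus ?thesis using c infinity by (simp add: pc_def)
qed

lemma unit_nonneg_val:
  assumes "z \<in> U" "\<And>j. va z j \<ge> 0" "\<And>j. vb z j \<ge> 0" "\<And>j. vc z j \<ge> 0" "Q \<in> fermat_curve n"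
  shows "val Q z \<ge> 0"
  using assms(5) by (cases rule: curve_point_cases) (use assms in \<open>auto simp: U_iff\<close>)

lemma unit_val_0:
  assumes "z \<in> U" "\<And>j. va z j = 0" "\<And>j. vb z j = 0" "\<And>j. vc z j = 0" "Q \<in> fermat_curve n"
  shows "val Q z = 0"
  using assms(5) by (cases rule: curve_point_cases) (use assms in \<open>auto simp: U_iff\<close>)

lemma unit_const:
  assumes "z \<in> U" "\<And>j. va z j = 0" "\<And>j. vb z j = 0" "\<And>j. vc z j = 0"
  obtains c where "c \<noteq> 0" "z = const c"
  by (rule const_if_val_0[OF U_L[OF assms(1)] U_nz[OF assms(1)] unit_val_0[OF assms]], assumption, rule that)

section \<open>Principal divisors and their degree\<close>

definition principal :: "(int \<Rightarrow> int) \<Rightarrow> (int \<Rightarrow> int) \<Rightarrow> (int \<Rightarrow> int) \<Rightarrow> bool" where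
  "principal p q r \<longleftrightarrow> (\<exists>z\<in>U. va z = p \<and> vb z = q \<and> vc z = r)"

lemma principalI: "z \<in> U \<Longrightarrow> (\<And>j. va z j = p j) \<Longrightarrow> (\<And>j. vb z j = q j) \<Longrightarrow> (\<And>j. vc z j = r j) \<Longrightarrow> principal p q r"
  unfolding principal_def by (auto intro!: bexI[of _ z])

lemma principalE:
  assumes "principal p q r"
  obtains z where "z \<in> U" "\<And>j. va z j = p j" "\<And>j. vb z j = q j" "\<And>j. vc z j = r j"
proof -
  obtain z where z: "z \<in> U" "va z = p" "vb z = q" "vc z = r"
    using assms unfolding principal_def by blast
  show ?thesis
    by (rule that[OF z(1) fun_cong[OF z(2)] fun_cong[OF z(3)] fun_cong[OF z(4)]])
qed

lemma v_U:
  assumes "Q \<in> fermat_curve n" "u \<in> U" "w \<in> U"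
  shows "val Q (u * w) = val Q u + val Q w" "val Q (inverse u) = - val Q u" "val Q (u powi i) = i * val Q u"
    "val Q (u / w) = val Q u - val Q w"
  using assms val_mult val_inverse val_power_int val_divide U_L U_nz by simp_all

lemma principal_add:
  "principal p q r \<Longrightarrow> principal p' q' r' \<Longrightarrow> principal (\<lambda>j. p j + p' j) (\<lambda>j. q j + q' j) (\<lambda>j. r j + r' j)"
proof -
  assume "principal p q r" "principal p' q' r'"
  then obtain u w where "u \<in> U" "va u = p" "vb u = q" "vc u = r" "w \<in> U" "va w = p'" "vb w = q'" "vc w = r'"
    unfolding principal_def by blast
  thus ?thesis by (intro principalI[of "u * w"]) (auto simp: v_U)
qed

lemma principal_cmult: "principal p q r \<Longrightarrow> principal (\<lambda>j. k * p j) (\<lambda>j. k * q j) (\<lambda>j. k * r j)"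
proof -
  assume "principal p q r"
  then obtain u where "u \<in> U" "va u = p" "vb u = q" "vc u = r"
    unfolding principal_def by blast
  thus ?thesis by (intro principalI[of "u powi k"]) (auto simp: v_U)
qed

lemma principal_0: "principal (\<lambda>_. 0) (\<lambda>_. 0) (\<lambda>_. 0)"
  by (intro principalI[of "const 1"]) (auto simp: val_1)

lemma principal_sum:
  "(\<And>i. i \<in> I \<Longrightarrow> principal (p i) (q i) (r i)) \<Longrightarrow>
    principal (\<lambda>j. \<Sum>i\<in>I. p i j) (\<lambda>j. \<Sum>i\<in>I. q i j) (\<lambda>j. \<Sum>i\<in>I. r i j)"
  by (induction I rule: infinite_finite_induct) (simp_all add: principal_0 principal_add)

lemma principal_sigma: "principal p q r \<Longrightarrow> principal p (\<lambda>j. q (j + 1)) (\<lambda>j. r (j + 1))"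
proof -
  assume "principal p q r"
  then obtain z where "z \<in> U" "va z = p" "vb z = q" "vc z = r" unfolding principal_def by blast
  thus ?thesis by (intro principalI[of "sigma z"]) (auto simp: v_sigma U_nz)
qed

lemma principal_tau: "principal p q r \<Longrightarrow> principal (\<lambda>j. p (j + 1)) q (\<lambda>j. r (j - 1))"
proof -
  assume "principal p q r"
  then obtain z where "z \<in> U" "va z = p" "vb z = q" "vc z = r" unfolding principal_def by blast
  thus ?thesis by (intro principalI[of "tau z"]) (auto simp: v_tau U_nz)
qed

lemma principal_swp: "principal p q r \<Longrightarrow> principal q p (\<lambda>j. r (- j - twist))"
proof -
  assume "principal p q r"
  then obtain z where "z \<in> U" "va z = p" "vb z = q" "vc z = r" unfolding principal_def by blast
  thus ?thesis by (intro principalI[of "swp z"]) (auto simp: v_swp U_nz)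
qed

lemma principal_kap: "principal p q r \<Longrightarrow> principal (\<lambda>j. r (- j)) (\<lambda>j. q (- j)) (\<lambda>j. p (- j - twist))"
proof -
  assume "principal p q r"
  then obtain z where "z \<in> U" "va z = p" "vb z = q" "vc z = r" unfolding principal_def by blast
  thus ?thesis by (intro principalI[of "kap z"]) (auto simp: v_kap U_nz)
qed

lemma principal_periodic:
  assumes "principal p q r"
  shows "p (j + int n * k) = p j" "q (j + int n * k) = q j" "r (j + int n * k) = r j"
  using assms cusps_periodic[of j k] unfolding principal_def by metis+

lemma principal_x: "principal (\<lambda>_. 1) (\<lambda>_. 0) (\<lambda>_. - 1)"
  and principal_y: "principal (\<lambda>_. 0) (\<lambda>_. 1) (\<lambda>_. - 1)"
  by (rule principalI[of gen_x] principalI[of y]; simp add: v_gen_x v_gen_y)+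

lemma principal_y_minus: "principal (\<lambda>j. if int n dvd j - i then int n else 0) (\<lambda>_. 0) (\<lambda>_. - 1)"
  by (rule principalI[of "y - const (\<zeta> powi i)"]) (simp_all add: v_gen_y_minus)

lemma sum_periodic_shift:
  fixes f :: "int \<Rightarrow> int"
  assumes "\<And>j. f (j + int n) = f j"
  shows "(\<Sum>k<n. f (j + int k)) = (\<Sum>k<n. f (int k))"
proof -
  have step: "(\<Sum>k<n. f (j + 1 + int k)) = (\<Sum>k<n. f (j + int k))" for j
  proof -
    obtain m where m: "n = Suc m" using n_pos by (cases n) auto
    have "(\<Sum>k<Suc m. f (j + 1 + int k)) = (\<Sum>k<m. f (j + int (Suc k))) + f (j + int n)"
      by (simp add: m ac_simps)
    also have "\<dots> = (\<Sum>k<Suc m. f (j + int k))"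
      unfolding sum.lessThan_Suc_shift assms by simp
    finally show ?thesis by (simp only: m)
  qed
  show ?thesis
  proof (induction j rule: int_induct[where k = 0])
    case base
    show ?case by simp
  next
    case (step1 i)
    thus ?case using step[of i] by simp
  next
    case (step2 i)
    thus ?case using step[of "i - 1"] by simp
  qed
qed

abbreviation S :: "(int \<Rightarrow> int) \<Rightarrow> int" where "S f \<equiv> (\<Sum>k<n. f (int k))"

text \<open>Add the n translates under one automorphism: the fixed family is multiplied by n, and
  each moved family becomes constant, equal to its sum over a period.\<close>

lemma principal_orbit:
  assumes "principal p q r"
  shows "principal (\<lambda>j. int n * p j) (\<lambda>_. S q) (\<lambda>_. S r)"
    "principal (\<lambda>_. S p) (\<lambda>j. int n * q j) (\<lambda>_. S r)"
proof -
  have 1: "principal p (\<lambda>j. q (j + int k)) (\<lambda>j. r (j + int k))" for k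
  proof (induction k)
    case (Suc k)
    thus ?case using principal_sigma[OF Suc] by (simp add: ac_simps)
  qed (simp add: assms)
  have 2: "principal (\<lambda>j. p (j + int k)) q (\<lambda>j. r (j - int k))" for k
  proof (induction k)
    case (Suc k)
    thus ?case using principal_tau[OF Suc] by (simp add: algebra_simps)
  qed (simp add: assms)
  note per = principal_periodic[OF assms, of _ 1, simplified]
  show "principal (\<lambda>j. int n * p j) (\<lambda>_. S q) (\<lambda>_. S r)"
    using principal_sum[of "{..<n}" "\<lambda>_. p" "\<lambda>k j. q (j + int k)" "\<lambda>k j. r (j + int k)", OF 1] per
    by (simp add: sum_periodic_shift)
  have "(\<Sum>k<n. r (j - int k)) = S r" for j
  proof -
    have "(\<Sum>k<n. r (j - int k)) = (\<Sum>k<n. r (j - int (n - Suc k)))"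
      by (rule sum.nat_diff_reindex[symmetric])
    also have "\<dots> = (\<Sum>k<n. r (j - int (n - 1) + int k))"
    proof (intro sum.cong refl)
      fix k assume "k \<in> {..<n}"
      hence "j - int (n - Suc k) = j - int (n - 1) + int k" by (auto simp: of_nat_diff)
      thus "r (j - int (n - Suc k)) = r (j - int (n - 1) + int k)" by (simp only:)
    qed
    finally show ?thesis using per by (simp add: sum_periodic_shift)
  qed
  thus "principal (\<lambda>_. S p) (\<lambda>j. int n * q j) (\<lambda>_. S r)"
    using principal_sum[of "{..<n}" "\<lambda>k j. p (j + int k)" "\<lambda>_. q" "\<lambda>k j. r (j - int k)", OF 2] per
    by (simp add: sum_periodic_shift)
qed

text \<open>A positive constant would belong to a function with zeros but no poles; a negative one
  is reduced to this by inversion.\<close>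

lemma principal_c_const:
  assumes "principal (\<lambda>_. 0) (\<lambda>_. 0) (\<lambda>_. m)"
  shows "m = 0"
proof -
  have "m \<le> 0" if "principal (\<lambda>_. 0) (\<lambda>_. 0) (\<lambda>_. m)" for m
  proof (rule ccontr)
    assume m: "\<not> m \<le> 0"
    obtain z where z: "z \<in> U" "\<And>j. va z j = 0" "\<And>j. vb z j = 0" "\<And>j. vc z j = m"
      using \<open>principal (\<lambda>_. 0) (\<lambda>_. 0) (\<lambda>_. m)\<close> that unfolding principal_def by metis
    have "vc z 0 = 0"
      by (rule no_poles_imp_no_zeros) (use z m U_nz unit_nonneg_val[OF z(1)] in auto)
    thus False using z m by simp
  qed
  from this[of m] this[of "- m"] show ?thesis
    using assms principal_cmult[OF assms, of "-1"] by simp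
qed

text \<open>Averaging over both automorphisms makes the divisor constant on each family, at the cost
  of a factor n. Powers of x and y then remove the families a and b, and
  \<open>principal_c_const\<close> makes the constant left on c vanish; it is n times the
  degree.\<close>

lemma principal_degree:
  assumes "principal p q r"
  shows "S p + S q + S r = 0"
proof -
  have "principal (\<lambda>_. int n * S p) (\<lambda>_. int n * S q) (\<lambda>_. int n * S r)"
    using principal_orbit(2)[OF principal_orbit(1)[OF assms]] by (simp add: sum_distrib_left[symmetric])
  from principal_add[OF this principal_add[OF principal_cmult[OF principal_x, of "- (int n * S p)"]
      principal_cmult[OF principal_y, of "- (int n * S q)"]]]
  have "principal (\<lambda>_. 0) (\<lambda>_. 0) (\<lambda>_. int n * S r + int n * S p + int n * S q)"
    by (simp add: algebra_simps)
  hence "int n * (S r + S p + S q) = 0" using principal_c_const by (simp only: distrib_left)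
  thus ?thesis using n_pos by simp
qed

subsection \<open>Hilbert's Theorem 90 for two commuting automorphisms\<close>

lemma of_nat_n_nz: "(of_nat n :: ambient) \<noteq> 0"
  using n_pos const_eq_0_iff[of "of_nat n"] by (simp add: const.hom_of_nat)

lemma const_power_int: "const (c powi i) = const c powi i"
  by (simp add: power_int_def const.hom_power const_inverse)

text \<open>The points \<open>pa j\<close> are fixed by \<open>sigma\<close>, so
  \<open>sigma\<close> multiplies z by a constant, necessarily some \<zeta>^k. Hence z / x^k is
  fixed and lies in C(y). There the orders at \<open>pa j\<close> are multiples of n, by
  ramification, while x^k contributes k.\<close>

lemma principal_only_a:
  assumes "principal p (\<lambda>_. 0) (\<lambda>_. 0)"
  obtains k where "\<And>j. int n dvd p j - k"
proof -
  obtain z where z: "z \<in> U" "\<And>j. va z j = p j" "\<And>j. vb z j = 0" "\<And>j. vc z j = 0"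
    using assms unfolding principal_def by metis
  have zL: "z \<in> L" "z \<noteq> 0" using z(1) U_nz by simp_all
  note ls = lhom_simps[OF autD(1)[OF sigma(1)]]
  obtain c where c: "c \<noteq> 0" "sigma z / z = const c"
    by (rule unit_const[of "sigma z / z"]) (use z zL in \<open>auto simp: v_U v_sigma\<close>)
  hence sz: "sigma z = const c * z" using zL by (simp add: field_simps)
  have "(sigma ^^ i) z = const c ^ i * z" for i
    by (induction i) (use zL in \<open>simp_all add: ls autD(2)[OF sigma(1)] sz\<close>)
  from this[of n] have "const (c ^ n) = 1" using zL sigma_n[OF zL(1)] by (simp add: const.hom_power)
  hence "c ^ n = 1" by (metis const.hom_one const_eq_iff)
  then obtain k where k: "c = \<zeta> powi k" by (rule root_of_unity)
  define w where "w = z * gen_x powi (- k)"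
  have wL: "w \<in> L" "w \<noteq> 0" using zL by (simp_all add: w_def)
  have "sigma w = w"
    using zL by (simp add: w_def ls sz sigma k const_power_int power_int_mult_distrib power_int_minus field_simps)
  then obtain P R where PR: "R \<noteq> 0" "w = py P / py R" "coprime P R" using sigma_fixed_field[OF wL(1)] by blast
  have P0: "P \<noteq> 0" using wL PR by auto
  have "int n dvd p j - k" for j
  proof -
    have "va w j = p j - k" using z by (simp add: w_def v_U v_gen_x)
    moreover have "va (py P) j = int (order (\<zeta> powi j) P) * int n" "va (py R) j = int (order (\<zeta> powi j) R) * int n"
      using val_py_affine[OF cusp_facts(1), of P j] val_py_affine[OF cusp_facts(1), of R j] P0 PR(1) v_gen_y_minus(1)[of j j]
      by (simp_all add: pa_def)
    moreover have "va w j = va (py P) j - va (py R) j"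
      unfolding PR(2) by (rule val_divide) (use P0 PR(1) in simp_all)
    ultimately have "p j - k = int n * (int (order (\<zeta> powi j) P) - int (order (\<zeta> powi j) R))"
      by (simp add: algebra_simps)
    thus ?thesis by simp
  qed
  thus ?thesis by (rule that)
qed

lemma principal_only_b:
  assumes "principal (\<lambda>_. 0) q (\<lambda>_. 0)"
  obtains k where "\<And>j. int n dvd q j - k"
  using principal_only_a principal_swp[OF assms] by metis

lemma principal_only_c:
  assumes "principal (\<lambda>_. 0) (\<lambda>_. 0) r"
  obtains k where "\<And>j. int n dvd r j - k"
proof -
  obtain k where k: "\<And>j. int n dvd r (- j) - k"
    using principal_only_a principal_kap[OF assms] by metis
  show ?thesis using that[of k] k[of "- j" for j] by simp
qed

text \<open>
  The resolvent \<open>\<Sum> \<alpha>^i(u) / (e \<alpha>(e) \<cdots> \<alpha>^(i-1)(e))\<close> of Hilbert's Theorem 90; it satisfies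
  \<open>\<alpha>(z) = e z\<close> if \<open>e\<close> has norm \<open>1\<close>.
\<close>
definition resolvent :: "(ambient \<Rightarrow> ambient) \<Rightarrow> ambient \<Rightarrow> ambient \<Rightarrow> ambient" where
  "resolvent \<alpha> e u = (\<Sum>i<n. (\<alpha> ^^ i) u / (\<Prod>k<i. (\<alpha> ^^ k) e))"

context
  fixes \<alpha> e
  assumes \<alpha>: "aut \<alpha>" "\<And>z. z \<in> L \<Longrightarrow> (\<alpha> ^^ n) z = z" and e: "e \<in> L" "e \<noteq> 0"
    and norm: "orbit_prod \<alpha> e = 1"
begin

lemma funpow_L: "u \<in> L \<Longrightarrow> (\<alpha> ^^ k) u \<in> L"
  using autD(3)[OF aut_funpow[OF \<alpha>(1)]] .

lemma partial_norm: "(\<Prod>k<i. (\<alpha> ^^ k) e) \<in> L" "(\<Prod>k<i. (\<alpha> ^^ k) e) \<noteq> 0"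
  using e funpow_L aut_funpow[OF \<alpha>(1)] by (auto)

lemma resolvent_L: "u \<in> L \<Longrightarrow> resolvent \<alpha> e u \<in> L"
  using funpow_L partial_norm by (auto simp: resolvent_def)

lemma resolvent_eigen:
  assumes u: "u \<in> L"
  shows "\<alpha> (resolvent \<alpha> e u) = e * resolvent \<alpha> e u"
proof -
  let ?E = "\<lambda>i. \<Prod>k<i. (\<alpha> ^^ k) e"
  note ls = lhom_simps[OF autD(1)[OF \<alpha>(1)]]
  have E: "e * \<alpha> (?E i) = ?E (Suc i)" for i
    unfolding prod.lessThan_Suc_shift using e funpow_L by (simp add: ls)
  have "\<alpha> (resolvent \<alpha> e u) = (\<Sum>i<n. (\<alpha> ^^ Suc i) u / \<alpha> (?E i))"
    unfolding resolvent_def using funpow_L[OF u] partial_norm by (simp add: ls(11) ls(8))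
  also have "\<dots> = e * (\<Sum>i<n. (\<alpha> ^^ Suc i) u / ?E (Suc i))"
    unfolding sum_distrib_left E[symmetric] using e by (intro sum.cong refl) simp
  also have "(\<Sum>i<n. (\<alpha> ^^ Suc i) u / ?E (Suc i)) = resolvent \<alpha> e u"
  proof -
    obtain m where m: "n = Suc m" using n_pos by (cases n) auto
    \<comment> \<open>The term that wraps around is the initial term u again, because \<alpha> has
      order dividing n and e has norm 1.\<close>
    have last: "(\<alpha> ^^ n) u / ?E n = u" using \<alpha>(2)[OF u] norm by (simp add: orbit_prod_def)
    have "(\<Sum>i<n. (\<alpha> ^^ Suc i) u / ?E (Suc i)) = (\<Sum>i<m. (\<alpha> ^^ Suc i) u / ?E (Suc i)) + (\<alpha> ^^ n) u / ?E n"
      unfolding m by (rule sum.lessThan_Suc)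
    also have "\<dots> = (\<Sum>i<Suc m. (\<alpha> ^^ i) u / ?E i)"
      unfolding last sum.lessThan_Suc_shift by simp
    finally show ?thesis unfolding resolvent_def by (simp only: m)
  qed
  finally show ?thesis .
qed

text \<open>Fourier inversion over the powers of the eigenvector g takes the role of independence of
  characters: dividing the resolvent of g^k u by g^k and summing over k isolates the term i = 0,
  which yields n u.\<close>

lemma resolvent_nonzero:
  assumes u: "u \<in> L" "u \<noteq> 0" and g: "g \<in> L" "g \<noteq> 0" "\<alpha> g = const \<zeta> * g"
  obtains k where "resolvent \<alpha> e (g ^ k * u) \<noteq> 0"
proof -
  let ?E = "\<lambda>i. \<Prod>k<i. (\<alpha> ^^ k) e"
  have ag: "(\<alpha> ^^ i) g = const \<zeta> ^ i * g" for i
    by (induction i) (use g in \<open>simp_all add: lhom_simps[OF autD(1)[OF \<alpha>(1)]] autD(2)[OF \<alpha>(1)]\<close>)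
  have "(\<Sum>k<n. resolvent \<alpha> e (g ^ k * u) / g ^ k)
      = (\<Sum>k<n. \<Sum>i<n. const \<zeta> ^ (i * k) * ((\<alpha> ^^ i) u / ?E i))"
  proof (intro sum.cong refl)
    fix k
    show "resolvent \<alpha> e (g ^ k * u) / g ^ k = (\<Sum>i<n. const \<zeta> ^ (i * k) * ((\<alpha> ^^ i) u / ?E i))"
      unfolding resolvent_def sum_divide_distrib
      by (intro sum.cong refl)
        (use u g in \<open>simp add: lhom_simps[OF autD(1)[OF aut_funpow[OF \<alpha>(1)]]] ag power_mult_distrib power_mult\<close>)
  qed
  also have "\<dots> = (\<Sum>i<n. (\<Sum>k<n. const \<zeta> ^ (k * i)) * ((\<alpha> ^^ i) u / ?E i))"
    by (subst sum.swap, intro sum.cong refl) (simp only: sum_distrib_right mult.commute)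
  also have "\<dots> = (\<Sum>i\<in>{0}. of_nat n * ((\<alpha> ^^ i) u / ?E i))"
    by (rule sum.mono_neutral_cong_right)
      (use n_pos in \<open>auto simp: sum_zeta_powers dvd_imp_le dest: nat_dvd_not_less[rotated]\<close>)
  also have "\<dots> = of_nat n * u" by simp
  also have "\<dots> \<noteq> 0" using of_nat_n_nz u by simp
  finally have *: "(\<Sum>k<n. resolvent \<alpha> e (g ^ k * u) / g ^ k) \<noteq> 0" .
  show ?thesis
  proof (rule ccontr)
    assume "\<not> thesis"
    hence "resolvent \<alpha> e (g ^ k * u) = 0" for k using that by blast
    thus False using * by simp
  qed
qed

end

text \<open>First solve for \<open>tau\<close> alone and call the solution v. Since
  \<open>tau\<close> fixes x, every x^k v is again a solution, and k is chosen so that its resolvent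
  for \<open>sigma\<close> is nonzero. The compatibility condition says that this resolvent keeps
  the eigenvalue e' under \<open>tau\<close>.\<close>

lemma bicyclic_hilbert90:
  assumes e: "e \<in> L" "e \<noteq> 0" "orbit_prod sigma e = 1" and e': "e' \<in> L" "e' \<noteq> 0" "orbit_prod tau e' = 1"
    and compat: "tau e * e' = e * sigma e'"
  obtains f where "f \<in> L" "f \<noteq> 0" "sigma f = e * f" "tau f = e' * f"
proof -
  note s = sigma(1) sigma_n e and t = tau(1) tau_n e'
  obtain l where "resolvent tau e' (y ^ l * 1) \<noteq> 0"
    by (rule resolvent_nonzero[OF t, of 1 y]) (simp_all add: tau)
  define v where "v = resolvent tau e' (y ^ l * 1)"
  have v: "v \<in> L" "v \<noteq> 0" "tau v = e' * v"
    unfolding v_def using resolvent_L[OF t, of "y ^ l * 1"] resolvent_eigen[OF t, of "y ^ l * 1"] \<open>resolvent tau e' (y ^ l * 1) \<noteq> 0\<close>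
    by simp_all
  obtain k where k: "resolvent sigma e (gen_x ^ k * v) \<noteq> 0"
    by (rule resolvent_nonzero[OF s v(1,2), of gen_x]) (simp_all add: sigma)
  define u where "u = gen_x ^ k * v"
  have u: "u \<in> L" "tau u = e' * u"
    using v by (simp_all add: u_def lhom_simps[OF autD(1)[OF tau(1)]] tau)
  let ?E = "\<lambda>i. \<Prod>k<i. (sigma ^^ k) e"
  note lt = lhom_simps[OF autD(1)[OF tau(1)]]
  have sL: "(sigma ^^ i) z \<in> L" if "z \<in> L" for i z
    using that autD(3)[OF aut_funpow[OF sigma(1)]] by simp
  have snz: "(sigma ^^ i) z \<noteq> 0" if "z \<in> L" "z \<noteq> 0" for i z
    using that aut_nz[OF aut_funpow[OF sigma(1)]] by simp
  have comm: "tau ((sigma ^^ i) z) = (sigma ^^ i) (tau z)" if "z \<in> L" for i z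
    using that by (induction i) (simp_all add: sL flip: sigma_tau)
  note lsi = lhom_simps[OF autD(1)[OF aut_funpow[OF sigma(1)]]]
  have EL: "?E i \<in> L" "?E i \<noteq> 0" for i using partial_norm[OF s(1,2,3,4,5)] by auto
  have step: "(sigma ^^ i) (tau e) * (sigma ^^ i) e' = (sigma ^^ i) e * (sigma ^^ Suc i) e'" for i
  proof -
    have "(sigma ^^ i) (tau e * e') = (sigma ^^ i) (e * sigma e')" by (simp only: compat)
    thus ?thesis using e e' autD(3)[OF tau(1)] autD(3)[OF sigma(1)] by (simp add: lsi funpow_swap1)
  qed
  \<comment> \<open>Telescoping the compatibility condition: \<open>tau\<close> changes the i-th
    partial norm by exactly the factor that turns \<sigma>^i(e') into e' in the i-th
    summand.\<close>
  have tauE: "tau (?E i) * e' = ?E i * (sigma ^^ i) e'" for i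
  proof (induction i)
    case 0
    show ?case by (simp add: lt)
  next
    case (Suc i)
    have "tau (?E (Suc i)) * e' = (tau (?E i) * e') * (sigma ^^ i) (tau e)"
      using EL e sL by (simp add: lt comm)
    also have "\<dots> = ?E i * ((sigma ^^ i) (tau e) * (sigma ^^ i) e')" by (simp add: Suc)
    also have "\<dots> = ?E (Suc i) * (sigma ^^ Suc i) e'" by (simp only: step) simp
    finally show ?case .
  qed
  have "tau ((sigma ^^ i) u / ?E i) = e' * ((sigma ^^ i) u / ?E i)" for i
  proof -
    have "tau ((sigma ^^ i) u / ?E i) = (sigma ^^ i) e' * (sigma ^^ i) u / tau (?E i)"
      using u sL EL e' by (simp add: lt comm lsi)
    also have "tau (?E i) = ?E i * (sigma ^^ i) e' / e'" using tauE[of i] e' by (simp add: field_simps)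
    finally show ?thesis using snz[OF e'(1,2)] e' by simp
  qed
  hence "tau (resolvent sigma e u) = e' * resolvent sigma e u"
    unfolding resolvent_def using u sL EL by (simp add: lt sum_distrib_left)
  thus ?thesis
    using that[of "resolvent sigma e u"] resolvent_L[OF s u(1)] resolvent_eigen[OF s u(1)] k by (simp add: u_def)
qed

text \<open>The units e and e' have order 0 away from the cusps, so f and its images have equal
  orders there, and these are the orders of f at translated points.\<close>

lemma val_zeta_invariant:
  assumes f: "f \<in> L" "f \<noteq> 0" "sigma f = e * f" "tau f = e' * f" "e \<in> U" "e' \<in> U"
    and ab: "a \<noteq> 0" "b \<noteq> 0" "a ^ n + b ^ n = 1"
  shows "val (proj_point (\<zeta> ^ i * a) (\<zeta> ^ j * b) 1) f = val (proj_point a b 1) f"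
proof -
  have ab': "\<zeta> ^ i * a \<noteq> 0" "\<zeta> ^ j * b \<noteq> 0" "(\<zeta> ^ i * a) ^ n + (\<zeta> ^ j * b) ^ n = 1" for i j
    using ab zeta_n by (simp_all add: power_mult_distrib power_mult[symmetric] mult.commute[of _ n] power_mult)
  have 1: "val (proj_point (\<zeta> * a) b 1) f = val (proj_point a b 1) f"
    if ab: "a \<noteq> 0" "b \<noteq> 0" "a ^ n + b ^ n = 1" for a b
  proof -
    have "val (proj_point (\<zeta> * a) b 1) f = val (proj_point a b 1) (sigma f)"
      by (rule val_sigma[symmetric]) (use ab f in simp_all)
    also have "\<dots> = val (proj_point a b 1) f"
      using ab f U_nz[OF f(5)] val_mult[of "proj_point a b 1" e f] by (auto simp: U_iff)
    finally show ?thesis .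
  qed
  have 2: "val (proj_point a (\<zeta> * b) 1) f = val (proj_point a b 1) f"
    if ab: "a \<noteq> 0" "b \<noteq> 0" "a ^ n + b ^ n = 1" for a b
  proof -
    have "val (proj_point a (\<zeta> * b) 1) f = val (proj_point a b 1) (tau f)"
      by (rule val_tau[symmetric]) (use ab f in simp_all)
    also have "\<dots> = val (proj_point a b 1) f"
      using ab f U_nz[OF f(6)] val_mult[of "proj_point a b 1" e' f] by (auto simp: U_iff)
    finally show ?thesis .
  qed
  have "val (proj_point (\<zeta> ^ i * a) (\<zeta> ^ j * b) 1) f = val (proj_point (\<zeta> ^ i * a) b 1) f"
  proof (induction j)
    case (Suc j)
    thus ?case using 2[OF ab'(1)[of i] ab'(2)[of j] ab'(3)[of i j]] by (simp add: mult.assoc)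
  qed simp
  also have "\<dots> = val (proj_point a b 1) f"
  proof (induction i)
    case (Suc i)
    thus ?case using 1[OF ab'(1)[of i] ab(2) ab'(3)[of i 0, simplified]] by (simp add: mult.assoc)
  qed simp
  finally show ?thesis .
qed

lemma root_of_unity_nat:
  assumes "w ^ n = 1"
  obtains k where "w = \<zeta> ^ k"
proof -
  obtain j where j: "w = \<zeta> powi j" using assms by (rule root_of_unity)
  have "\<zeta> powi j = \<zeta> powi int (nat (j mod int n))"
    using n_pos by (simp add: zeta_powi_eq_iff del: power_int_of_nat)
  also have "\<dots> = \<zeta> ^ nat (j mod int n)" by (simp only: power_int_of_nat)
  finally show ?thesis using that j by simp
qed

text \<open>The solution f may have zeros and poles outside the cusps, but with equal order along
  each orbit of the two automorphisms. Those orbits are the fibres of y^n, so a product T of powers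
  of y^n - c, which both automorphisms fix, has the same orders there; f / T is a unit with the same
  eigenvalues.\<close>

lemma hilbert90_units:
  assumes e: "e \<in> U" "orbit_prod sigma e = 1" and e': "e' \<in> U" "orbit_prod tau e' = 1"
    and compat: "tau e * e' = e * sigma e'"
  obtains f where "f \<in> U" "sigma f = e * f" "tau f = e' * f"
proof -
  obtain f where f: "f \<in> L" "f \<noteq> 0" "sigma f = e * f" "tau f = e' * f"
    by (rule bicyclic_hilbert90[OF U_L[OF e(1)] U_nz[OF e(1)] e(2) U_L[OF e'(1)] U_nz[OF e'(1)] e'(2) compat])
  note inv = val_zeta_invariant[OF f e(1) e'(1)]
  define N where "N = orbit_prod sigma f"
  have N: "N \<in> L" "N \<noteq> 0" "sigma N = N"
    using f sigma(1) orbit_prod_invariant[OF sigma(1) sigma_n f(1)] by (simp_all add: N_def)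
  obtain P R where PR: "R \<noteq> 0" "N = py P / py R" "coprime P R"
    using sigma_fixed_field[OF N(1,3)] by blast
  have P0: "P \<noteq> 0" using N PR by auto
  have f_val: "int n * val (proj_point a b 1) f = int (order b P) - int (order b R)"
    if ab: "a \<noteq> 0" "b \<noteq> 0" "a ^ n + b ^ n = 1" for a b
  proof -
    have Q: "proj_point a b 1 \<in> fermat_curve n" using ab by simp
    have "val (proj_point a b 1) N = (\<Sum>k<n. val (proj_point a b 1) ((sigma ^^ k) f))"
      unfolding N_def by (rule orbit_prod_val[OF sigma(1) f(1,2) Q])
    also have "\<dots> = (\<Sum>k<n. val (proj_point a b 1) f)"
    proof (intro sum.cong refl)
      fix k
      have "val (proj_point a b 1) ((sigma ^^ k) f) = val (proj_point (\<zeta> ^ k * a) b 1) f"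
        by (rule sigma_funpow_val) (use ab f in simp_all)
      thus "val (proj_point a b 1) ((sigma ^^ k) f) = val (proj_point a b 1) f"
        using inv[OF ab, of k 0] by simp
    qed
    finally have "val (proj_point a b 1) N = int n * val (proj_point a b 1) f" by simp
    moreover have "val (proj_point a b 1) N = int (order b P) - int (order b R)"
      using val_divide[OF Q, of "py P" "py R"] P0 PR val_py_affine[OF ab(3)] val_affine(2)[OF ab(3,1)] by simp
    ultimately show ?thesis by simp
  qed
  \<comment> \<open>Outside the fibres over B the norm of f, and hence f, has order 0. B may contain
    0 or 1, over which no point outside the cusps lies; the corresponding factors of T have order 0
    at all points that matter.\<close>
  define B where "B = (\<lambda>b. b ^ n) ` ({b. poly P b = 0} \<union> {b. poly R b = 0})"
  have finB: "finite B" unfolding B_def using P0 PR(1) by (simp add: poly_roots_finite)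
  \<comment> \<open>Any point of the fibre serves as representative, by invariance along the
    orbit.\<close>
  define m where "m = (\<lambda>c. val (proj_point (SOME a. a ^ n = 1 - c) (SOME b. b ^ n = c) 1) f)"
  have m: "m (b ^ n) = val (proj_point a b 1) f" if ab: "a \<noteq> 0" "b \<noteq> 0" "a ^ n + b ^ n = 1" for a b
  proof -
    define a' b' where "a' = (SOME a'. a' ^ n = 1 - b ^ n)" and "b' = (SOME b'. b' ^ n = b ^ n)"
    have a': "a' ^ n = 1 - b ^ n" unfolding a'_def by (rule someI_ex[OF nth_root_exists[OF n_pos]])
    have b': "b' ^ n = b ^ n" unfolding b'_def by (rule someI_ex[OF nth_root_exists[OF n_pos]])
    have "(a' / a) ^ n = 1" using a' ab by (simp add: power_divide divide_eq_1_iff diff_eq_eq)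
    then obtain i where "a' / a = \<zeta> ^ i" by (rule root_of_unity_nat)
    moreover have "(b' / b) ^ n = 1" using b' ab by (simp add: power_divide)
    then obtain j where "b' / b = \<zeta> ^ j" by (rule root_of_unity_nat)
    ultimately have "a' = \<zeta> ^ i * a" "b' = \<zeta> ^ j * b" using ab by (simp_all add: field_simps)
    thus ?thesis using inv[OF ab, of i j] by (simp add: m_def a'_def b'_def)
  qed
  have nc: "y ^ n - const c \<in> L \<and> y ^ n - const c \<noteq> 0" for c
  proof -
    have "val (proj_point \<epsilon> 1 0) (y ^ n) < 0"
      using val_power[of "proj_point \<epsilon> 1 0" y n] val_infinity(1)[OF eps_n] eps_n n_pos by simp
    from val_minus_const_neg(2)[OF _ _ _ this, of c] show ?thesis using eps_n by simp
  qed
  define T where "T = (\<Prod>c\<in>B. (y ^ n - const c) powi m c)"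
  have T: "T \<in> L" "T \<noteq> 0" using finB nc by (auto simp: T_def)
  note ls = lhom_simps[OF autD(1)[OF sigma(1)]] and lt = lhom_simps[OF autD(1)[OF tau(1)]]
  have sT: "sigma T = T"
    using nc by (simp add: T_def ls sigma autD(2)[OF sigma(1)])
  have tT: "tau T = T"
    using nc by (simp add: T_def lt tau autD(2)[OF tau(1)] power_mult_distrib const_zeta_n)
  have T_val: "val (proj_point a b 1) T = val (proj_point a b 1) f"
    if ab: "a \<noteq> 0" "b \<noteq> 0" "a ^ n + b ^ n = 1" for a b
  proof -
    have Q: "proj_point a b 1 \<in> fermat_curve n" using ab by simp
    have 1: "val (proj_point a b 1) (y ^ n - const (b ^ n)) = 1"
      using val_y_n[OF ab(3,2)] val_affine(2)[OF ab(3,1)] by simp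
    have 0: "val (proj_point a b 1) (y ^ n - const c) = 0" if "c \<noteq> b ^ n" for c
      by (rule val_minus_const_0(1)[OF Q, of _ "b ^ n"]) (use 1 that in auto)
    have "val (proj_point a b 1) T = (\<Sum>c\<in>B. m c * val (proj_point a b 1) (y ^ n - const c))"
    proof -
      have "val (proj_point a b 1) T = (\<Sum>c\<in>B. val (proj_point a b 1) ((y ^ n - const c) powi m c))"
        unfolding T_def by (rule val_prod[OF Q]) (use nc in auto)
      thus ?thesis using nc by (simp add: val_power_int[OF Q])
    qed
    also have "\<dots> = (\<Sum>c\<in>B. if c = b ^ n then m c else 0)"
      by (intro sum.cong refl) (use 0 1 in auto)
    also have "\<dots> = (if b ^ n \<in> B then m (b ^ n) else 0)" using finB by simp
    also have "\<dots> = val (proj_point a b 1) f"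
    proof (cases "b ^ n \<in> B")
      case False
      hence "poly P b \<noteq> 0" "poly R b \<noteq> 0" by (auto simp: B_def)
      hence "int n * val (proj_point a b 1) f = 0" using f_val[OF ab] by (simp add: order_0I)
      thus ?thesis using n_pos False by simp
    qed (simp add: m[OF ab])
    finally show ?thesis .
  qed
  have "f / T \<in> U"
    unfolding U_iff using f T T_val val_divide[of _ f T] by simp
  moreover have "sigma (f / T) = e * (f / T)" "tau (f / T) = e' * (f / T)"
    using f T sT tT by (simp_all add: ls lt)
  ultimately show ?thesis using that by blast
qed

section \<open>Units of norm 1 and integration of divisors\<close>

lemma v_sigma_funpow:
  assumes z: "z \<in> U"
  shows "(sigma ^^ k) z \<in> U" "va ((sigma ^^ k) z) j = va z j" "vb ((sigma ^^ k) z) j = vb z (j + int k)"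
    "vc ((sigma ^^ k) z) j = vc z (j + int k)"
proof -
  show *: "(sigma ^^ k) z \<in> U" for k by (induction k) (simp_all add: z)
  show "va ((sigma ^^ k) z) j = va z j" "vb ((sigma ^^ k) z) j = vb z (j + int k)"
    "vc ((sigma ^^ k) z) j = vc z (j + int k)"
    by (induction k arbitrary: j) (use * U_nz in \<open>simp_all add: v_sigma ac_simps\<close>)
qed

lemma v_tau_funpow:
  assumes z: "z \<in> U"
  shows "(tau ^^ k) z \<in> U" "va ((tau ^^ k) z) j = va z (j + int k)" "vb ((tau ^^ k) z) j = vb z j"
    "vc ((tau ^^ k) z) j = vc z (j - int k)"
proof -
  show *: "(tau ^^ k) z \<in> U" for k by (induction k) (simp_all add: z)
  show "va ((tau ^^ k) z) j = va z (j + int k)" "vb ((tau ^^ k) z) j = vb z j"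
    "vc ((tau ^^ k) z) j = vc z (j - int k)"
    by (induction k arbitrary: j) (use * U_nz in \<open>simp_all add: v_tau algebra_simps\<close>)
qed

lemma U_prod: "(\<And>i. i \<in> I \<Longrightarrow> f i \<in> U) \<Longrightarrow> prod f I \<in> U"
  by (induction I rule: infinite_finite_induct) simp_all

lemma orbit_prod_mult: "aut \<alpha> \<Longrightarrow> u \<in> L \<Longrightarrow> w \<in> L \<Longrightarrow> orbit_prod \<alpha> (u * w) = orbit_prod \<alpha> u * orbit_prod \<alpha> w"
  by (simp add: orbit_prod_def lhom_mult[OF autD(1)[OF aut_funpow]] prod.distrib)

lemma orbit_prod_const: "aut \<alpha> \<Longrightarrow> orbit_prod \<alpha> (const c) = const (c ^ n)"
  by (simp add: orbit_prod_def autD(2)[OF aut_funpow] const.hom_power)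

lemma orbit_prod_power_int: "aut \<alpha> \<Longrightarrow> u \<in> L \<Longrightarrow> orbit_prod \<alpha> (u powi i) = orbit_prod \<alpha> u powi i"
proof -
  have "(\<Prod>k<m. (f k :: ambient) powi i) = (\<Prod>k<m. f k) powi i" for f and m :: nat
    by (induction m) (simp_all add: power_int_mult_distrib)
  thus "aut \<alpha> \<Longrightarrow> u \<in> L \<Longrightarrow> orbit_prod \<alpha> (u powi i) = orbit_prod \<alpha> u powi i"
    by (simp add: orbit_prod_def lhom_power_int[OF autD(1)[OF aut_funpow]])
qed

lemma scale_norm:
  assumes \<alpha>: "aut \<alpha>" and u: "u \<in> U" and N: "orbit_prod \<alpha> u = const d" "d \<noteq> 0"
  obtains c where "c \<noteq> 0" "orbit_prod \<alpha> (const c * u) = 1"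
proof -
  obtain c where c: "c ^ n = inverse d" using nth_root_exists[OF n_pos] by blast
  have "c \<noteq> 0" using c N n_pos by (auto simp: power_0_left)
  moreover have "orbit_prod \<alpha> (const c * u) = const (c ^ n * d)"
    using u N by (simp only: orbit_prod_mult[OF \<alpha> fermat_field.const U_L] orbit_prod_const[OF \<alpha>] const.hom_mult)
  ultimately show ?thesis using that[of c] c N by simp
qed

text \<open>The norm has order n * 0 on the family a and the vanishing period sums on b and c, so it
  is a constant, and an n-th root of its inverse rescales u to norm 1.\<close>

lemma normalize_sigma:
  assumes u: "u \<in> U" "\<And>j. va u j = 0" "S (vb u) = 0" "S (vc u) = 0"
  obtains c where "c \<noteq> 0" "orbit_prod sigma (const c * u) = 1"
proof -
  have U': "orbit_prod sigma u \<in> U" unfolding orbit_prod_def by (intro U_prod v_sigma_funpow u)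
  have per: "vb u (j + int n) = vb u j" "vc u (j + int n) = vc u j" for j
    using cusps_periodic[of j 1] by simp_all
  obtain d where d: "d \<noteq> 0" "orbit_prod sigma u = const d"
    by (rule unit_const[OF U'])
      (use u per in \<open>simp_all add: orbit_prod_val[OF sigma(1) U_L[OF u(1)] U_nz[OF u(1)]] v_sigma_funpow sum_periodic_shift[of "vb u"] sum_periodic_shift[of "vc u"]\<close>)
  show ?thesis by (rule scale_norm[OF sigma(1) u(1) d(2,1)], rule that)
qed

lemma normalize_tau:
  assumes u: "u \<in> U" "\<And>j. vb u j = 0" "S (va u) = 0" "S (vc u) = 0"
  obtains c where "c \<noteq> 0" "orbit_prod tau (const c * u) = 1"
proof -
  have "swp u \<in> U" using u by simp
  have U': "orbit_prod tau u \<in> U" unfolding orbit_prod_def by (intro U_prod v_tau_funpow u)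
  have per: "va u (j + int n) = va u j" "vc u (j + int n) = vc u j" for j
    using cusps_periodic[of j 1] by simp_all
  have "(\<Sum>k<n. vc u (j - int k)) = 0" for j
  proof -
    have "(\<Sum>k<n. vc u (j - int k)) = (\<Sum>k<n. vc u (j - int (n - Suc k)))"
      by (rule sum.nat_diff_reindex[symmetric])
    also have "\<dots> = (\<Sum>k<n. vc u (j - int (n - 1) + int k))"
    proof (intro sum.cong refl)
      fix k assume "k \<in> {..<n}"
      hence "j - int (n - Suc k) = j - int (n - 1) + int k" by (auto simp: of_nat_diff)
      thus "vc u (j - int (n - Suc k)) = vc u (j - int (n - 1) + int k)" by (simp only:)
    qed
    also have "\<dots> = 0" using u(4) per by (simp add: sum_periodic_shift[of "vc u"])
    finally show ?thesis .
  qed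
  note c0 = this
  obtain d where d: "d \<noteq> 0" "orbit_prod tau u = const d"
    by (rule unit_const[OF U'])
      (use u per c0 in \<open>simp_all add: orbit_prod_val[OF tau(1) U_L[OF u(1)] U_nz[OF u(1)]] v_tau_funpow sum_periodic_shift[of "va u"]\<close>)
  show ?thesis by (rule scale_norm[OF tau(1) u(1) d(2,1)], rule that)
qed

lemma orbit_prod_sigma_tau: "u \<in> L \<Longrightarrow> orbit_prod sigma (tau u) = tau (orbit_prod sigma u)"
proof -
  assume u: "u \<in> L"
  have "(sigma ^^ k) (tau u) = tau ((sigma ^^ k) u)" for k
    by (induction k) (use u autD(3)[OF aut_funpow[OF sigma(1)]] in \<open>simp_all add: sigma_tau\<close>)
  thus ?thesis using u autD(3)[OF aut_funpow[OF sigma(1)]]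
    by (simp add: orbit_prod_def lhom_prod[OF autD(1)[OF tau(1)]])
qed

lemma orbit_prod_sigma_sigma: "u \<in> L \<Longrightarrow> orbit_prod sigma (sigma u) = orbit_prod sigma u"
proof -
  assume u: "u \<in> L"
  have "orbit_prod sigma (sigma u) = sigma (orbit_prod sigma u)"
    using u autD(3)[OF aut_funpow[OF sigma(1)]]
    by (simp add: orbit_prod_def lhom_prod[OF autD(1)[OF sigma(1)]] funpow_swap1)
  thus ?thesis using orbit_prod_invariant[OF sigma(1) sigma_n u] by simp
qed

text \<open>
  Divisors are integrated along the orbits of the two automorphisms. The obstruction is a root of
  unity, absorbed by a power of \<open>x / (y - 1)\<close>, which accounts for the constant \<open>k\<close>.
\<close>
lemma principal_integrate:
  assumes e: "principal (\<lambda>_. 0) q r" "S q = 0" "S r = 0"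
    and e': "principal p' (\<lambda>_. 0) r'" "S p' = 0" "S r' = 0"
    and compat: "\<And>j. r' (j + 1) - r' j = r (j - 1) - r j"
  obtains p2 q2 r2 k where "principal p2 q2 r2" "\<And>j. int n dvd p2 (j + 1) - p2 j - p' j - k"
    "\<And>j. q2 (j + 1) - q2 j = q j" "\<And>j. r2 (j + 1) - r2 j = r j"
proof -
  note ls = lhom_simps[OF autD(1)[OF sigma(1)]] and lt = lhom_simps[OF autD(1)[OF tau(1)]]
  obtain u where u: "u \<in> U" "\<And>j. va u j = 0" "\<And>j. vb u j = q j" "\<And>j. vc u j = r j"
    by (rule principalE[OF e(1)], rule that)
  have uS: "S (vb u) = 0" "S (vc u) = 0" using u e by simp_all
  obtain c where c: "c \<noteq> 0" "orbit_prod sigma (const c * u) = 1"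
    by (rule normalize_sigma[OF u(1,2) uS], rule that)
  define eu where "eu = const c * u"
  have eu: "eu \<in> U" "\<And>j. va eu j = 0" "\<And>j. vb eu j = q j" "\<And>j. vc eu j = r j" "orbit_prod sigma eu = 1"
    using u c by (simp_all add: eu_def v_U val_const)
  obtain w where w: "w \<in> U" "\<And>j. va w j = p' j" "\<And>j. vb w j = 0" "\<And>j. vc w j = r' j"
    by (rule principalE[OF e'(1)], rule that)
  have wS: "S (va w) = 0" "S (vc w) = 0" using w e' by simp_all
  obtain c' where c': "c' \<noteq> 0" "orbit_prod tau (const c' * w) = 1"
    by (rule normalize_tau[OF w(1,3) wS], rule that)
  define eu' where "eu' = const c' * w"
  have eu': "eu' \<in> U" "\<And>j. va eu' j = p' j" "\<And>j. vb eu' j = 0" "\<And>j. vc eu' j = r' j" "orbit_prod tau eu' = 1"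
    using w c' by (simp_all add: eu'_def v_U val_const)
  \<comment> \<open>This unit is supported on the family a with orders of sum 0 over a period, so it
    can be scaled to norm 1 for \<open>tau\<close>, while \<open>sigma\<close> multiplies it by
    \<zeta>.\<close>
  let ?w0 = "gen_x / (y - const (\<zeta> powi 0))"
  have w0: "?w0 \<in> U" "\<And>j. va ?w0 j = 1 - (if int n dvd j then int n else 0)" "\<And>j. vb ?w0 j = 0" "\<And>j. vc ?w0 j = 0"
    using U_gen_y_minus[of 0] by (simp_all add: v_U v_gen_x v_gen_y_minus del: power_int_0_right)
  have "S (va ?w0) = int n - (\<Sum>k<n. if k = 0 then int n else 0)"
  proof -
    have "(\<Sum>k<n. if int n dvd int k then int n else 0) = (\<Sum>k<n. if k = 0 then int n else 0)"
      by (intro sum.cong refl) (auto dest: dvd_imp_le)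
    thus ?thesis by (simp add: w0 sum_subtractf del: power_int_0_right)
  qed
  also have "\<dots> = 0" using n_pos by simp
  finally have "S (va ?w0) = 0" .
  moreover have "S (vc ?w0) = 0" by (simp only: w0 sum.neutral_const)
  ultimately have "\<exists>c0. c0 \<noteq> 0 \<and> orbit_prod tau (const c0 * ?w0) = 1"
    using normalize_tau[OF w0(1,3)] by blast
  then obtain c0 where c0: "c0 \<noteq> 0" "orbit_prod tau (const c0 * ?w0) = 1" by blast
  define W where "W = const c0 * ?w0"
  have W: "W \<in> U" "\<And>j. va W j = 1 - (if int n dvd j then int n else 0)" "\<And>j. vb W j = 0" "\<And>j. vc W j = 0"
      "orbit_prod tau W = 1"
    using w0 c0 by (simp_all add: W_def v_U val_const del: power_int_0_right)
  have sW: "sigma W = const \<zeta> * W"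
    using gen_y_not_const by (simp add: W_def ls sigma autD(2)[OF sigma(1)])
  \<comment> \<open>The defect of compatibility. By the hypothesis relating r and r' its divisor is
    0, so it is a constant.\<close>
  define \<rho> where "\<rho> = (tau eu * eu') / (eu * sigma eu')"
  have rU: "\<rho> \<in> U" using eu eu' by (simp add: \<rho>_def)
  obtain \<kappa> where \<kappa>: "\<kappa> \<noteq> 0" "\<rho> = const \<kappa>"
  proof (rule unit_const[OF rU])
    show "va \<rho> j = 0" "vb \<rho> j = 0" for j
      using eu eu' by (simp_all add: \<rho>_def v_U v_sigma v_tau U_nz)
    show "vc \<rho> j = 0" for j
      using eu eu' compat[of j] by (simp add: \<rho>_def v_U v_sigma v_tau U_nz)
  qed (rule that)
  have eq: "tau eu * eu' = const \<kappa> * (eu * sigma eu')"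
    using \<kappa> eu eu' U_nz[OF eu(1)] U_nz[OF U_sigma[OF eu'(1)]] by (simp add: \<rho>_def field_simps)
  \<comment> \<open>In the norm along \<open>sigma\<close> the factors eu and \<open>tau eu\<close>
    become 1, and eu' and its image under \<open>sigma\<close> have equal norms; what remains is
    \<kappa>^n = 1.\<close>
  have "orbit_prod sigma (tau eu * eu') = orbit_prod sigma (const \<kappa> * (eu * sigma eu'))" by (simp only: eq)
  hence "orbit_prod sigma eu' = const (\<kappa> ^ n) * orbit_prod sigma eu'"
    using eu eu' sigma(1) autD(3)[OF sigma(1)] autD(3)[OF tau(1)]
    by (simp add: orbit_prod_mult orbit_prod_const orbit_prod_sigma_tau orbit_prod_sigma_sigma lt)
  hence "const (\<kappa> ^ n) = const 1"
    using eu' U_nz[OF eu'(1)] sigma(1) by simp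
  hence "\<kappa> ^ n = 1" by (simp only: const_eq_iff)
  then obtain k where k: "\<kappa> = \<zeta> powi k" by (rule root_of_unity)
  have "sigma (W powi k) = const \<kappa> * W powi k"
    using W by (simp add: ls sW power_int_mult_distrib k const_power_int)
  hence compat': "tau eu * (eu' * W powi k) = eu * sigma (eu' * W powi k)"
    using eu' W eq by (simp add: ls ac_simps)
  have norm': "orbit_prod tau (eu' * W powi k) = 1"
    using eu' W tau(1) by (simp add: orbit_prod_mult orbit_prod_power_int)
  obtain f where f: "f \<in> U" "sigma f = eu * f" "tau f = eu' * W powi k * f"
    by (rule hilbert90_units[OF eu(1,5) _ norm' compat']) (use eu' W in auto)
  have "principal (va f) (vb f) (vc f)" using f(1) by (intro principalI[of f]) auto
  moreover have "int n dvd va f (j + 1) - va f j - p' j - k" for j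
  proof -
    have "va f (j + 1) = va (tau f) j" using f(1) U_nz by (simp add: v_tau)
    also have "\<dots> = p' j + k * va W j + va f j" using f(1) eu' W by (simp add: f(3) v_U)
    finally have "va f (j + 1) - va f j - p' j - k = k * - (if int n dvd j then int n else 0)"
      by (simp add: W(2) algebra_simps)
    thus ?thesis by simp
  qed
  moreover have "vb f (j + 1) - vb f j = q j" for j
  proof -
    have "vb f (j + 1) = vb (sigma f) j" using f(1) U_nz by (simp add: v_sigma)
    thus ?thesis using f(1) eu by (simp add: f(2) v_U)
  qed
  moreover have "vc f (j + 1) - vc f j = r j" for j
  proof -
    have "vc f (j + 1) = vc (sigma f) j" using f(1) U_nz by (simp add: v_sigma)
    thus ?thesis using f(1) eu by (simp add: f(2) v_U)
  qed
  ultimately show ?thesis by (rule that)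
qed

subsection \<open>Principal divisors modulo \<open>n\<close>\<close>

definition slope :: "(int \<Rightarrow> int) \<Rightarrow> int \<Rightarrow> bool" where
  "slope f a \<longleftrightarrow> (\<forall>j. int n dvd f (j + 1) - f j - a)"

lemma slopeD: "slope f a \<Longrightarrow> int n dvd f (j + 1) - f j - a"
  by (simp add: slope_def)

lemma slope_add: "slope f a \<Longrightarrow> slope g b \<Longrightarrow> slope (\<lambda>j. f j + g j) (a + b)"
  unfolding slope_def
proof (intro allI)
  fix j assume "\<forall>j. int n dvd f (j + 1) - f j - a" "\<forall>j. int n dvd g (j + 1) - g j - b"
  hence "int n dvd (f (j + 1) - f j - a) + (g (j + 1) - g j - b)" by (intro dvd_add) auto
  thus "int n dvd f (j + 1) + g (j + 1) - (f j + g j) - (a + b)" by (simp add: algebra_simps)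
qed

lemma slope_cmult: "slope f a \<Longrightarrow> slope (\<lambda>j. k * f j) (k * a)"
  unfolding slope_def
proof (intro allI)
  fix j assume "\<forall>j. int n dvd f (j + 1) - f j - a"
  hence "int n dvd k * (f (j + 1) - f j - a)" by (intro dvd_mult) auto
  thus "int n dvd k * f (j + 1) - k * f j - k * a" by (simp add: algebra_simps)
qed

lemma slope_reflect: "slope f a \<Longrightarrow> slope (\<lambda>j. f (c - j)) (- a)"
  unfolding slope_def
proof (intro allI)
  fix j assume "\<forall>j. int n dvd f (j + 1) - f j - a"
  hence "int n dvd - (f (c - j - 1 + 1) - f (c - j - 1) - a)" by (subst dvd_minus_iff) blast
  thus "int n dvd f (c - (j + 1)) - f (c - j) - - a" by (simp add: algebra_simps)
qed

lemma slope_shift: "slope f a \<Longrightarrow> slope (\<lambda>j. f (j + c)) a"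
  unfolding slope_def by (metis add.assoc add.commute)

lemma slope_const: "slope (\<lambda>_. c) 0"
  by (simp add: slope_def)

lemma slope_multiple: "(\<And>j. int n dvd f j) \<Longrightarrow> slope f 0"
  by (simp add: slope_def)

lemma slope_cong: "slope f a \<Longrightarrow> int n dvd a - b \<Longrightarrow> slope f b"
  unfolding slope_def
proof (intro allI)
  fix j assume "\<forall>j. int n dvd f (j + 1) - f j - a" "int n dvd a - b"
  hence "int n dvd (f (j + 1) - f j - a) + (a - b)" by (intro dvd_add) auto
  thus "int n dvd f (j + 1) - f j - b" by (simp add: algebra_simps)
qed

lemma slope_eq:
  assumes "slope f a"
  shows "int n dvd f j - f 0 - a * j"
proof (induction j rule: int_induct[where k = 0])
  case (step1 i)
  have "int n dvd (f i - f 0 - a * i) + (f (i + 1) - f i - a)"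
    by (rule dvd_add[OF step1(2) slopeD[OF assms]])
  thus ?case by (simp add: algebra_simps)
next
  case (step2 i)
  have "int n dvd (f i - f 0 - a * i) - (f (i - 1 + 1) - f (i - 1) - a)"
    by (rule dvd_diff[OF step2(2) slopeD[OF assms]])
  thus ?case by (simp add: algebra_simps)
qed simp

definition periodic :: "(int \<Rightarrow> int) \<Rightarrow> bool" where
  "periodic f \<longleftrightarrow> (\<forall>j. f (j + int n) = f j)"

lemma periodic_eq:
  assumes "periodic f" "int n dvd i - j"
  shows "f i = f j"
proof -
  have *: "f (j + int n * k) = f j" for j k
  proof (induction k rule: int_induct[where k = 0])
    case (step1 i)
    thus ?case using assms(1) unfolding periodic_def by (metis add.assoc distrib_left mult.right_neutral)
  next
    case (step2 i)
    have "f (j + int n * (i - 1)) = f (j + int n * (i - 1) + int n)" using assms(1) by (simp add: periodic_def)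
    thus ?case using step2 by (simp add: algebra_simps)
  qed simp
  obtain k where "i - j = int n * k" using assms(2) by blast
  hence "i = j + int n * k" by simp
  thus ?thesis using * by simp
qed

lemma periodic_add: "periodic f \<Longrightarrow> periodic g \<Longrightarrow> periodic (\<lambda>j. f j + g j)"
  and periodic_cmult: "periodic f \<Longrightarrow> periodic (\<lambda>j. k * f j)"
  and periodic_const: "periodic (\<lambda>_. c)"
  by (simp_all add: periodic_def)

lemma principal_periodic': 
  assumes "principal p q r" shows "periodic p" "periodic q" "periodic r"
  using principal_periodic[OF assms, of _ 1] by (simp_all add: periodic_def)

definition sum_zero :: "(int \<Rightarrow> int) \<Rightarrow> (int \<Rightarrow> int) \<Rightarrow> (int \<Rightarrow> int) \<Rightarrow> bool" where
  "sum_zero p q r \<longleftrightarrow> periodic p \<and> periodic q \<and> periodic r \<and> S p + S q + S r = 0"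

lemma principal_sum_zero: "principal p q r \<Longrightarrow> sum_zero p q r"
  using principal_periodic' principal_degree by (simp add: sum_zero_def)

lemma sum_zero_add: "sum_zero p q r \<Longrightarrow> sum_zero p' q' r' \<Longrightarrow> sum_zero (\<lambda>j. p j + p' j) (\<lambda>j. q j + q' j) (\<lambda>j. r j + r' j)"
  by (simp add: sum_zero_def periodic_add sum.distrib)

lemma sum_zero_cmult: "sum_zero p q r \<Longrightarrow> sum_zero (\<lambda>j. k * p j) (\<lambda>j. k * q j) (\<lambda>j. k * r j)"
  by (simp add: sum_zero_def periodic_cmult sum_distrib_left[symmetric] distrib_left[symmetric])

text \<open>Take the product of the (y - \<zeta>^k)^(p(k)/n); its poles are spread evenly over the
  family c.\<close>

lemma principal_multiple_a:
  assumes "periodic p" "\<And>j. int n dvd p j"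
  shows "\<exists>s. principal p (\<lambda>_. 0) (\<lambda>_. s) \<and> int n * s = - S p"
proof -
  define p' where "p' = (\<lambda>j. p j div int n)"
  have p': "p j = int n * p' j" for j using assms(2)[of j] by (simp add: p'_def)
  have "principal (\<lambda>j. \<Sum>k<n. p' (int k) * (if int n dvd j - int k then int n else 0))
      (\<lambda>j. \<Sum>k<n. p' (int k) * 0) (\<lambda>j. \<Sum>k<n. p' (int k) * - 1)"
    by (intro principal_sum principal_cmult principal_y_minus)
  moreover have "(\<Sum>k<n. p' (int k) * (if int n dvd j - int k then int n else 0)) = p j" for j
  proof -
    define l where "l = nat (j mod int n)"
    have l: "l < n" "int l = j mod int n" using n_pos by (simp_all add: l_def nat_less_iff)
    have ld: "int n dvd j - int l" using l by (simp add: mod_eq_dvd_iff[symmetric])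
    have "int n dvd j - int k \<longleftrightarrow> k = l" if "k < n" for k
    proof
      assume "int n dvd j - int k"
      hence "j mod int n = int k mod int n" by (simp add: mod_eq_dvd_iff)
      thus "k = l" using l that by simp
    qed (use ld in simp)
    hence "(\<Sum>k<n. p' (int k) * (if int n dvd j - int k then int n else 0)) = (\<Sum>k<n. if k = l then p (int k) else 0)"
      by (intro sum.cong refl) (auto simp: p')
    also have "\<dots> = p (int l)" using l by simp
    also have "\<dots> = p j" using periodic_eq[OF assms(1) ld] by simp
    finally show ?thesis .
  qed
  ultimately have "principal p (\<lambda>_. 0) (\<lambda>_. - S p')" by (simp add: sum_negf)
  moreover have "int n * - S p' = - S p" by (simp add: p' sum_distrib_left)
  ultimately show ?thesis by blast
qed

lemma principal_multiple:
  assumes sz: "sum_zero p q r" and d: "\<And>j. int n dvd p j" "\<And>j. int n dvd q j" "\<And>j. int n dvd r j"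
  shows "principal p q r"
proof -
  have per: "periodic p" "periodic q" "periodic r" using sz by (auto simp: sum_zero_def)
  obtain s where s: "principal p (\<lambda>_. 0) (\<lambda>_. s)" "int n * s = - S p"
    using principal_multiple_a[OF per(1) d(1)] by blast
  obtain s' where s': "principal q (\<lambda>_. 0) (\<lambda>_. s')" "int n * s' = - S q"
    using principal_multiple_a[OF per(2) d(2)] by blast
  have "r (- (j + int n) - twist) = r (- j - twist)" for j by (rule periodic_eq[OF per(3)]) simp
  hence "periodic (\<lambda>j. r (- j - twist))" by (simp add: periodic_def)
  then obtain s'' where s'': "principal (\<lambda>j. r (- j - twist)) (\<lambda>_. 0) (\<lambda>_. s'')"
    using principal_multiple_a[of "\<lambda>j. r (- j - twist)"] d(3) by blast
  have 3: "principal (\<lambda>_. s'') (\<lambda>_. 0) r" using principal_kap[OF s''] by simp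
  have e3: "int n * s'' = - S r" using principal_degree[OF 3] by simp
  \<comment> \<open>The three families are realised separately, leaving constants s and s' on c and
    s'' on a. The latter is moved to c by a power of x, and degree 0 makes the total vanish.\<close>
  have "int n * (s + s' + s'') = 0" using s s' e3 sz by (simp add: sum_zero_def distrib_left)
  hence z: "s + s' + s'' = 0" using n_pos by simp
  have "principal (\<lambda>j. p j + (0 + (s'' + - s'' * 1))) (\<lambda>j. 0 + (q j + (0 + - s'' * 0))) (\<lambda>j. s + (s' + (r j + - s'' * - 1)))"
    by (intro principal_add principal_cmult s(1) 3 principal_x) (use principal_swp[OF s'(1)] in simp)
  moreover have "(\<lambda>j. s + (s' + (r j + - s'' * - 1))) = r"
  proof
    fix j
    have "s + (s' + (r j + - s'' * - 1)) = r j + (s + s' + s'')" by simp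
    thus "s + (s' + (r j + - s'' * - 1)) = r j" by (simp only: z add_0_right)
  qed
  ultimately show ?thesis by simp
qed

lemma principal_cong:
  assumes "principal p q r" "sum_zero p' q' r'"
    "\<And>j. int n dvd p' j - p j" "\<And>j. int n dvd q' j - q j" "\<And>j. int n dvd r' j - r j"
  shows "principal p' q' r'"
proof -
  have "sum_zero (\<lambda>j. p' j + -1 * p j) (\<lambda>j. q' j + -1 * q j) (\<lambda>j. r' j + -1 * r j)"
    by (intro sum_zero_add sum_zero_cmult assms(2) principal_sum_zero[OF assms(1)])
  hence "principal (\<lambda>j. p' j + -1 * p j) (\<lambda>j. q' j + -1 * q j) (\<lambda>j. r' j + -1 * r j)"
    by (rule principal_multiple) (use assms(3-5) in simp_all)
  from principal_add[OF this assms(1)] show ?thesis by simp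
qed

lemma principal_slope_0:
  assumes sz: "sum_zero p q r" and "slope p 0" "slope q 0" "slope r 0"
  shows "principal p q r"
proof -
  \<comment> \<open>The unit x^p(0) y^q(0) has order -p(0) - q(0) on c. The power -(p(0) + q(0) +
    r(0)) of y - 1 raises it to r(0) and alters the family a by multiples of n only.\<close>
  let ?c = "p 0 + q 0 + r 0"
  have "principal (\<lambda>j. p 0 * 1 + (q 0 * 0 + - ?c * (if int n dvd j - 0 then int n else 0)))
      (\<lambda>j. p 0 * 0 + (q 0 * 1 + - ?c * 0)) (\<lambda>j. p 0 * - 1 + (q 0 * - 1 + - ?c * - 1))"
    by (intro principal_add principal_cmult principal_x principal_y principal_y_minus)
  thus ?thesis
  proof (rule principal_cong[OF _ sz])
    fix j
    have "int n dvd (p j - p 0 - 0 * j) + ?c * (if int n dvd j - 0 then int n else 0)"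
      by (intro dvd_add slope_eq assms dvd_mult) simp
    thus "int n dvd p j - (p 0 * 1 + (q 0 * 0 + - ?c * (if int n dvd j - 0 then int n else 0)))"
      by (simp add: algebra_simps)
    show "int n dvd q j - (p 0 * 0 + (q 0 * 1 + - ?c * 0))" using slope_eq[OF assms(3), of j] by simp
    show "int n dvd r j - (p 0 * - 1 + (q 0 * - 1 + - ?c * - 1))" using slope_eq[OF assms(4), of j]
      by (simp add: algebra_simps)
  qed
qed

lemma principal_slopes_110: "\<exists>p q r. principal p q r \<and> slope p 1 \<and> slope q 1 \<and> slope r 0"
proof -
  note ls = lhom_simps[OF autD(1)[OF sigma(1)]] and lt = lhom_simps[OF autD(1)[OF tau(1)]]
  let ?v = "y - const (\<zeta> powi 0)"
  let ?u = "swp ?v"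
  note yU = U_gen_y_minus[of 0]
  have u: "?u = gen_x - 1" using yU by (simp add: lhom_simps[OF autD(1)[OF swp(1)]] swp)
  have uU: "?u \<in> U" using yU by (rule U_swp)
  have e: "?u / y \<in> U" "\<And>j. va (?u / y) j = 0" "\<And>j. vb (?u / y) j = (if int n dvd j then int n else 0) - 1"
    "\<And>j. vc (?u / y) j = 0"
    using uU yU U_nz[OF yU] by (simp_all add: v_U v_gen_y v_swp v_gen_y_minus del: power_int_0_right)
  have e': "?v / gen_x \<in> U" "\<And>j. va (?v / gen_x) j = (if int n dvd j then int n else 0) - 1" "\<And>j. vb (?v / gen_x) j = 0"
    "\<And>j. vc (?v / gen_x) j = 0"
    using yU U_nz[OF yU] by (simp_all add: v_U v_gen_x v_gen_y_minus del: power_int_0_right)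
  have s0: "(\<Sum>k<n. (if int n dvd int k then int n else 0) - 1) = 0"
  proof -
    have "(\<Sum>k<n. if int n dvd int k then int n else 0) = (\<Sum>k<n. if k = 0 then int n else 0)"
      by (intro sum.cong refl) (auto dest: dvd_imp_le)
    thus ?thesis using n_pos by (simp add: sum_subtractf)
  qed
  have "\<exists>c. c \<noteq> 0 \<and> orbit_prod sigma (const c * (?u / y)) = 1"
    using normalize_sigma[OF e(1,2)] s0 e(3,4) by (simp del: power_int_0_right) blast
  then obtain c where c: "c \<noteq> 0" "orbit_prod sigma (const c * (?u / y)) = 1" by blast
  have "\<exists>c. c \<noteq> 0 \<and> orbit_prod tau (const c * (?v / gen_x)) = 1"
    using normalize_tau[OF e'(1,3)] s0 e'(2,4) by (simp del: power_int_0_right) blast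
  then obtain c' where c': "c' \<noteq> 0" "orbit_prod tau (const c' * (?v / gen_x)) = 1" by blast
  define eu eu' where "eu = const c * (?u / y)" and "eu' = const c' * (?v / gen_x)"
  have U': "eu \<in> U" "eu' \<in> U" unfolding eu_def eu'_def by (intro U_mult U_const c c' e e')+
  have "tau eu = eu / const \<zeta>" "sigma eu' = eu' / const \<zeta>"
    unfolding eu_def eu'_def u by (simp_all add: ls lt sigma tau autD(2)[OF sigma(1)] autD(2)[OF tau(1)])
  hence compat: "tau eu * eu' = eu * sigma eu'" by simp
  have ve: "vb eu j = (if int n dvd j then int n else 0) - 1" "vc eu j = 0"
    "va eu' j = (if int n dvd j then int n else 0) - 1" for j
    unfolding eu_def eu'_def
    by (simp_all only: v_U(1)[OF _ U_const[OF c(1)] e(1)] v_U(1)[OF _ U_const[OF c'(1)] e'(1)] cusps_on_curve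
        val_const[OF _ c(1)] val_const[OF _ c'(1)] e e' add_0)
  have nm: "orbit_prod sigma eu = 1" "orbit_prod tau eu' = 1"
    unfolding eu_def eu'_def by (rule c(2), rule c'(2))
  obtain f where f: "f \<in> U" "sigma f = eu * f" "tau f = eu' * f"
    by (rule hilbert90_units[OF U'(1) nm(1) U'(2) nm(2) compat], rule that)
  have "slope (va f) (-1)" unfolding slope_def
  proof
    fix j
    have "va f (j + 1) = va (tau f) j" using f(1) U_nz by (simp add: v_tau)
    also have "\<dots> = (if int n dvd j then int n else 0) - 1 + va f j"
      using f(1) U' by (simp add: f(3) v_U ve)
    finally show "int n dvd va f (j + 1) - va f j - - 1" by simp
  qed
  moreover have "slope (vb f) (-1)" unfolding slope_def
  proof
    fix j
    have "vb f (j + 1) = vb (sigma f) j" using f(1) U_nz by (simp add: v_sigma)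
    also have "\<dots> = (if int n dvd j then int n else 0) - 1 + vb f j"
      using f(1) U' by (simp add: f(2) v_U ve)
    finally show "int n dvd vb f (j + 1) - vb f j - - 1" by simp
  qed
  moreover have "slope (vc f) 0" unfolding slope_def
  proof
    fix j
    have "vc f (j + 1) = vc (sigma f) j" using f(1) U_nz by (simp add: v_sigma)
    also have "\<dots> = vc f j"
      using f(1) U' by (simp add: f(2) v_U ve)
    finally show "int n dvd vc f (j + 1) - vc f j - 0" by simp
  qed
  moreover have "principal (va f) (vb f) (vc f)" using f(1) by (intro principalI[of f]) auto
  ultimately obtain p q r where h: "principal p q r" "slope p (-1)" "slope q (-1)" "slope r 0" by blast
  show ?thesis
    using principal_cmult[OF h(1), of "-1"] slope_cmult[OF h(2), of "-1"] slope_cmult[OF h(3), of "-1"]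
      slope_cmult[OF h(4), of "-1"]
    by - (rule exI[of _ "\<lambda>j. - p j"], rule exI[of _ "\<lambda>j. - q j"], rule exI[of _ "\<lambda>j. - r j"], simp)
qed

text \<open>Apply \<open>kap\<close>, which exchanges the families a and c and reverses all slopes,
  and invert.\<close>

lemma principal_slopes_011: "\<exists>p q r. principal p q r \<and> slope p 0 \<and> slope q 1 \<and> slope r 1"
proof -
  obtain p q r where h: "principal p q r" "slope p 1" "slope q 1" "slope r 0"
    using principal_slopes_110 by blast
  have "principal (\<lambda>j. -1 * r (0 - j)) (\<lambda>j. -1 * q (0 - j)) (\<lambda>j. -1 * p (- twist - j))"
  proof -
    have "- twist - j = - j - twist" for j by simp
    thus ?thesis using principal_cmult[OF principal_kap[OF h(1)], of "-1"] by (simp only: diff_0)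
  qed
  moreover have "slope (\<lambda>j. -1 * r (0 - j)) 0" "slope (\<lambda>j. -1 * q (0 - j)) 1" "slope (\<lambda>j. -1 * p (- twist - j)) 1"
    using slope_cmult[OF slope_reflect[OF h(4), of 0], of "-1"] slope_cmult[OF slope_reflect[OF h(3), of 0], of "-1"]
      slope_cmult[OF slope_reflect[OF h(2), of "- twist"], of "-1"] by simp_all
  ultimately show ?thesis by blast
qed

lemma slope_residual:
  assumes "principal p q r" "slope p \<alpha>" "slope q \<beta>" "slope r \<gamma>"
  shows "\<exists>p' q' r'. principal p' q' r' \<and> slope p' \<alpha> \<and> slope q' (\<alpha> + \<gamma>) \<and> slope r' \<gamma>"
proof -
  obtain p1 q1 r1 where 1: "principal p1 q1 r1" "slope p1 1" "slope q1 1" "slope r1 0"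
    using principal_slopes_110 by blast
  obtain p2 q2 r2 where 2: "principal p2 q2 r2" "slope p2 0" "slope q2 1" "slope r2 1"
    using principal_slopes_011 by blast
  have "principal (\<lambda>j. \<alpha> * p1 j + \<gamma> * p2 j) (\<lambda>j. \<alpha> * q1 j + \<gamma> * q2 j) (\<lambda>j. \<alpha> * r1 j + \<gamma> * r2 j)"
    by (intro principal_add principal_cmult 1 2)
  moreover have "slope (\<lambda>j. \<alpha> * p1 j + \<gamma> * p2 j) (\<alpha> * 1 + \<gamma> * 0)" "slope (\<lambda>j. \<alpha> * q1 j + \<gamma> * q2 j) (\<alpha> * 1 + \<gamma> * 1)"
    "slope (\<lambda>j. \<alpha> * r1 j + \<gamma> * r2 j) (\<alpha> * 0 + \<gamma> * 1)"
    by (intro slope_add slope_cmult 1 2)+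
  ultimately show ?thesis by auto
qed

text \<open>Subtracting \<alpha> times a divisor with slopes (1, 1, 0) and \<gamma> times one with
  slopes (0, 1, 1) leaves slopes 0, \<beta> - \<alpha> - \<gamma>, 0; all vanish modulo n, so
  \<open>principal_slope_0\<close> applies.\<close>

lemma principal_affine:
  assumes sz: "sum_zero p q r" and sl: "slope p \<alpha>" "slope q \<beta>" "slope r \<gamma>"
    and rel: "int n dvd \<alpha> - \<beta> + \<gamma>"
  shows "principal p q r"
proof -
  obtain p1 q1 r1 where 1: "principal p1 q1 r1" "slope p1 1" "slope q1 1" "slope r1 0"
    using principal_slopes_110 by blast
  obtain p2 q2 r2 where 2: "principal p2 q2 r2" "slope p2 0" "slope q2 1" "slope r2 1"
    using principal_slopes_011 by blast
  define p0 q0 r0 where "p0 = (\<lambda>j. \<alpha> * p1 j + \<gamma> * p2 j)" and "q0 = (\<lambda>j. \<alpha> * q1 j + \<gamma> * q2 j)"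
    and "r0 = (\<lambda>j. \<alpha> * r1 j + \<gamma> * r2 j)"
  have 0: "principal p0 q0 r0" unfolding p0_def q0_def r0_def by (intro principal_add principal_cmult 1 2)
  have s0: "slope p0 (\<alpha> * 1 + \<gamma> * 0)" "slope q0 (\<alpha> * 1 + \<gamma> * 1)" "slope r0 (\<alpha> * 0 + \<gamma> * 1)"
    unfolding p0_def q0_def r0_def by (intro slope_add slope_cmult 1 2)+
  have sz': "sum_zero (\<lambda>j. p j + -1 * p0 j) (\<lambda>j. q j + -1 * q0 j) (\<lambda>j. r j + -1 * r0 j)"
    by (intro sum_zero_add sum_zero_cmult sz principal_sum_zero[OF 0])
  have "slope (\<lambda>j. p j + -1 * p0 j) (\<alpha> + -1 * (\<alpha> * 1 + \<gamma> * 0))"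
    "slope (\<lambda>j. q j + -1 * q0 j) (\<beta> + -1 * (\<alpha> * 1 + \<gamma> * 1))"
    "slope (\<lambda>j. r j + -1 * r0 j) (\<gamma> + -1 * (\<alpha> * 0 + \<gamma> * 1))"
    by (intro slope_add slope_cmult sl s0)+
  moreover have "int n dvd (\<beta> + -1 * (\<alpha> * 1 + \<gamma> * 1)) - 0"
    using rel by (subst dvd_minus_iff[symmetric]) (simp add: algebra_simps)
  ultimately have "slope (\<lambda>j. p j + -1 * p0 j) 0" "slope (\<lambda>j. q j + -1 * q0 j) 0" "slope (\<lambda>j. r j + -1 * r0 j) 0"
    using slope_cong by auto
  from principal_add[OF principal_slope_0[OF sz' this] 0] show ?thesis by simp
qed

lemma S_cong:
  assumes "\<And>j. int n dvd f j - g j"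
  shows "int n dvd S f - S g"
  unfolding sum_subtractf[symmetric] using assms by (intro dvd_sum) auto

lemma slope_0_S:
  assumes "slope f 0"
  shows "int n dvd S f"
proof -
  have "int n dvd (S f - S (\<lambda>_. f 0)) + int n * f 0"
    by (intro dvd_add S_cong) (use slope_eq[OF assms] in auto)
  thus ?thesis by simp
qed

lemma S_delta_at: "S (\<lambda>j. if int n dvd j - i then s else 0) = s"
proof -
  have "S (\<lambda>j. if int n dvd j - i then s else 0) = (\<Sum>k<n. if k = nat (i mod int n) then s else 0)"
  proof (intro sum.cong refl)
    fix k assume k: "k \<in> {..<n}"
    have "int n dvd int k - i \<longleftrightarrow> int k mod int n = i mod int n" by (simp add: mod_eq_dvd_iff)
    also have "\<dots> \<longleftrightarrow> k = nat (i mod int n)" using k n_pos by (auto simp: nat_eq_iff)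
    finally show "(if int n dvd int k - i then s else 0) = (if k = nat (i mod int n) then s else 0)" by simp
  qed
  also have "\<dots> = s" using n_pos by (simp add: nat_less_iff)
  finally show ?thesis .
qed

lemma S_delta: "S (\<lambda>j. if int n dvd j then s else 0) = s"
  using S_delta_at[of 0] by (simp only: diff_0_right)

text \<open>The same subtraction leaves a principal divisor whose only possible slope is \<beta> -
  \<alpha> - \<gamma> on b. A divisor with slopes 0 reduces it to one supported on b, and that is
  constant modulo n by \<open>principal_only_b\<close>.\<close>

lemma principal_slope_rel:
  assumes pr: "principal p q r" and sl: "slope p \<alpha>" "slope q \<beta>" "slope r \<gamma>"
  shows "int n dvd \<alpha> - \<beta> + \<gamma>"
proof -
  obtain p0 q0 r0 where 0: "principal p0 q0 r0" "slope p0 \<alpha>" "slope q0 (\<alpha> + \<gamma>)" "slope r0 \<gamma>"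
    using slope_residual[OF assms] by blast
  define p1 q1 r1 where d: "p1 = (\<lambda>j. p j + -1 * p0 j)" "q1 = (\<lambda>j. q j + -1 * q0 j)" "r1 = (\<lambda>j. r j + -1 * r0 j)"
  have 1: "principal p1 q1 r1" unfolding d by (intro principal_add principal_cmult pr 0)
  have "slope p1 (\<alpha> + -1 * \<alpha>)" "slope q1 (\<beta> + -1 * (\<alpha> + \<gamma>))" "slope r1 (\<gamma> + -1 * \<gamma>)"
    unfolding d by (intro slope_add slope_cmult sl 0)+
  hence s1: "slope p1 0" "slope q1 (\<beta> - \<alpha> - \<gamma>)" "slope r1 0" by (simp_all add: algebra_simps)
  have per: "periodic p1" "periodic q1" "periodic r1" using principal_periodic'[OF 1] by auto
  have deg: "S p1 + S q1 + S r1 = 0" by (rule principal_degree[OF 1])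
  define s where "s = S q1"
  have ns: "int n dvd s"
  proof -
    have "int n dvd S p1 + S r1" by (intro dvd_add slope_0_S s1)
    moreover have "s = - (S p1 + S r1)" using deg by (simp add: s_def)
    ultimately show ?thesis by (simp only: dvd_minus_iff)
  qed
  \<comment> \<open>Removing the sum s at index 0 gives period sum 0 and does not change q1 modulo
    n, since n divides s.\<close>
  define q2 where "q2 = (\<lambda>j. q1 j - (if int n dvd j then s else 0))"
  have pq2: "periodic q2" using per(2) by (simp add: periodic_def q2_def)
  have "S q2 = 0" using S_delta[of s] by (simp add: q2_def sum_subtractf s_def)
  hence "sum_zero (\<lambda>_. 0) q2 (\<lambda>_. 0)" using pq2 by (simp add: sum_zero_def periodic_const)
  hence sz: "sum_zero (\<lambda>j. 0 + -1 * p1 j) (\<lambda>j. q2 j + -1 * q1 j) (\<lambda>j. 0 + -1 * r1 j)"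
    by (intro sum_zero_add sum_zero_cmult principal_sum_zero[OF 1])
  have "principal (\<lambda>j. 0 + -1 * p1 j) (\<lambda>j. q2 j + -1 * q1 j) (\<lambda>j. 0 + -1 * r1 j)"
  proof (rule principal_slope_0[OF sz])
    show "slope (\<lambda>j. 0 + -1 * p1 j) 0" "slope (\<lambda>j. 0 + -1 * r1 j) 0"
      using slope_cmult[OF s1(1), of "-1"] slope_cmult[OF s1(3), of "-1"] by simp_all
    show "slope (\<lambda>j. q2 j + -1 * q1 j) 0" by (rule slope_multiple) (simp add: q2_def ns)
  qed
  from principal_add[OF this 1] have "principal (\<lambda>_. 0) q2 (\<lambda>_. 0)" by simp
  then obtain k where k: "\<And>j. int n dvd q2 j - k" by (elim principal_only_b) (rule that)
  have "int n dvd (q2 1 - k) - (q2 0 - k) - (q1 (0 + 1) - q1 0 - (\<beta> - \<alpha> - \<gamma>)) - s"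
    by (intro dvd_diff k slopeD[OF s1(2)] ns)
  also have "(q2 1 - k) - (q2 0 - k) - (q1 (0 + 1) - q1 0 - (\<beta> - \<alpha> - \<gamma>)) - s = - (\<alpha> - \<beta> + \<gamma>)"
    using n_ge by (simp add: q2_def)
  finally show ?thesis by (simp only: dvd_minus_iff)
qed

section \<open>Second differences and parity\<close>

lemma double_sum_n: "2 * (\<Sum>k<n. int k) = int n * (int n - 1)"
  by (induction n) (simp_all add: algebra_simps)

text \<open>The least positive multiplier that makes n(n-1)/2 divisible by n.\<close>

definition lead :: int where "lead = (if odd n then 1 else 2)"

text \<open>A periodic version of lead * j. The correction at multiples of n makes the period sum 0,
  and by the choice of \<open>lead\<close> it is itself divisible by n, so the slope
  survives.\<close>

definition lin :: "int \<Rightarrow> int" where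
  "lin j = lead * (j mod int n) - (if int n dvd j then lead * (\<Sum>k<n. int k) else 0)"

lemma lead_sum: "int n dvd lead * (\<Sum>k<n. int k)"
proof -
  show ?thesis
  proof (cases "odd n")
    case True
    then obtain m where "n = 2 * m + 1" by (rule oddE)
    hence "(\<Sum>k<n. int k) = int n * int m" using double_sum_n by simp
    thus ?thesis by simp
  qed (simp add: lead_def double_sum_n)
qed

lemma lin: "periodic lin" "S lin = 0" "slope lin lead"
proof -
  show "periodic lin" by (simp add: periodic_def lin_def)
  have "S lin = lead * S (\<lambda>j. j mod int n) - S (\<lambda>j. if int n dvd j then lead * (\<Sum>k<n. int k) else 0)"
    by (simp add: lin_def sum_subtractf sum_distrib_left)
  also have "S (\<lambda>j. j mod int n) = (\<Sum>k<n. int k)" by (intro sum.cong refl) simp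
  finally show "S lin = 0" by (simp only: S_delta diff_self)
  have m: "int n dvd lin j - lead * j" for j
  proof -
    have "lin j - lead * j = lead * (j mod int n - j) - (if int n dvd j then lead * (\<Sum>k<n. int k) else 0)"
      by (simp add: lin_def algebra_simps)
    moreover have "int n dvd j mod int n - j" by (simp add: mod_eq_dvd_iff[symmetric])
    moreover have "int n dvd (if int n dvd j then lead * (\<Sum>k<n. int k) else 0)" using lead_sum by simp
    ultimately show ?thesis by (simp only: dvd_diff dvd_mult)
  qed
  have "int n dvd (lin (j + 1) - lead * (j + 1)) - (lin j - lead * j)" for j by (intro dvd_diff m)
  thus "slope lin lead" by (simp add: slope_def algebra_simps)
qed

definition second_diff :: "(int \<Rightarrow> int) \<Rightarrow> int \<Rightarrow> bool" where
  "second_diff f c \<longleftrightarrow> slope (\<lambda>j. f (j + 1) - f j) c"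

lemma second_diff_slope: "second_diff f 0 \<Longrightarrow> slope f (f 1 - f 0)"
  unfolding slope_def
proof
  fix j assume "second_diff f 0"
  from slope_eq[OF this[unfolded second_diff_def], of j]
  show "int n dvd f (j + 1) - f j - (f 1 - f 0)" by simp
qed

text \<open>Integrate the divisors (0, lin, lin) and (lin, 0, -lin shifted by one). Both satisfy the
  slope relation, and the shift makes them compatible. The unknown constant k of the integration
  disappears in the second difference.\<close>

lemma principal_quadratic_exists:
  "\<exists>p q r. principal p q r \<and> second_diff p lead \<and> second_diff q lead \<and> second_diff r lead"
proof -
  have e: "principal (\<lambda>_. 0) lin lin"
    by (rule principal_affine[OF _ slope_const lin(3) lin(3)]) (use lin in \<open>auto simp: sum_zero_def periodic_const\<close>)
  define r' where "r' = (\<lambda>j. - lin (j - 1))"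
  have per: "periodic r'"
    unfolding periodic_def r'_def
  proof
    fix j
    show "- lin (j + int n - 1) = - lin (j - 1)" using periodic_eq[OF lin(1), of "j + int n - 1" "j - 1"] by simp
  qed
  have Sr': "S r' = 0"
    using sum_periodic_shift[of lin "-1"] lin(1,2) by (simp add: r'_def sum_negf periodic_def)
  have sl: "slope r' (- lead)"
    using slope_cmult[OF slope_shift[OF lin(3), of "-1"], of "-1"] by (simp add: r'_def)
  have e': "principal lin (\<lambda>_. 0) r'"
    by (rule principal_affine[OF _ lin(3) slope_const sl]) (use lin per Sr' in \<open>auto simp: sum_zero_def periodic_const\<close>)
  obtain p2 q2 r2 k where f: "principal p2 q2 r2" "\<And>j. int n dvd p2 (j + 1) - p2 j - lin j - k"
    "\<And>j. q2 (j + 1) - q2 j = lin j" "\<And>j. r2 (j + 1) - r2 j = lin j"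
    by (rule principal_integrate[OF e lin(2) lin(2) e' lin(2) Sr']) (simp add: r'_def, rule that)
  have "second_diff p2 lead"
    unfolding second_diff_def slope_def
  proof
    fix j
    have "int n dvd (p2 (j + 1 + 1) - p2 (j + 1) - lin (j + 1) - k) - (p2 (j + 1) - p2 j - lin j - k)
        + (lin (j + 1) - lin j - lead)"
      by (intro dvd_add dvd_diff f(2) slopeD[OF lin(3)])
    thus "int n dvd p2 (j + 1 + 1) - p2 (j + 1) - (p2 (j + 1) - p2 j) - lead" by (simp add: algebra_simps)
  qed
  moreover have "second_diff q2 lead" "second_diff r2 lead"
    using lin(3) unfolding second_diff_def f(3,4) by auto
  ultimately show ?thesis using f(1) by blast
qed

text \<open>Differencing along \<open>sigma\<close>, \<open>tau\<close> and their composite empties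
  one family each time. A further difference leaves one family, where the divisor is constant modulo
  n; these constants are the second differences, and the slope relation for the first differences
  identifies them.\<close>

lemma principal_second_diff:
  assumes "principal p q r"
  obtains c where "second_diff p c" "second_diff q c" "second_diff r c" "lead dvd c"
proof -
  have add_neg: "principal (\<lambda>j. f j + -1 * p j) (\<lambda>j. g j + -1 * q j) (\<lambda>j. h j + -1 * r j)"
    if "principal f g h" "principal p q r" for f g h p q r
    by (intro principal_add principal_cmult that)
  define dp dq dr where d: "dp = (\<lambda>j. p (j + 1) - p j)" "dq = (\<lambda>j. q (j + 1) - q j)" "dr = (\<lambda>j. r (j + 1) - r j)"
  have s: "principal (\<lambda>_. 0) dq dr"
    using add_neg[OF principal_sigma[OF assms] assms] by (simp add: d)
  have t: "principal dp (\<lambda>_. 0) (\<lambda>j. - dr (j - 1))"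
    using add_neg[OF principal_tau[OF assms] assms] by (simp add: d)
  have st: "principal dp dq (\<lambda>_. 0)"
    using add_neg[OF principal_sigma[OF principal_tau[OF assms]] assms] by (simp add: d)
  have "principal (\<lambda>_. 0) (\<lambda>_. 0) (\<lambda>j. dr (j - 1) - dr j)"
    using add_neg[OF principal_tau[OF s] s] by simp
  then obtain c3 where c3: "\<And>j. int n dvd dr (j - 1) - dr j - c3" by (elim principal_only_c) (rule that)
  have "principal (\<lambda>_. 0) (\<lambda>j. dq (j + 1) - dq j) (\<lambda>_. 0)"
    using add_neg[OF principal_sigma[OF st] st] by simp
  then obtain c2 where c2: "\<And>j. int n dvd dq (j + 1) - dq j - c2" by (elim principal_only_b) (rule that)
  have "principal (\<lambda>j. dp (j + 1) - dp j) (\<lambda>_. 0) (\<lambda>_. 0)"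
    using add_neg[OF principal_tau[OF st] st] by simp
  then obtain c1 where c1: "\<And>j. int n dvd dp (j + 1) - dp j - c1" by (elim principal_only_a) (rule that)
  have sl: "slope dp c1" "slope dq c2" using c1 c2 by (simp_all add: slope_def)
  have sl3: "slope dr (- c3)" unfolding slope_def
  proof
    fix j
    have "int n dvd - (dr (j + 1 - 1) - dr (j + 1) - c3)" using c3[of "j + 1"] by (simp only: dvd_minus_iff)
    thus "int n dvd dr (j + 1) - dr j - - c3" by (simp add: algebra_simps)
  qed
  have sl3': "slope (\<lambda>j. - dr (j - 1)) c3"
    using slope_cmult[OF slope_shift[OF sl3, of "-1"], of "-1"] by simp
  have r1: "int n dvd 0 - c2 + - c3" by (rule principal_slope_rel[OF s slope_const sl(2) sl3])
  have r2: "int n dvd c1 - 0 + c3" by (rule principal_slope_rel[OF t sl(1) slope_const sl3'])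
  have "int n dvd (0 - c2 + - c3) + (c1 - 0 + c3)" by (rule dvd_add[OF r1 r2])
  hence "int n dvd c1 - c2" by simp
  hence "int n dvd - (c1 - c2)" by (simp only: dvd_minus_iff)
  hence 2: "slope dq c1" using slope_cong[OF sl(2), of c1] by simp
  have "int n dvd - (c1 - 0 + c3)" using r2 by (simp only: dvd_minus_iff)
  moreover have "- (c1 - 0 + c3) = - c3 - c1" by simp
  ultimately have "int n dvd - c3 - c1" by (simp only:)
  hence 3: "slope dr c1" by (rule slope_cong[OF sl3])
  \<comment> \<open>Over a period the first differences telescope to 0, yet they are congruent to an
    arithmetic progression with step c1. So n divides c1 n(n-1)/2, and for even n this forces c1 to
    be even.\<close>
  have "lead dvd c1"
  proof (cases "odd n")
    case False
    then obtain m where m: "n = 2 * m" by blast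
    have "S dp = S (\<lambda>j. p (j + 1)) - S p" by (simp add: d sum_subtractf)
    also have "S (\<lambda>j. p (j + 1)) = S p"
      using sum_periodic_shift[of p 1] principal_periodic'(1)[OF assms] by (simp add: periodic_def add.commute)
    finally have "S dp = 0" by simp
    moreover have "int n dvd S dp - S (\<lambda>j. dp 0 + c1 * j)"
      using slope_eq[OF sl(1)] by (intro S_cong) (simp add: algebra_simps)
    ultimately have "int n dvd - (int n * dp 0 + c1 * (\<Sum>k<n. int k))"
      by (simp add: sum.distrib sum_distrib_left)
    hence "int n dvd int n * dp 0 + c1 * (\<Sum>k<n. int k)" by (simp only: dvd_minus_iff)
    hence "int n dvd c1 * (\<Sum>k<n. int k)" by (simp add: dvd_add_right_iff)
    moreover have "(\<Sum>k<n. int k) = int m * (int n - 1)" using double_sum_n by (simp add: m)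
    ultimately have "int m * 2 dvd int m * (c1 * (int n - 1))" by (simp add: m ac_simps)
    moreover have "int m \<noteq> 0" using m n_pos by simp
    ultimately have "2 dvd c1 * (int n - 1)" by (simp only: dvd_mult_cancel_left) simp
    moreover have "odd (int n - 1)" using False by simp
    ultimately have "even c1" by (simp add: even_mult_iff)
    thus ?thesis using False by (simp add: lead_def)
  qed (simp add: lead_def)
  thus ?thesis using that[of c1] sl(1) 2 3 unfolding second_diff_def d by blast
qed

subsection \<open>An echelon basis\<close>

lemma periodic_delta: "periodic (\<lambda>j. if int n dvd j - i then s else 0)"
proof -
  have "int n dvd j + int n - i \<longleftrightarrow> int n dvd j - i" for j
    using dvd_add_left_iff[of "int n" "int n" "j - i"] by (simp add: algebra_simps)
  thus ?thesis by (simp add: periodic_def)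
qed

text \<open>A periodic function of slope 1. The free correction s of the period sum sits at the last
  index n - 1, so that the early entries, where pivots are read, equal j.\<close>

definition saw :: "int \<Rightarrow> int \<Rightarrow> int" where
  "saw s j = j mod int n + (if int n dvd j - (- 1) then s else 0)"

lemma periodic_saw: "periodic (saw s)"
  unfolding saw_def by (intro periodic_add periodic_delta) (simp add: periodic_def)

lemma slope_saw:
  assumes "int n dvd s"
  shows "slope (saw s) 1"
proof -
  have "slope (\<lambda>j. j mod int n) 1" unfolding slope_def
  proof
    fix j
    have "int n dvd ((j + 1) mod int n - (j + 1)) - (j mod int n - j)"
      by (intro dvd_diff[of "int n" "(j + 1) mod int n - (j + 1)" "j mod int n - j"]) (simp_all add: mod_eq_dvd_iff[symmetric])
    thus "int n dvd (j + 1) mod int n - j mod int n - 1" by (simp add: algebra_simps)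
  qed
  moreover have "slope (\<lambda>j. if int n dvd j - (- 1) then s else 0) 0" by (rule slope_multiple) (simp add: assms)
  ultimately show ?thesis using slope_add[of "\<lambda>j. j mod int n" 1] by (simp only: saw_def[abs_def] add_0_right) (metis add_0_right)
qed

lemma S_saw: "S (saw s) = (\<Sum>k<n. int k) + s"
proof -
  have "S (saw s) = (\<Sum>k<n. int k mod int n) + S (\<lambda>j. if int n dvd j - (- 1) then s else 0)"
    by (simp only: saw_def sum.distrib)
  also have "(\<Sum>k<n. int k mod int n) = (\<Sum>k<n. int k)" by (intro sum.cong refl) simp
  finally show ?thesis by (simp only: S_delta_at)
qed

lemma saw_small: "0 \<le> j \<Longrightarrow> j < int n - 1 \<Longrightarrow> saw s j = j"
  by (auto simp: saw_def dest: zdvd_imp_le)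

lemma principal_saw:
  "\<exists>s. principal (saw 0) (saw s) (\<lambda>_. 0)" "\<exists>s. principal (\<lambda>_. 0) (saw 0) (saw s)"
proof -
  define s where "s = - (int n * (int n - 1))"
  \<comment> \<open>The two sawtooth sums add up to n(n-1), which n divides whatever its parity, so
    slopes cause no factor 2.\<close>
  have s: "S (saw 0) + S (saw s) = 0" using double_sum_n by (simp add: S_saw s_def)
  have d: "int n dvd s" by (simp add: s_def)
  have "principal (saw 0) (saw s) (\<lambda>_. 0)"
    by (rule principal_affine[OF _ slope_saw slope_saw slope_const])
      (use s d in \<open>simp_all add: sum_zero_def periodic_saw periodic_const\<close>)
  thus "\<exists>s. principal (saw 0) (saw s) (\<lambda>_. 0)" by blast
  have "principal (\<lambda>_. 0) (saw 0) (saw s)"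
    by (rule principal_affine[OF _ slope_const slope_saw slope_saw])
      (use s d in \<open>simp_all add: sum_zero_def periodic_saw periodic_const\<close>)
  thus "\<exists>s. principal (\<lambda>_. 0) (saw 0) (saw s)" by blast
qed

definition peak :: "int \<Rightarrow> int \<Rightarrow> int" where
  "peak i j = (if int n dvd j - i then int n else 0)"

lemma periodic_peak: "periodic (peak i)" and S_peak: "S (peak i) = int n" and slope_peak: "slope (peak i) 0"
  unfolding peak_def using periodic_delta[of i "int n"] S_delta_at[of i "int n"]
  by (simp_all add: slope_multiple)

lemma peak_small: "0 \<le> i \<Longrightarrow> i < int n \<Longrightarrow> 0 \<le> j \<Longrightarrow> j < int n \<Longrightarrow> peak i j = (if i = j then int n else 0)"
proof -
  assume *: "0 \<le> i" "i < int n" "0 \<le> j" "j < int n"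
  have "int n dvd j - i \<longleftrightarrow> j mod int n = i mod int n" by (simp add: mod_eq_dvd_iff)
  thus ?thesis using * by (auto simp: peak_def)
qed

lemma sum_zero_peaks: 
  "sum_zero (peak i) (\<lambda>_. 0) (\<lambda>j. -1 * peak k j)"
  "sum_zero (\<lambda>_. 0) (peak i) (\<lambda>j. -1 * peak k j)"
  "sum_zero (\<lambda>_. 0) (\<lambda>_. 0) (\<lambda>j. peak i j + -1 * peak k j)"
  using S_peak by (auto simp only: sum_zero_def periodic_const sum.distrib sum_distrib_left[symmetric]
    intro!: periodic_add periodic_cmult periodic_peak) simp_all

lemma principal_peaks: 
  "principal (peak i) (\<lambda>_. 0) (\<lambda>j. -1 * peak k j)"
  "principal (\<lambda>_. 0) (peak i) (\<lambda>j. -1 * peak k j)"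
  "principal (\<lambda>_. 0) (\<lambda>_. 0) (\<lambda>j. peak i j + -1 * peak k j)"
  by (rule principal_multiple[OF sum_zero_peaks(1)] principal_multiple[OF sum_zero_peaks(2)]
    principal_multiple[OF sum_zero_peaks(3)]; simp add: peak_def)+

lemma principal_consts:
  "principal (\<lambda>_. 1) (\<lambda>_. 0) (\<lambda>_. -1)" "principal (\<lambda>_. 0) (\<lambda>_. 1) (\<lambda>_. -1)"
  by (rule principal_affine[OF _ slope_const slope_const slope_const]; simp add: sum_zero_def periodic_const)+

lemma principal_const_c: "principal (\<lambda>_. 0) (\<lambda>_. 0) (\<lambda>j. 1 + -1 * peak (-1) j)"
proof (rule principal_affine[OF _ slope_const slope_const])
  show "slope (\<lambda>j. 1 + -1 * peak (-1) j) (0 + -1 * 0)"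
    by (intro slope_add slope_const slope_cmult slope_peak)
  have "S (\<lambda>j. 1 + -1 * peak (-1) j) = 0"
    using S_peak[of "-1"] by (simp only: sum.distrib sum_distrib_left[symmetric]) simp
  moreover have "periodic (\<lambda>j. 1 + -1 * peak (-1) j)"
    by (intro periodic_add periodic_const periodic_cmult periodic_peak)
  ultimately show "sum_zero (\<lambda>_. 0) (\<lambda>_. 0) (\<lambda>j. 1 + -1 * peak (-1) j)"
    by (simp add: sum_zero_def periodic_const)
qed simp

lemma principal_quadratic:
  "\<exists>p q r. principal p q r \<and> p 0 = 0 \<and> p 1 = 0 \<and> p 2 = lead"
proof -
  obtain p q r where 1: "principal p q r" "second_diff p lead" "second_diff q lead" "second_diff r lead"
    using principal_quadratic_exists by blast
  obtain s where 2: "principal (saw 0) (saw s) (\<lambda>_. 0)" using principal_saw(1) by blast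
  have "int n dvd p (0 + 1 + 1) - p (0 + 1) - (p (0 + 1) - p 0) - lead"
    using 1(2) slopeD unfolding second_diff_def by blast
  hence "int n dvd p 2 - 2 * p 1 + p 0 - lead" by (simp add: algebra_simps)
  then obtain k where k: "p 2 - 2 * p 1 + p 0 - lead = int n * k" by blast
  \<comment> \<open>The constant clears the entry at 0, the multiple of \<open>saw 0\<close> the
    entry at 1. The entry at 2 becomes p(2) - 2 p(1) + p(0), which the peak corrects by n k to
    \<open>lead\<close>.\<close>
  have "\<exists>q' r'. principal (\<lambda>j. p j + (- p 0 * 1 + ((p 0 - p 1) * saw 0 j + - k * peak 2 j))) q' r'"
    using principal_add[OF 1(1) principal_add[OF principal_cmult[OF principal_consts(1)]
      principal_add[OF principal_cmult[OF 2] principal_cmult[OF principal_peaks(1)]]]] by blast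
  then obtain q' r' where pr: "principal (\<lambda>j. p j + (- p 0 * 1 + ((p 0 - p 1) * saw 0 j + - k * peak 2 j))) q' r'"
    by blast
  have "saw 0 0 = 0" "saw 0 1 = 1" "saw 0 2 = 2" using n_ge by (auto intro!: saw_small)
  moreover have "peak 2 0 = 0" "peak 2 1 = 0" "peak 2 2 = int n" using n_ge by (simp_all add: peak_small)
  ultimately show ?thesis using k by (intro exI conjI) (rule pr, simp_all add: algebra_simps)
qed

definition entry :: "(int \<Rightarrow> int) \<Rightarrow> (int \<Rightarrow> int) \<Rightarrow> (int \<Rightarrow> int) \<Rightarrow> nat \<Rightarrow> int" where
  "entry p q r i = (if i < n then p (int i) else if i < 2 * n then q (int i - int n) else r (int i - 2 * int n))"

text \<open>Indices 0, n and 2n carry the free values at 0 of the three families, 1 and n + 1 the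
  free slopes of p and q, and 2 the common second difference. At 2n + 1 the slope of r is already
  determined by the slope relation.\<close>

definition pivot :: "nat \<Rightarrow> int" where
  "pivot t = (if t = 2 then lead else if t \<in> {0, 1, n, n + 1, 2 * n} then 1 else int n)"

lemma echelon_element:
  assumes "t < 3 * n - 1"
  shows "\<exists>p q r. principal p q r \<and> (\<forall>i<t. entry p q r i = 0) \<and> entry p q r t = pivot t"
proof -
  have w: ?thesis if "principal p q r" "\<forall>i<t. entry p q r i = 0" "entry p q r t = pivot t" for p q r
    using that by blast
  consider "t = 0" | "t = 1" | "t = 2" | "3 \<le> t" "t < n" | "t = n" | "t = n + 1" | "n + 2 \<le> t" "t < 2 * n"
    | "t = 2 * n" | "2 * n < t" by linarith
  thus ?thesis
  proof cases
    case 1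
    show ?thesis by (rule w[OF principal_consts(1)]) (use n_ge 1 in \<open>auto simp: entry_def pivot_def\<close>)
  next
    case 2
    obtain s where pr: "principal (saw 0) (saw s) (\<lambda>_. 0)" using principal_saw(1) by blast
    show ?thesis by (rule w[OF pr]) (use n_ge 2 in \<open>auto simp: entry_def pivot_def saw_small\<close>)
  next
    case 3
    obtain p q r where pr: "principal p q r" and p: "p 0 = 0" "p 1 = 0" "p 2 = lead" using principal_quadratic by blast
    show ?thesis by (rule w[OF pr]) (use n_ge p 3 in \<open>auto simp: entry_def pivot_def less_2_cases_iff\<close>)
  next
    case 4
    show ?thesis by (rule w[OF principal_peaks(1)[of "int t" 0]]) (use n_ge 4 in \<open>auto simp: entry_def pivot_def peak_small\<close>)
  next
    case 5
    show ?thesis by (rule w[OF principal_consts(2)]) (use n_ge 5 in \<open>auto simp: entry_def pivot_def\<close>)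
  next
    case 6
    obtain s where pr: "principal (\<lambda>_. 0) (saw 0) (saw s)" using principal_saw(2) by blast
    show ?thesis by (rule w[OF pr]) (use n_ge 6 in \<open>auto simp: entry_def pivot_def saw_small\<close>)
  next
    case 7
    show ?thesis by (rule w[OF principal_peaks(2)[of "int t - int n" 0]]) (use n_ge 7 in \<open>auto simp: entry_def pivot_def peak_small\<close>)
  next
    case 8
    have "peak (-1) 0 = 0" using n_ge by (simp add: peak_def)
    thus ?thesis by (intro w[OF principal_const_c]) (use n_ge 8 in \<open>auto simp: entry_def pivot_def\<close>)
  next
    case 9
    \<comment> \<open>Within the last family the compensating peak goes to index n - 1, the final
      coordinate, which carries no pivot.\<close>
    have "peak (int t - 2 * int n) (int i - 2 * int n) = 0" if "2 * n \<le> i" "i < t" for i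
      using 9 assms that by (subst peak_small) auto
    moreover have "peak (int n - 1) (int i - 2 * int n) = 0" if "2 * n \<le> i" "i \<le> t" for i
      using 9 assms that by (subst peak_small) auto
    moreover have "peak (int t - 2 * int n) (int t - 2 * int n) = int n" by (simp add: peak_def)
    ultimately show ?thesis
      by (intro w[OF principal_peaks(3)[of "int t - 2 * int n" "int n - 1"]]) (use n_ge 9 in \<open>auto simp: entry_def pivot_def\<close>)
  qed
qed

text \<open>Each vanishing entry removes an invariant modulo n: p(0) = p(1) = 0 makes p(2) congruent
  to the second difference, and p(2) = 0 then kills it. Next q(0) = q(1) = 0 kills the slope of q,
  and the slope relation kills the slope of r, so the entries that follow are multiples of
  n.\<close>

lemma pivot_dvd_entry:
  assumes pr: "principal p q r" and t: "t < 3 * n - 1" and zero: "\<And>i. i < t \<Longrightarrow> entry p q r i = 0"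
  shows "pivot t dvd entry p q r t"
proof -
  have p0: "p (int i) = 0" if "i < n" "i < t" for i using zero[of i] that by (simp add: entry_def)
  have q0: "q (int i) = 0" if "i < n" "i + n < t" for i using zero[of "i + n"] that by (simp add: entry_def)
  have r0: "r 0 = 0" if "2 * n < t" using zero[of "2 * n"] that by (simp add: entry_def)
  obtain c where c: "second_diff p c" "second_diff q c" "second_diff r c" "lead dvd c"
    by (rule principal_second_diff[OF pr], rule that)
  have c2: "int n dvd p 2 - c" if "2 \<le> t"
    using slopeD[OF c(1)[unfolded second_diff_def], of 0] p0[of 0] p0[of 1] that n_ge by simp
  have flat: "int n dvd p j" "slope p 0" "slope q (q 1 - q 0)" "slope r (r 1 - r 0)" if "3 \<le> t" for j
  proof -
    have "int n dvd c - 0" using c2 p0[of 2] that n_ge by (simp add: dvd_minus_iff)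
    hence sd: "second_diff p 0" "second_diff q 0" "second_diff r 0"
      using c slope_cong unfolding second_diff_def by blast+
    show s: "slope q (q 1 - q 0)" "slope r (r 1 - r 0)" using sd second_diff_slope by blast+
    show s: "slope p 0" using second_diff_slope[OF sd(1)] p0[of 0] p0[of 1] that n_ge by simp
    show "int n dvd p j" using slope_eq[OF s, of j] p0[of 0] that n_ge by simp
  qed
  consider "t \<in> {0, 1, n, n + 1, 2 * n}" | "t = 2" | "3 \<le> t" "t < n" | "n + 2 \<le> t" "t < 2 * n" | "2 * n < t"
    by fastforce
  thus ?thesis
  proof cases
    case 1
    thus ?thesis using n_ge by (auto simp: pivot_def)
  next
    case 2
    have "lead dvd int n" by (simp add: lead_def)
    hence "lead dvd p 2 - c" using c2 2 dvd_trans by blast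
    from dvd_add[OF this c(4)] show ?thesis using 2 n_ge by (simp add: pivot_def entry_def)
  next
    case 3
    thus ?thesis using flat(1) by (simp add: pivot_def entry_def)
  next
    case 4
    have "q 0 = 0" "q 1 = 0" using q0[of 0] q0[of 1] 4 n_ge by auto
    hence "int n dvd q (int t - int n)" using flat(3) slope_eq[of q 0] 4 n_ge by simp
    thus ?thesis using 4 n_ge by (simp add: pivot_def entry_def)
  next
    case 5
    have t3: "3 \<le> t" using 5 n_ge by simp
    have "q 0 = 0" "q 1 = 0" using q0[of 0] q0[of 1] 5 n_ge by auto
    hence "slope q 0" using flat(3)[OF t3] by simp
    hence "int n dvd 0 - 0 + (r 1 - r 0)" by (rule principal_slope_rel[OF pr flat(2)[OF t3] _ flat(4)[OF t3]])
    hence "slope r 0" using slope_cong[OF flat(4)[OF t3], of 0] by simp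
    hence "int n dvd r (int t - 2 * int n)" using slope_eq[of r 0 "int t - 2 * int n"] r0 5 by simp
    thus ?thesis using 5 n_ge by (simp add: pivot_def entry_def)
  qed
qed

lemma prod_pivot: "(\<Prod>t<3 * n - 1. pivot t) = lead * int n ^ (3 * n - 7)"
proof -
  let ?A = "{0, 1, 2, n, n + 1, 2 * n}"
  have sub: "?A \<subseteq> {..<3 * n - 1}" using n_ge by auto
  \<comment> \<open>The bound on n keeps these six indices distinct; the other 3n - 7 pivots are
    n.\<close>
  have card: "card ?A = 6" using n_ge by simp
  have "(\<Prod>t<3 * n - 1. pivot t) = (\<Prod>t\<in>?A. pivot t) * (\<Prod>t\<in>{..<3 * n - 1} - ?A. pivot t)"
    by (subst prod.subset_diff[OF sub]) (simp_all only: finite_lessThan mult.commute)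
  also have "(\<Prod>t\<in>?A. pivot t) = lead" using n_ge by (simp add: pivot_def)
  also have "(\<Prod>t\<in>{..<3 * n - 1} - ?A. pivot t) = (\<Prod>t\<in>{..<3 * n - 1} - ?A. int n)"
    by (intro prod.cong refl) (auto simp: pivot_def)
  also have "\<dots> = int n ^ (3 * n - 7)" using card_Diff_subset[OF _ sub] card by simp
  finally show ?thesis .
qed

lemma entry_sum:
  assumes "principal p q r"
  shows "(\<Sum>i<3 * n. entry p q r i) = 0"
proof -
  have split: "(\<Sum>i<m + n. f i) = (\<Sum>i<m. f i) + (\<Sum>i<n. f (i + m))" for m and f :: "nat \<Rightarrow> int"
    using sum.atLeastLessThan_concat[of 0 m "m + n" f] sum.shift_bounds_nat_ivl[of f 0 m n]
    by (simp add: lessThan_atLeast0 add.commute)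
  have "3 * n = n + n + n" by simp
  hence "(\<Sum>i<3 * n. entry p q r i) = (\<Sum>i<n + n + n. entry p q r i)" by (simp only:)
  also have "\<dots> = S p + S q + S r"
    unfolding split by (intro arg_cong2[of _ _ _ _ "(+)"] sum.cong refl) (auto simp: entry_def)
  finally show ?thesis using principal_degree[OF assms] by simp
qed

end

subsection \<open>Volumes of lattices with an echelon basis\<close>

lemma det_Ints:
  fixes A :: "'a :: comm_ring_1 mat"
  assumes "A \<in> carrier_mat m m" and "\<And>i j. i < m \<Longrightarrow> j < m \<Longrightarrow> A $$ (i, j) \<in> \<int>"
  shows "det A \<in> \<int>"
  unfolding det_def'[OF assms(1)]
  by (intro Ints_sum Ints_mult Ints_prod)
    (auto simp: sign_def intro!: assms(2) dest: permutes_in_image)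

text \<open>Compare traces: tr(PQ) = k and tr(QP) = m agree, and the characteristic is 0.\<close>

lemma dim_eq_if_inverse:
  fixes P :: "'a :: field_char_0 mat"
  assumes P: "P \<in> carrier_mat k m" and Q: "Q \<in> carrier_mat m k"
    and PQ: "P * Q = 1\<^sub>m k" and QP: "Q * P = 1\<^sub>m m"
  shows "k = m"
proof -
  have tr: "(\<Sum>i<a. (R * T) $$ (i, i)) = (\<Sum>i<a. \<Sum>j<b. R $$ (i, j) * T $$ (j, i))"
    if "R \<in> carrier_mat a b" "T \<in> carrier_mat b a" for R T :: "'a mat" and a b
    using that by (intro sum.cong refl) (auto simp: scalar_prod_def lessThan_atLeast0)
  have "of_nat k = (\<Sum>i<k. (P * Q) $$ (i, i))" by (simp add: PQ)
  also have "\<dots> = (\<Sum>j<m. \<Sum>i<k. P $$ (i, j) * Q $$ (j, i))"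
    unfolding tr[OF P Q] by (rule sum.swap)
  also have "\<dots> = (\<Sum>j<m. (Q * P) $$ (j, j))"
    unfolding tr[OF Q P] by (simp add: mult.commute)
  also have "\<dots> = of_nat m" by (simp add: QP)
  finally show ?thesis by simp
qed

lemma lattice_basis_change:
  assumes vs: "is_lattice_basis N vs L" and ws: "is_lattice_basis N ws L"
  obtains P where "P \<in> carrier_mat (length ws) (length vs)"
    "\<And>i j. i < length ws \<Longrightarrow> j < length vs \<Longrightarrow> P $$ (i, j) \<in> \<int>"
    "mat_of_cols N vs = mat_of_cols N ws * P"
proof -
  let ?m = "length vs" and ?k = "length ws"
  have "\<exists>c. c \<in> carrier_vec ?k \<and> (\<forall>i<?k. c $ i \<in> \<int>) \<and> vs ! j = mat_of_cols N ws *\<^sub>v c" if j: "j < ?m" for j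
  proof -
    have v: "vs ! j \<in> carrier_vec N" using vs j by (auto simp: is_lattice_basis_def)
    have "mat_of_cols N vs *\<^sub>v unit_vec ?m j = vs ! j"
      using j v by (intro eq_vecI) (auto simp: mat_of_cols_index)
    hence "vs ! j \<in> L" using vs j
      by (auto simp: is_lattice_basis_def unit_vec_def intro!: exI[of _ "unit_vec ?m j"])
    thus ?thesis using ws by (auto simp: is_lattice_basis_def)
  qed
  then obtain c where c: "\<And>j. j < ?m \<Longrightarrow> c j \<in> carrier_vec ?k \<and> (\<forall>i<?k. c j $ i \<in> \<int>) \<and> vs ! j = mat_of_cols N ws *\<^sub>v c j"
    by metis
  define P where "P = mat ?k ?m (\<lambda>(i, j). c j $ i)"
  have P: "P \<in> carrier_mat ?k ?m" by (simp add: P_def)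
  have C: "mat_of_cols N ws \<in> carrier_mat N ?k" by simp
  have col: "col P j = c j" if "j < ?m" for j
    using c[OF that] that by (intro eq_vecI) (auto simp: P_def)
  have eq: "mat_of_cols N vs = mat_of_cols N ws * P"
  proof (rule mat_col_eqI)
    fix j assume "j < dim_col (mat_of_cols N ws * P)"
    hence j: "j < ?m" using P by simp
    have v: "vs ! j \<in> carrier_vec N" using vs j by (auto simp: is_lattice_basis_def)
    have "col (mat_of_cols N ws * P) j = mat_of_cols N ws *\<^sub>v col P j"
      by (rule col_mult2[OF C P j])
    thus "col (mat_of_cols N vs) j = col (mat_of_cols N ws * P) j"
      using c[OF j] col[OF j] j v by simp
  qed (use P in auto)
  have int: "P $$ (i, j) \<in> \<int>" if "i < ?k" "j < ?m" for i j using c that by (simp add: P_def)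
  show ?thesis by (rule that[OF P int eq])
qed

lemma lattice_basis_cancel:
  assumes vs: "is_lattice_basis N vs L" and R: "R \<in> carrier_mat (length vs) (length vs)"
    and eq: "mat_of_cols N vs = mat_of_cols N vs * R"
  shows "R = 1\<^sub>m (length vs)"
proof (rule mat_col_eqI)
  let ?m = "length vs" and ?A = "mat_of_cols N vs"
  have A: "?A \<in> carrier_mat N ?m" by simp
  fix j assume "j < dim_col (1\<^sub>m ?m)"
  hence j: "j < ?m" by simp
  have c: "col R j \<in> carrier_vec ?m" "unit_vec ?m j \<in> carrier_vec ?m" using R j by auto
  have "?A *\<^sub>v col R j = col ?A j" using col_mult2[OF A R j] eq by simp
  moreover have "?A *\<^sub>v unit_vec ?m j = col ?A j"
    using col_mult2[OF A one_carrier_mat j] j A by simp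
  ultimately have "?A *\<^sub>v (col R j - unit_vec ?m j) = 0\<^sub>v N"
    using mult_minus_distrib_mat_vec[OF A c] A j by simp
  hence "col R j - unit_vec ?m j = 0\<^sub>v ?m" using vs c by (simp add: is_lattice_basis_def)
  hence "(col R j - unit_vec ?m j) $ i = 0" if "i < ?m" for i using that by simp
  hence "col R j $ i = unit_vec ?m j $ i" if "i < ?m" for i using that c by simp
  thus "col R j = col (1\<^sub>m ?m) j" using R j by (intro eq_vecI) auto
qed (use R in auto)

text \<open>Two bases are related by mutually inverse integer matrices, whose determinants have
  square 1, so the Gram determinant does not change. This determines the value of the definite
  description.\<close>

lemma lattice_volume_eq:
  assumes vs: "is_lattice_basis N vs L"
  shows "lattice_volume N L = sqrt (det (transpose_mat (mat_of_cols N vs) * mat_of_cols N vs))"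
  unfolding lattice_volume_def
proof (rule the_equality)
  show "\<exists>ws. is_lattice_basis N ws L \<and> sqrt (det (transpose_mat (mat_of_cols N vs) * mat_of_cols N vs)) =
      sqrt (det (transpose_mat (mat_of_cols N ws) * mat_of_cols N ws))"
    using vs by blast
next
  fix V assume "\<exists>ws. is_lattice_basis N ws L \<and> V = sqrt (det (transpose_mat (mat_of_cols N ws) * mat_of_cols N ws))"
  then obtain ws where ws: "is_lattice_basis N ws L"
    and V: "V = sqrt (det (transpose_mat (mat_of_cols N ws) * mat_of_cols N ws))" by blast
  let ?A = "mat_of_cols N vs" and ?C = "mat_of_cols N ws" and ?m = "length vs" and ?k = "length ws"
  obtain P where P: "P \<in> carrier_mat ?k ?m" "\<And>i j. i < ?k \<Longrightarrow> j < ?m \<Longrightarrow> P $$ (i, j) \<in> \<int>" "?A = ?C * P"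
    by (rule lattice_basis_change[OF vs ws], rule that)
  obtain Q where Q: "Q \<in> carrier_mat ?m ?k" "\<And>i j. i < ?m \<Longrightarrow> j < ?k \<Longrightarrow> Q $$ (i, j) \<in> \<int>" "?C = ?A * Q"
    by (rule lattice_basis_change[OF ws vs], rule that)
  have A: "?A \<in> carrier_mat N ?m" and C: "?C \<in> carrier_mat N ?k" by simp_all
  have "?A = ?A * (Q * P)" by (simp only: assoc_mult_mat[OF A Q(1) P(1), symmetric] Q(3)[symmetric] P(3)[symmetric])
  hence QP: "Q * P = 1\<^sub>m ?m" by (intro lattice_basis_cancel[OF vs] mult_carrier_mat[OF Q(1) P(1)])
  have "?C = ?C * (P * Q)" by (simp only: assoc_mult_mat[OF C P(1) Q(1), symmetric] Q(3)[symmetric] P(3)[symmetric])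
  hence PQ: "P * Q = 1\<^sub>m ?k" by (intro lattice_basis_cancel[OF ws] mult_carrier_mat[OF P(1) Q(1)])
  have km: "?k = ?m" by (rule dim_eq_if_inverse[OF P(1) Q(1) PQ QP])
  have P': "P \<in> carrier_mat ?k ?k" and Q': "Q \<in> carrier_mat ?k ?k" using P Q km by auto
  have "det P * det Q = 1" using det_mult[OF P' Q'] PQ by simp
  moreover have "det P \<in> \<int>" "det Q \<in> \<int>" using det_Ints[OF P'] det_Ints[OF Q'] P(2) Q(2) km by auto
  then obtain a b :: int where "det P = of_int a" "det Q = of_int b" by (auto elim!: Ints_cases)
  ultimately have ab: "a * b = 1" "det P = of_int a" by (auto simp flip: of_int_mult)
  hence "a * a = 1" using zmult_eq_1_iff by fastforce
  hence dP: "det P * det P = 1" using ab(2) by (simp flip: of_int_mult)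
  have C': "transpose_mat ?C \<in> carrier_mat ?k N" and T: "transpose_mat P \<in> carrier_mat ?k ?k"
    using C P' by (simp_all only: transpose_carrier_mat)
  note CP = mult_carrier_mat[OF C P'] and CC = mult_carrier_mat[OF C' C]
  have "transpose_mat ?A * ?A = (transpose_mat P * transpose_mat ?C) * (?C * P)"
    using transpose_mult[OF C P'] P(3) by simp
  also have "\<dots> = transpose_mat P * (transpose_mat ?C * ?C * P)"
    by (simp only: assoc_mult_mat[OF T C' CP] assoc_mult_mat[OF C' C P'])
  finally have "transpose_mat ?A * ?A = transpose_mat P * (transpose_mat ?C * ?C * P)" .
  hence "det (transpose_mat ?A * ?A) = det P * (det (transpose_mat ?C * ?C) * det P)"
    using det_mult[OF CC P'] det_mult[OF T mult_carrier_mat[OF CC P']] det_transpose[OF P'] by simp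
  also have "\<dots> = det (transpose_mat ?C * ?C)" using dP by (simp add: mult.left_commute)
  finally show "V = sqrt (det (transpose_mat ?A * ?A))" using V by simp
qed

text \<open>Adjoin a column of ones, giving B. It is orthogonal to the columns of A and has square
  length m + 1, so the Gram determinant is multiplied by m + 1. Left multiplication by R adds all
  rows to the last one, which becomes (0, ..., 0, m + 1); hence det B is m + 1 times the product of
  the pivots. Comparing det(B)^2 with the Gram determinant leaves one factor m + 1.\<close>

lemma sum_zero_gram_det:
  fixes A :: "'a :: field_char_0 mat"
  assumes A: "A \<in> carrier_mat (Suc m) m"
    and zero: "\<And>j. j < m \<Longrightarrow> (\<Sum>i\<le>m. A $$ (i, j)) = 0"
    and tri: "\<And>i j. i < j \<Longrightarrow> j < m \<Longrightarrow> A $$ (i, j) = 0"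
  shows "det (transpose_mat A * A) = of_nat (Suc m) * (\<Prod>i<m. A $$ (i, i)) ^ 2"
proof -
  define B where "B = mat (Suc m) (Suc m) (\<lambda>(i, j). if j < m then A $$ (i, j) else 1)"
  define R where "R = mat (Suc m) (Suc m) (\<lambda>(i, j). if i = j \<or> i = m then 1 else 0 :: 'a)"
  define T where "T = mat m m (\<lambda>(i, j). A $$ (i, j))"
  have c: "B \<in> carrier_mat (Suc m) (Suc m)" "R \<in> carrier_mat (Suc m) (Suc m)" "T \<in> carrier_mat m m"
    by (simp_all add: B_def R_def T_def)
  have gram: "(transpose_mat M * M) $$ (i, j) = (\<Sum>k\<le>m. M $$ (k, i) * M $$ (k, j))"
    if "M \<in> carrier_mat (Suc m) l" "i < l" "j < l" for M :: "'a mat" and l i j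
    using that by (auto simp: scalar_prod_def atLeast0LessThan lessThan_Suc_atMost intro!: sum.cong)
  have Bij: "B $$ (i, j) = (if j < m then A $$ (i, j) else 1)" if "i \<le> m" "j \<le> m" for i j
    using that by (simp add: B_def)
  define W where "W = transpose_mat A * A"
  have W: "W \<in> carrier_mat m m" using A by (simp add: W_def)
  have "transpose_mat B * B = four_block_mat (W) (0\<^sub>m m 1) (0\<^sub>m 1 m) (mat 1 1 (\<lambda>_. of_nat (Suc m)))"
  proof (rule eq_matI)
    fix i j
    assume "i < dim_row (four_block_mat (W) (0\<^sub>m m 1) (0\<^sub>m 1 m) (mat 1 1 (\<lambda>_. of_nat (Suc m) :: 'a)))"
      "j < dim_col (four_block_mat (W) (0\<^sub>m m 1) (0\<^sub>m 1 m) (mat 1 1 (\<lambda>_. of_nat (Suc m) :: 'a)))"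
    hence ij: "i < Suc m" "j < Suc m" using W by auto
    have "(transpose_mat B * B) $$ (i, j) =
        (\<Sum>k\<le>m. (if i < m then A $$ (k, i) else 1) * (if j < m then A $$ (k, j) else 1))"
      unfolding gram[OF c(1) ij] using ij by (intro sum.cong refl) (simp add: Bij)
    also have "\<dots> = four_block_mat W (0\<^sub>m m 1) (0\<^sub>m 1 m) (mat 1 1 (\<lambda>_. of_nat (Suc m))) $$ (i, j)"
      using ij W zero gram[OF A, of i j] by (cases "i < m"; cases "j < m") (auto simp: W_def[symmetric])
    finally show "(transpose_mat B * B) $$ (i, j) =
      four_block_mat (W) (0\<^sub>m m 1) (0\<^sub>m 1 m) (mat 1 1 (\<lambda>_. of_nat (Suc m))) $$ (i, j)" .
  qed (use W c in auto)
  hence "det (transpose_mat B * B) = det (transpose_mat A * A) * of_nat (Suc m)"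
    using W by (simp add: det_four_block_mat_lower_left_zero[of _ m _ 1] det_single W_def)
  moreover have "det (transpose_mat B * B) = det B ^ 2"
    using det_mult[of "transpose_mat B" "Suc m" B] c det_transpose[OF c(1)] by (simp add: power2_eq_square)
  moreover have "R * B = four_block_mat T (mat m 1 (\<lambda>_. 1)) (0\<^sub>m 1 m) (mat 1 1 (\<lambda>_. of_nat (Suc m)))"
  proof (rule eq_matI)
    fix i j
    assume "i < dim_row (four_block_mat T (mat m 1 (\<lambda>_. 1)) (0\<^sub>m 1 m) (mat 1 1 (\<lambda>_. of_nat (Suc m) :: 'a)))"
      "j < dim_col (four_block_mat T (mat m 1 (\<lambda>_. 1)) (0\<^sub>m 1 m) (mat 1 1 (\<lambda>_. of_nat (Suc m) :: 'a)))"
    hence ij: "i < Suc m" "j < Suc m" using c by auto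
    have "(R * B) $$ (i, j) = (\<Sum>k\<le>m. (if i = k \<or> i = m then 1 else 0) * (if j < m then A $$ (k, j) else 1))"
      using ij by (simp add: R_def B_def scalar_prod_def atLeast0LessThan lessThan_Suc_atMost)
    also have "\<dots> = (if i < m then if j < m then A $$ (i, j) else 1 else if j < m then 0 else of_nat (Suc m))"
    proof (cases "i < m")
      case True
      hence "(\<Sum>k\<le>m. (if i = k \<or> i = m then 1 else 0) * (if j < m then A $$ (k, j) else 1))
        = (\<Sum>k\<le>m. if k = i then (if j < m then A $$ (k, j) else 1) else 0)"
        by (intro sum.cong refl) auto
      thus ?thesis using True by simp
    next
      case False
      thus ?thesis using ij zero[of j] by (auto simp: less_Suc_eq)
    qed
    finally show "(R * B) $$ (i, j) = four_block_mat T (mat m 1 (\<lambda>_. 1)) (0\<^sub>m 1 m) (mat 1 1 (\<lambda>_. of_nat (Suc m))) $$ (i, j)"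
      using ij c by (auto simp: T_def)
  qed (use c in auto)
  hence "det (R * B) = det T * of_nat (Suc m)"
    using c by (simp add: det_four_block_mat_lower_left_zero[of _ m _ 1] det_single)
  moreover have "det (R * B) = det B"
  proof -
    have "det R = prod_list (diag_mat R)"
      by (rule det_lower_triangular[OF _ c(2)]) (auto simp: R_def)
    also have "diag_mat R = replicate (Suc m) 1"
      by (auto simp: diag_mat_def R_def intro!: nth_equalityI simp del: upt_Suc replicate_Suc)
    finally have "det R = 1" by simp
    thus ?thesis using det_mult[OF c(2,1)] by simp
  qed
  moreover have "det T = (\<Prod>i<m. A $$ (i, i))"
  proof -
    have "det T = prod_list (diag_mat T)"
      by (rule det_lower_triangular[OF _ c(3)]) (use tri in \<open>auto simp: T_def\<close>)
    also have "diag_mat T = map (\<lambda>i. A $$ (i, i)) [0..<m]"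
      by (auto simp: diag_mat_def T_def)
    finally show ?thesis by (simp add: prod.list_conv_set_nth atLeast0LessThan)
  qed
  ultimately have "det (transpose_mat A * A) * of_nat (Suc m) = of_nat (Suc m) * (\<Prod>i<m. A $$ (i, i)) ^ 2 * of_nat (Suc m)"
    by (simp only: power2_eq_square mult_ac)
  moreover have "(of_nat (Suc m) :: 'a) \<noteq> 0" by (simp only: of_nat_eq_0_iff)
  ultimately show ?thesis by (simp only: mult_cancel_right simp_thms)
qed

text \<open>Gaussian elimination over the integers: the divisibility hypothesis allows the leading
  entry to be removed by an integer multiple of the matching echelon vector.\<close>

lemma echelon_span:
  fixes G :: "(nat \<Rightarrow> int) set" and g :: "nat \<Rightarrow> nat \<Rightarrow> int"
  assumes g: "\<And>t. t < m \<Longrightarrow> g t \<in> G" "\<And>i t. i < t \<Longrightarrow> t < m \<Longrightarrow> g t i = 0"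
    and comb: "\<And>u v k. u \<in> G \<Longrightarrow> v \<in> G \<Longrightarrow> (\<lambda>i. u i + k * v i) \<in> G"
    and zero: "\<And>v. v \<in> G \<Longrightarrow> (\<Sum>i\<le>m. v i) = 0"
    and dvd: "\<And>v t. v \<in> G \<Longrightarrow> t < m \<Longrightarrow> (\<And>i. i < t \<Longrightarrow> v i = 0) \<Longrightarrow> g t t dvd v t"
    and v: "v \<in> G"
  shows "\<exists>c. \<forall>i\<le>m. v i = (\<Sum>t<m. c t * g t i)"
proof -
  have "\<exists>c. \<forall>i\<le>m. v i = (\<Sum>t=s..<m. c t * g t i)" if "s \<le> m" "v \<in> G" "\<And>i. i < s \<Longrightarrow> v i = 0" for s v
    using that
  proof (induction "m - s" arbitrary: s v)
    case 0
    \<comment> \<open>Only the last coordinate is left, and it equals the coordinate sum, which is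
      0.\<close>
    hence "(\<Sum>i\<le>m. v i) = (\<Sum>i\<le>m. if i = m then v m else 0)" by (intro sum.cong refl) auto
    hence "v m = 0" using zero[OF 0(3)] by simp
    hence "\<forall>i\<le>m. v i = 0" using 0 by (metis diff_is_0_eq le_neq_implies_less order_trans less_le_trans)
    thus ?case using 0 by auto
  next
    case (Suc l)
    have s: "s < m" using Suc(2) by simp
    obtain a where a: "v s = g s s * a" using dvd[OF Suc(4) s Suc(5)] by blast
    have "\<exists>c. \<forall>i\<le>m. v i + - a * g s i = (\<Sum>t=Suc s..<m. c t * g t i)"
    proof (rule Suc(1))
      show "(\<lambda>i. v i + - a * g s i) \<in> G" by (intro comb Suc(4) g s)
      show "v i + - a * g s i = 0" if "i < Suc s" for i
        using that Suc(5)[of i] g(2)[of i s] s a by (cases "i = s") (auto simp: less_Suc_eq)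
    qed (use Suc(2) s in auto)
    then obtain c where c: "\<forall>i\<le>m. v i + - a * g s i = (\<Sum>t=Suc s..<m. c t * g t i)" by blast
    have "v i = (\<Sum>t=s..<m. (c(s := a)) t * g t i)" if "i \<le> m" for i
    proof -
      have "(\<Sum>t=s..<m. (c(s := a)) t * g t i) = a * g s i + (\<Sum>t=Suc s..<m. (c(s := a)) t * g t i)"
        using s by (simp add: sum.atLeast_Suc_lessThan)
      also have "(\<Sum>t=Suc s..<m. (c(s := a)) t * g t i) = (\<Sum>t=Suc s..<m. c t * g t i)"
        by (intro sum.cong refl) auto
      also have "\<dots> = v i + - a * g s i" using c that by simp
      finally show ?thesis by simp
    qed
    thus ?case by blast
  qed
  from this[of 0 v] v show ?thesis by (auto simp: lessThan_atLeast0)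
qed

lemma echelon_lattice_volume:
  fixes G :: "(nat \<Rightarrow> int) set" and g :: "nat \<Rightarrow> nat \<Rightarrow> int"
  assumes g: "\<And>t. t < m \<Longrightarrow> g t \<in> G" "\<And>i t. i < t \<Longrightarrow> t < m \<Longrightarrow> g t i = 0"
    and nz: "\<And>t. t < m \<Longrightarrow> g t t \<noteq> 0"
    and G0: "(\<lambda>_. 0) \<in> G"
    and comb: "\<And>u v k. u \<in> G \<Longrightarrow> v \<in> G \<Longrightarrow> (\<lambda>i. u i + k * v i) \<in> G"
    and zero: "\<And>v. v \<in> G \<Longrightarrow> (\<Sum>i\<le>m. v i) = 0"
    and dvd: "\<And>v t. v \<in> G \<Longrightarrow> t < m \<Longrightarrow> (\<And>i. i < t \<Longrightarrow> v i = 0) \<Longrightarrow> g t t dvd v t"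
  shows "lattice_volume (Suc m) ((\<lambda>v. vec (Suc m) (\<lambda>i. real_of_int (v i))) ` G)
    = sqrt (real (Suc m)) * \<bar>\<Prod>t<m. real_of_int (g t t)\<bar>"
proof -
  define vs where "vs = map (\<lambda>t. vec (Suc m) (\<lambda>i. real_of_int (g t i))) [0..<m]"
  let ?A = "mat_of_cols (Suc m) vs"
  have len: "length vs = m" by (simp add: vs_def)
  have A: "?A \<in> carrier_mat (Suc m) m" using len by auto
  have Aij: "?A $$ (i, t) = real_of_int (g t i)" if "i \<le> m" "t < m" for i t
    using that by (simp add: mat_of_cols_index len) (simp add: vs_def)
  have Ac: "(?A *\<^sub>v c) $ i = (\<Sum>t<m. real_of_int (g t i) * c $ t)" if "i \<le> m" "c \<in> carrier_vec m" for c i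
  proof -
    have "(?A *\<^sub>v c) $ i = (\<Sum>t<m. ?A $$ (i, t) * c $ t)"
      using that A by (auto simp: scalar_prod_def atLeast0LessThan)
    also have "\<dots> = (\<Sum>t<m. real_of_int (g t i) * c $ t)" by (intro sum.cong refl) (use that Aij in auto)
    finally show ?thesis .
  qed
  have "is_lattice_basis (Suc m) vs ((\<lambda>v. vec (Suc m) (\<lambda>i. real_of_int (v i))) ` G)"
    unfolding is_lattice_basis_def len
  proof (intro conjI ballI impI)
    show "set vs \<subseteq> carrier_vec (Suc m)" by (auto simp: vs_def)
  next
    fix c assume c: "c \<in> carrier_vec m" "?A *\<^sub>v c = 0\<^sub>v (Suc m)"
    have "c $ t = 0" if "t < m" for t
      using that
    proof (induction t rule: less_induct)
      case (less t)
      have "0 = (?A *\<^sub>v c) $ t" using c less(2) by simp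
      also have "\<dots> = (\<Sum>s<m. if s = t then real_of_int (g t t) * c $ t else 0)"
        unfolding Ac[OF less_imp_le[OF less(2)] c(1)]
      proof (intro sum.cong refl)
        fix s assume "s \<in> {..<m}"
        thus "real_of_int (g s t) * c $ s = (if s = t then real_of_int (g t t) * c $ t else 0)"
          using less.IH[of s] g(2)[of t s] by (cases s t rule: linorder_cases) auto
      qed
      finally show ?case using nz[OF less(2)] less(2) by simp
    qed
    thus "c = 0\<^sub>v m" using c by (intro eq_vecI) auto
  next
    show "(\<lambda>v. vec (Suc m) (\<lambda>i. real_of_int (v i))) ` G = {?A *\<^sub>v c |c. c \<in> carrier_vec m \<and> (\<forall>i<m. c $ i \<in> \<int>)}"
    proof (intro equalityI subsetI)
      fix w assume "w \<in> (\<lambda>v. vec (Suc m) (\<lambda>i. real_of_int (v i))) ` G"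
      then obtain v where v: "v \<in> G" "w = vec (Suc m) (\<lambda>i. real_of_int (v i))" by blast
      have "\<exists>c. \<forall>i\<le>m. v i = (\<Sum>t<m. c t * g t i)"
        by (rule echelon_span[of m g G v]; fact g comb zero dvd v)
      then obtain c where c: "\<forall>i\<le>m. v i = (\<Sum>t<m. c t * g t i)" by blast
      have "w = ?A *\<^sub>v vec m (\<lambda>t. real_of_int (c t))"
      proof (rule eq_vecI)
        fix i assume "i < dim_vec (?A *\<^sub>v vec m (\<lambda>t. real_of_int (c t)))"
        hence i: "i \<le> m" using A by simp
        show "w $ i = (?A *\<^sub>v vec m (\<lambda>t. real_of_int (c t))) $ i"
          using i c v by (subst Ac) (auto simp: mult.commute intro!: sum.cong)
      qed (use A v in auto)
      thus "w \<in> {?A *\<^sub>v c |c. c \<in> carrier_vec m \<and> (\<forall>i<m. c $ i \<in> \<int>)}" by auto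
    next
      fix w assume "w \<in> {?A *\<^sub>v c |c. c \<in> carrier_vec m \<and> (\<forall>i<m. c $ i \<in> \<int>)}"
      then obtain c :: "real vec" where c: "w = ?A *\<^sub>v c" "c \<in> carrier_vec m" "\<forall>i<m. c $ i \<in> \<int>" by blast
      define d where "d = (\<lambda>t. \<lfloor>c $ t\<rfloor>)"
      have d: "c $ t = real_of_int (d t)" if "t < m" for t
      proof -
        obtain k where "c $ t = of_int k" using c(3) \<open>t < m\<close> by (meson Ints_cases)
        thus ?thesis by (simp add: d_def)
      qed
      have "(\<lambda>i. \<Sum>t<s. d t * g t i) \<in> G" if "s \<le> m" for s
        using that by (induction s) (auto simp: G0 g intro!: comb)
      hence "(\<lambda>i. \<Sum>t<m. d t * g t i) \<in> G" by blast
      moreover have "w = vec (Suc m) (\<lambda>i. real_of_int (\<Sum>t<m. d t * g t i))"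
      proof (rule eq_vecI)
        fix i assume "i < dim_vec (vec (Suc m) (\<lambda>i. real_of_int (\<Sum>t<m. d t * g t i)))"
        hence i: "i \<le> m" by simp
        show "w $ i = vec (Suc m) (\<lambda>i. real_of_int (\<Sum>t<m. d t * g t i)) $ i"
          using i d unfolding c(1) Ac[OF i c(2)] by (auto simp: mult.commute intro!: sum.cong)
      qed (use A c in auto)
      ultimately show "w \<in> (\<lambda>v. vec (Suc m) (\<lambda>i. real_of_int (v i))) ` G" by (intro image_eqI)
    qed
  qed
  note lattice_volume_eq[OF this]
  also have "det (transpose_mat ?A * ?A) = real (Suc m) * (\<Prod>i<m. ?A $$ (i, i)) ^ 2"
  proof (rule sum_zero_gram_det[OF A])
    fix j assume j: "j < m"
    have "(\<Sum>i\<le>m. ?A $$ (i, j)) = real_of_int (\<Sum>i\<le>m. g j i)" using Aij j by simp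
    thus "(\<Sum>i\<le>m. ?A $$ (i, j)) = 0" using zero[OF g(1)[OF j]] by simp
  qed (use Aij g(2) in auto)
  also have "(\<Prod>i<m. ?A $$ (i, i)) = (\<Prod>t<m. real_of_int (g t t))" using Aij by (intro prod.cong) auto
  finally show ?thesis by (simp add: real_sqrt_mult)
qed

subsection \<open>The volume of the Fermat lattice\<close>

context fermat
begin

lemma special_point_cusps:
  "i < n \<Longrightarrow> special_point n \<zeta> \<epsilon> i = pa (int i)"
  "n \<le> i \<Longrightarrow> i < 2 * n \<Longrightarrow> special_point n \<zeta> \<epsilon> i = pb (int i - int n)"
  "2 * n \<le> i \<Longrightarrow> special_point n \<zeta> \<epsilon> i = pc (int i - 2 * int n)"
proof -
  assume "n \<le> i" "i < 2 * n"
  moreover from this have "int i - int n = int (i - n)" by simp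
  ultimately show "special_point n \<zeta> \<epsilon> i = pb (int i - int n)"
    by (simp only: special_point_def pb_def power_int_of_nat) simp
next
  assume "2 * n \<le> i"
  moreover from this have "int i - 2 * int n = int (i - 2 * n)" by simp
  ultimately show "special_point n \<zeta> \<epsilon> i = pc (int i - 2 * int n)"
    using n_pos by (simp only: special_point_def pc_def power_int_of_nat) simp
qed (simp add: special_point_def pa_def)

lemma special_points_eq: "special_points n \<zeta> \<epsilon> = range pa \<union> range pb \<union> range pc"
proof
  show "special_points n \<zeta> \<epsilon> \<subseteq> range pa \<union> range pb \<union> range pc"
    unfolding special_points_def
  proof
    fix Q assume "Q \<in> special_point n \<zeta> \<epsilon> ` {..<3 * n}"
    then obtain i where "Q = special_point n \<zeta> \<epsilon> i" by blast
    thus "Q \<in> range pa \<union> range pb \<union> range pc"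
      using special_point_cusps[of i] by (metis UnCI linorder_not_le rangeI)
  qed
next
  have red: "\<exists>l<n. pa j = pa (int l) \<and> pb j = pb (int l) \<and> pc j = pc (int l)" for j
  proof -
    have l: "nat (j mod int n) < n" "int (nat (j mod int n)) = j mod int n" using n_pos by (simp_all add: nat_less_iff)
    have "pa j = pa (j mod int n) \<and> pb j = pb (j mod int n) \<and> pc j = pc (j mod int n)"
      using cusps_periodic[of "j mod int n" "j div int n"] by (simp add: add.commute)
    thus ?thesis using l by (intro exI[of _ "nat (j mod int n)"]) simp
  qed
  have "pa j \<in> special_points n \<zeta> \<epsilon> \<and> pb j \<in> special_points n \<zeta> \<epsilon> \<and> pc j \<in> special_points n \<zeta> \<epsilon>" for j
  proof -
    obtain l where l: "l < n" "pa j = pa (int l)" "pb j = pb (int l)" "pc j = pc (int l)" using red by blast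
    have "special_point n \<zeta> \<epsilon> l = pa j" "special_point n \<zeta> \<epsilon> (l + n) = pb j" "special_point n \<zeta> \<epsilon> (l + 2 * n) = pc j"
      using l special_point_cusps(1)[of l] special_point_cusps(2)[of "l + n"] special_point_cusps(3)[of "l + 2 * n"]
      by simp_all
    moreover have "l < 3 * n" "l + n < 3 * n" "l + 2 * n < 3 * n" using l by simp_all
    ultimately show ?thesis unfolding special_points_def by (metis imageI lessThan_iff)
  qed
  thus "range pa \<union> range pb \<union> range pc \<subseteq> special_points n \<zeta> \<epsilon>" by blast
qed

lemma generic_not_special:
  assumes "a \<noteq> 0" "b \<noteq> 0"
  shows "proj_point a b 1 \<notin> special_points n \<zeta> \<epsilon>"
proof -
  have m: "(a, b, 1) \<in> proj_point a b 1" unfolding proj_point_def by (auto intro!: exI[of _ 1])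
  have "(a, b, 1) \<notin> pa j" "(a, b, 1) \<notin> pb j" "(a, b, 1) \<notin> pc j" for j
    using assms by (auto simp: pa_def pb_def pc_def proj_point_def)
  thus ?thesis using m unfolding special_points_eq by blast
qed

lemma special_units_eq: "special_units n \<zeta> \<epsilon> y = U"
proof (intro equalityI subsetI)
  fix z assume z: "z \<in> special_units n \<zeta> \<epsilon> y"
  show "z \<in> U" unfolding U_iff
  proof (intro conjI allI impI)
    fix a b :: complex assume ab: "a \<noteq> 0" "b \<noteq> 0" "a ^ n + b ^ n = 1"
    show "val (proj_point a b 1) z = 0"
      using z generic_not_special[OF ab(1,2)] fermat_curve_affine[OF ab(3)] unfolding special_units_def by blast
  qed (use z in \<open>auto simp: special_units_def\<close>)
next
  fix z assume z: "z \<in> U"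
  have "Q \<in> special_points n \<zeta> \<epsilon>" if "Q \<in> fermat_curve n" "val Q z \<noteq> 0" for Q
    using that(1)
    by (cases rule: curve_point_cases) (use z that(2) in \<open>auto simp: U_iff special_points_eq\<close>)
  thus "z \<in> special_units n \<zeta> \<epsilon> y" using z U_nz unfolding special_units_def by simp
qed

lemma fermat_lattice_eq: 
  "fermat_lattice n \<zeta> \<epsilon> y = (\<lambda>v. vec (3 * n) (\<lambda>i. real_of_int (v i))) ` {entry p q r | p q r. principal p q r}"
proof -
  have e: "vec (3 * n) (\<lambda>i. real_of_int (val (special_point n \<zeta> \<epsilon> i) z)) =
    vec (3 * n) (\<lambda>i. real_of_int (entry (va z) (vb z) (vc z) i))" for z
    using special_point_cusps by (intro eq_vecI) (simp_all add: entry_def)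
  have "{entry p q r | p q r. principal p q r} = (\<lambda>z. entry (va z) (vb z) (vc z)) ` U"
    unfolding principal_def by blast
  thus ?thesis unfolding fermat_lattice_def special_units_eq e by (simp only: image_image)
qed

lemma fermat_lattice_volume:
  "lattice_volume (3 * n) (fermat_lattice n \<zeta> \<epsilon> y) = sqrt (3 * real n) * (real_of_int lead * real n ^ (3 * n - 7))"
proof -
  let ?G = "{entry p q r | p q r. principal p q r}"
  have "\<exists>v. \<forall>t<3 * n - 1. v t \<in> ?G \<and> (\<forall>i<t. v t i = 0) \<and> v t t = pivot t"
    using echelon_element by (intro choice_iff'[THEN iffD1]) blast
  then obtain g where g: "\<And>t. t < 3 * n - 1 \<Longrightarrow> g t \<in> ?G \<and> (\<forall>i<t. g t i = 0) \<and> g t t = pivot t" by blast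
  \<comment> \<open>Degree 0 determines the last of the 3n coordinates, so the rank is 3n -
    1.\<close>
  have N: "3 * n = Suc (3 * n - 1)" using n_pos by simp
  have vol: "lattice_volume (Suc (3 * n - 1)) ((\<lambda>v. vec (Suc (3 * n - 1)) (\<lambda>i. real_of_int (v i))) ` ?G)
    = sqrt (real (Suc (3 * n - 1))) * \<bar>\<Prod>t<3 * n - 1. real_of_int (g t t)\<bar>"
  proof (rule echelon_lattice_volume[of "3 * n - 1" g])
    show "(\<lambda>_. 0) \<in> ?G"
      by (intro CollectI exI[of _ "\<lambda>_. 0"] conjI principal_0) (simp add: entry_def fun_eq_iff)
    show "(\<lambda>i. u i + k * v i) \<in> ?G" if "u \<in> ?G" "v \<in> ?G" for u v k
    proof -
      from that obtain p q r p' q' r' where "principal p q r" "u = entry p q r" "principal p' q' r'" "v = entry p' q' r'"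
        by blast
      hence "principal (\<lambda>j. p j + k * p' j) (\<lambda>j. q j + k * q' j) (\<lambda>j. r j + k * r' j)"
        "(\<lambda>i. u i + k * v i) = entry (\<lambda>j. p j + k * p' j) (\<lambda>j. q j + k * q' j) (\<lambda>j. r j + k * r' j)"
        by (auto simp: entry_def fun_eq_iff intro!: principal_add principal_cmult)
      thus ?thesis by blast
    qed
    show "(\<Sum>i\<le>3 * n - 1. v i) = 0" if "v \<in> ?G" for v
      using that entry_sum N by (auto simp flip: lessThan_Suc_atMost)
    show "g t t dvd v t" if "v \<in> ?G" "t < 3 * n - 1" "\<And>i. i < t \<Longrightarrow> v i = 0" for v t
      using that pivot_dvd_entry g by auto
    show "g t t \<noteq> 0" if "t < 3 * n - 1" for t
      using g[OF that] n_pos by (auto simp: pivot_def lead_def)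
  qed (use g in blast)+
  have "lattice_volume (3 * n) (fermat_lattice n \<zeta> \<epsilon> y) = sqrt (real (3 * n)) * \<bar>\<Prod>t<3 * n - 1. real_of_int (g t t)\<bar>"
    unfolding fermat_lattice_eq using vol[folded N] .
  also have "(\<Prod>t<3 * n - 1. real_of_int (g t t)) = real_of_int (\<Prod>t<3 * n - 1. pivot t)"
    unfolding of_int_prod using g by (intro prod.cong refl) auto
  also have "\<bar>real_of_int (\<Prod>t<3 * n - 1. pivot t)\<bar> = real_of_int lead * real n ^ (3 * n - 7)"
    unfolding prod_pivot by (simp add: lead_def)
  finally show ?thesis by simp
qed

end

theorem theorem3p18:
  fixes n :: nat and \<zeta> \<epsilon> :: complex and y :: ambient
  assumes "n \<ge> 4"
    and "is_primitive_root n 1 \<zeta>"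
    and "is_primitive_root n (-1) \<epsilon>"
    and "gen_x ^ n + y ^ n = 1"
  shows "lattice_volume (3 * n) (fermat_lattice n \<zeta> \<epsilon> y) =
    (if odd n then sqrt (3 * real n) * real n ^ (3 * n - 7)
     else 2 * sqrt (3 * real n) * real n ^ (3 * n - 7))"
proof -
  interpret fermat n \<zeta> \<epsilon> y
    using assms by unfold_locales
  show ?thesis
    using fermat_lattice_volume by (simp add: lead_def)
qed

end
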